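(* Let $0<q<1$, $N,n\ge1$ finite and $m\ge2N$. Put $\mathbb L_{ij}^{\rm seed}=\{\mathbb A_i^+,\mathbb A_j^-\}$, $\mathbb R_q=\mathbb U_q^+(\mathbb U_q^-)^{-1}$ and $\boldsymbol\Omega_{j}=\mathbb R_q\mathbb A_j^-\mathbb R_q^{-1}-\mathbb A_j^-$. Then for all labels $i,j\in\{1,\dots,N\}$, $$\{\mathbb D_{i,q}^+,\mathbb D_{j,q}^-\}=\mathbb G^{\rm PBW}_{m,N}(\mathbb U_q^+)^{-1}\Big(\mathbb L_{ij}^{\rm seed}+\{\mathbb A_i^+,\boldsymbol\Omega_{j}\}\Big)\mathbb U_q^+(\mathbb G^{\rm PBW}_{m,N})^{-1}.$$
   Context: **Coordinates.** $[r]_q=\frac{1-q^r}{1-q}$, $\gamma_q=\frac{1+q}2$, $c_r=\gamma_q[r]_{q^2}=\frac12[2r]_q$, $c_r!=\prod_{t=1}^rc_t$, $[r]_q!=\prod_{t=1}^r[t]_q$. For $1\le k\le N$, $1\le a\le m$ let $z_{ka},\bar z_{ka}$ be independent commuting variables; $f_a,f_a^\dagger$ is a Witt basis of the complex Clifford algebra $\mathrm{Cl}_{2m}$: $\{f_a,f_b\}=\{f_a^\dagger,f_b^\dagger\}=0$, $\{f_a,f_b^\dagger\}=\delta_{ab}$. $\mathscr P^{\rm sc}_{m,N}=\mathbb C[z_{ka},\bar z_{ka}]$, $\mathscr P^{\rm Cl}_{m,N}=\mathscr P^{\rm sc}_{m,N}\otimes\mathrm{Cl}_{2m}$ ($\mathbb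 Z_2$-graded by Clifford parity). $H_{ij}=\sum_az_{ia}\bar z_{ja}$, $\partial_{Z_k}=\sum_af_a^\dagger\partial_{z_{ka}}$, $\partial_{Z_k^\dagger}=\sum_af_a\partial_{\bar z_{ka}}$ (Clifford elements act by left multiplication), $\Delta_{ij}=\sum_a\partial_{z_{ia}}\partial_{\bar z_{ja}}$. $\ddagger$ is the order-preserving antilinear involution $z\leftrightarrow\bar z$, $f_a\leftrightarrow f_a^\dagger$, $\vartheta\leftrightarrow\bar\vartheta$, $a\leftrightarrow b$ (fermionic symbols below), and $X^\ddagger=\ddagger X\ddagger$ on operators. **Capelli contractions.** $\delta_a$ is the odd antiderivation of Clifford coefficients with $\delta_a(f_b)=\delta_{ab}$, $\delta_a(f_b^\dagger)=0$. $\mathfrak s_i=\sum_a\delta_a\partial_{z_{ia}}$, $\mathcal E^z_{ji}=\sum_az_{ja}\partial_{z_{ia}}$, $(\mathcal C_z)_{ij}=m\delta_{ij}+\mathcal E^z_{ji}$ (an $N\times N$ matrix of operators, invertible on columns of polynomials in each homogeneous degree for $m\ge2N$). $\mathfrak n_i^+=\sum_\ell(\mathcal C_z^{-1})_{i\ell}\mathfrak s_\ell$, $\mathfrak n_i^-=(\mathfrak n_i^+)^\ddagger$. **Gauge.** For $m\ge 2N$ every $P\in\mathscr P^{\rm sc}_{m,N}$ is uniquely a finite sum $P=\sum_{\alpha\in\mathbb N^{N\times N}}H^\alpha h_\alpha$ with $\Delta_{ij}h_\alpha=0$ for all $i,j$. $\mathbb G^{\rm nf}(H^\alpha h)=g_\alpha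 H^\alpha h$ for such $h$, with $g_\alpha=\prod_i\frac{\alpha_{ii}!}{c_{\alpha_{ii}}!}\prod_{i\ne j}\frac{\alpha_{ij}!}{[\alpha_{ij}]_q!}$. Let $\sigma_{\rm Ch}$ be the Chevalley symbol isomorphism from the Clifford algebra to the exterior algebra on $f_a,f_a^\dagger$; in the exterior model $\mathbb K=\frac12\sum_{i,j}H_{ij}\,\mathfrak n_j^-\mathfrak n_i^+$; $\mathbb W=\sigma_{\rm Ch}^{-1}\exp(\mathbb K)\sigma_{\rm Ch}$. $\mathbb G^{\rm PBW}_{m,N}=\mathbb W\,\mathbb G^{{\rm nf},\Lambda}\,\mathbb W^{-1}$, where $\mathbb G^{{\rm nf},\Lambda}$ is $\mathbb G^{\rm nf}$ acting coefficientwise in the exterior-symbol basis. It is extended by the identity on fermionic factors. **Fermionic data.** One pair: Grassmann generators $\vartheta,\bar\vartheta$ (odd), Weyl generators $a,b$ (even), $ab-ba=-2i$, $B=ba-i$. Put $s=\frac1nq^{2m-2n}[2n]_q$, $\sigma R(B)=R(B+2i)$; $\mathcal A_s^{\min}$ is the localization of $\mathbb C[B]$ at the multiplicative set generated by $\sigma^k(B-i),\sigma^k(s-2iB),\sigma^k(s+2iB)$, $k\in\mathbb Z$. $x_j=a^j$ ($j\ge0$), $x_j=b^{-j}$ ($j<0$); $\beta_j(B)=B+(2j-1)i$ for $j\ge1$ and $1$ for $j\le0$; $\alpha_j(B)=1$ for $j\ge0$ and $B+(2j+1)i$ for $j\le-1$. The charge-$c$ module ($c\in\mathbb Z$) is the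 free right $\mathcal A_s^{\min}$-module on $e_{0,c}=x_c$, $e_{\vartheta,c}=\vartheta x_{c+1}$, $e_{\bar\vartheta,c}=\bar\vartheta x_{c-1}$, $e_{2,c}=\vartheta\bar\vartheta x_c$. $\Phi_s(B)=\frac{4-s+2iB}{B-i}$, $\Psi_s(B)=\frac{-s-2iB}{B-i}$, $\sigma_c^+(B)=\beta_{c+1}(B)\Phi_s(B+2i(c+1))$, $\sigma_c^-(B)=\alpha_{c-1}(B)\Psi_s(B+2ic)$, $\pi_c^\pm=-\frac14\sigma_c^\pm$. Right-linear maps (zero on unlisted basis vectors): $\mathbb Q_c^+:e_{\vartheta,c}\mapsto e_{0,c}\pi_c^+,\ e_{2,c}\mapsto\frac1{2i}e_{\bar\vartheta,c}\beta_c$; $\mathbb h_c^+:e_{0,c}\mapsto e_{\vartheta,c}(\pi_c^+)^{-1},\ e_{\bar\vartheta,c}\mapsto2i\,e_{2,c}\beta_c^{-1}$. The minus maps are the $\ddagger$-conjugates ($c\leftrightarrow-c$): $\mathbb Q_c^-:e_{\bar\vartheta,c}\mapsto e_{0,c}\pi_c^-,\ e_{2,c}\mapsto\frac1{2i}e_{\vartheta,c}\alpha_c$; $\mathbb h_c^-:e_{0,c}\mapsto e_{\bar\vartheta,c}(\pi_c^-)^{-1},\ e_{\vartheta,c}\mapsto2i\,e_{2,c}\alpha_c^{-1}$. For $n$ pairs and $\mathbf c\in\mathbb Z^n$ take the graded tensor product of the one-pair modules; $\mathbb Q^\pm=\sum_j\widehat{\mathbb Q}_j^\pm$, $\mathbb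 h^\pm=\frac1n\sum_j\widehat{\mathbb h}_j^\pm$ (hats: graded embeddings in factor $j$). Let $\widehat{\mathsf P}_j^+$ be the projector on the span of $e_{\bar\vartheta,c_j},e_{2,c_j}$ in factor $j$ (killing $e_{0,c_j},e_{\vartheta,c_j}$), $\mathsf P_S^+=\prod_{j\in S}\widehat{\mathsf P}_j^+\prod_{j\notin S}(I-\widehat{\mathsf P}_j^+)$; $\kappa_c^+=-\frac14\sigma_c^+\alpha_c$, $K_c=\frac1{2i}\alpha_{c-1}\beta_c$, $\delta_m(q)=\frac{2m-[2m]_q}4$, and $$\mathbb M^+=\delta_m(q)I+\sum_{\varnothing\ne S}\mathsf P_S^+\Big(\sum_{j\in S}\kappa_{c_j}^+-|S|-B_q^{(|S|)}(E_{\bar z})\sum_{j\in S}K_{c_j}\Big),\qquad \mathbb N^+=-\mathbb h^+\mathbb M^+,$$ where $B_q^{(k)}(E_{\bar z})$ is the scalar $\frac{c_{r+k}}{r+k}$ on bosonic elements of antiholomorphic Euler degree $r$. $\mathbb M^-,\mathbb N^-$ are the $\ddagger$-conjugates (depending on the holomorphic Euler degree). $\mathscr F_k$ ($1\le k\le N$) is a copy, for label $k$, of the direct sum over $\mathbf c\in\mathbb Z^n$ of these modules; $\mathbb Q_k^\pm,\mathbb N_k^\pm$ are the corresponding operators, the Euler degree in $\mathbb N_k^+$ (resp. $\mathbb N_k^-$) being that in the variables $\bar z_k$ (resp. $z_k$), its coefficient acting on the bosonic factor. **Transport.** $\mathcal M=\mathscr P^{\rm Cl}_{m,N}\widehat\otimes\mathscr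 F_1\widehat\otimes\cdots\widehat\otimes\mathscr F_N$. With $(X\widehat\otimes Y)(F\otimes e)=(-1)^{|Y||F|}XF\otimes Ye$: $\mathbb A_k^+=\partial_{Z_k}\widehat\otimes I+I\widehat\otimes\mathbb Q_k^+$, $\mathbb A_k^-=(\mathbb A_k^+)^\ddagger$; $\mathbb H_i^\pm=\mathfrak n_i^\pm\widehat\otimes\mathbb N_i^\pm$, $\mathbb U_q^\pm=\exp(\sum_{i=1}^N\mathbb H_i^\pm)$; $\mathbb D_{k,q}^{\pm}=\mathbb G^{\rm PBW}_{m,N}(\mathbb U_q^\pm)^{-1}\mathbb A_k^\pm\,\mathbb U_q^\pm(\mathbb G^{\rm PBW}_{m,N})^{-1}$. *)

theory Defs
  imports
    Complex_Main
    "HOL-Library.Poly_Mapping"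
    "HOL-Library.Product_Lexorder"
    "HOL-Library.Cardinality"
    "HOL-Computational_Algebra.Fraction_Field"
begin

text \<open>
  The three sizes are type cardinalities: \<open>N = CARD('l)\<close> labels, \<open>m = CARD('m)\<close> bosonic
  coordinates, \<open>n = CARD('p)\<close> fermionic pairs per label.  The linear orders on these types stand
  for the orders of \<open>1..N\<close>, \<open>1..m\<close>, \<open>1..n\<close>; they enter only through ordered Clifford
  monomials and through the order of the graded tensor factors.  All spaces are free modules
  \<open>'b \<Rightarrow>\<^sub>0 'k\<close> on explicit bases \<open>'b\<close>.
\<close>

section \<open>Free modules and their linear maps\<close>

definition bas :: "'b \<Rightarrow> ('b \<Rightarrow>\<^sub>0 'k::zero_neq_one)" where
  "bas b = Poly_Mapping.single b 1"

definition scl :: "'k \<Rightarrow> ('b \<Rightarrow>\<^sub>0 'k) \<Rightarrow> ('b \<Rightarrow>\<^sub>0 'k::comm_ring_1)" where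
  "scl c x = Poly_Mapping.map ((*) c) x"

text \<open>The extension of a map on basis vectors that is semilinear along \<open>\<tau>\<close>, and its linear case.\<close>

definition semilin_ext ::
    "('k \<Rightarrow> 'k) \<Rightarrow> ('b \<Rightarrow> ('c \<Rightarrow>\<^sub>0 'k)) \<Rightarrow> ('b \<Rightarrow>\<^sub>0 'k) \<Rightarrow> ('c \<Rightarrow>\<^sub>0 'k::comm_ring_1)" where
  "semilin_ext \<tau> f x =
     (\<Sum>b\<in>Poly_Mapping.keys x. scl (\<tau> (Poly_Mapping.lookup x b)) (f b))"

definition lin_ext :: "('b \<Rightarrow> ('c \<Rightarrow>\<^sub>0 'k)) \<Rightarrow> ('b \<Rightarrow>\<^sub>0 'k) \<Rightarrow> ('c \<Rightarrow>\<^sub>0 'k::comm_ring_1)" where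
  "lin_ext f = semilin_ext (\<lambda>c. c) f"

lemma sum_singles:
  "(\<Sum>x\<in>Poly_Mapping.keys p. Poly_Mapping.single x (Poly_Mapping.lookup p x)) = p"
  by (rule poly_mapping_eqI) (auto simp: lookup_sum lookup_single when_def in_keys_iff)

lemma lookup_scl: "Poly_Mapping.lookup (scl c x) b = c * Poly_Mapping.lookup x b"
  unfolding scl_def by (simp add: Poly_Mapping.map.rep_eq when_def)

lemma scl_simps:
  "scl c (x + y) = scl c x + scl c y" "scl (c + d) x = scl c x + scl d x"
  "scl c (scl d x) = scl (c * d) x" "scl 1 x = x" "scl 0 x = 0" "scl c 0 = 0"
  "scl c (- x) = - scl c x" "scl (- c) x = - scl c x"
  "scl c (Poly_Mapping.single b d) = Poly_Mapping.single b (c * d)"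
  by (auto intro!: poly_mapping_eqI simp: lookup_scl lookup_add algebra_simps lookup_single when_def)

lemma semilin_ext_superset:
  assumes "finite S" "Poly_Mapping.keys x \<subseteq> S" "\<tau> 0 = 0"
  shows "semilin_ext \<tau> f x = (\<Sum>b\<in>S. scl (\<tau> (Poly_Mapping.lookup x b)) (f b))"
  unfolding semilin_ext_def using assms
  by (intro sum.mono_neutral_left) (auto simp: in_keys_iff scl_simps)

lemma semilin_ext_add:
  assumes "\<And>c d. \<tau> (c + d) = \<tau> c + \<tau> d"
  shows "semilin_ext \<tau> f (x + y) = semilin_ext \<tau> f x + semilin_ext \<tau> f y"
proof -
  have z: "\<tau> 0 = 0" using assms[of 0 0] by simp
  let ?S = "Poly_Mapping.keys x \<union> Poly_Mapping.keys y"
  have "finite ?S" by simp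
  then show ?thesis
    using Poly_Mapping.keys_add[of x y] z assms
    by (simp add: semilin_ext_superset[of ?S] lookup_add scl_simps flip: sum.distrib)
qed

lemma lin_ext_add: "lin_ext f (x + y) = lin_ext f x + lin_ext f y"
  unfolding lin_ext_def by (rule semilin_ext_add) simp

lemma lin_ext_0: "lin_ext f 0 = 0"
  unfolding lin_ext_def semilin_ext_def by simp

lemma lin_ext_single: "lin_ext f (Poly_Mapping.single b c) = scl c (f b)"
  unfolding lin_ext_def semilin_ext_def by (auto simp: scl_simps)

lemma additive_eqI:
  fixes F :: "('a \<Rightarrow>\<^sub>0 'b::comm_monoid_add) \<Rightarrow> ('c \<Rightarrow>\<^sub>0 'd::ab_group_add)"
  assumes "\<And>x y. F (x + y) = F x + F y" "\<And>x y. G (x + y) = G x + G y"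
    and "\<And>b c. F (Poly_Mapping.single b c) = G (Poly_Mapping.single b c)"
  shows "F x = G x"
proof -
  have F0: "F 0 = 0" using assms(1)[of 0 0] by simp
  have G0: "G 0 = 0" using assms(2)[of 0 0] by simp
  have "F (\<Sum>b\<in>S. Poly_Mapping.single b (Poly_Mapping.lookup p b)) =
        G (\<Sum>b\<in>S. Poly_Mapping.single b (Poly_Mapping.lookup p b))" for S p
    using assms F0 G0 by (induction S rule: infinite_finite_induct) auto
  from this[where p=x and S="Poly_Mapping.keys x"] show ?thesis by (simp add: sum_singles)
qed

text \<open>Tensors \<open>x \<otimes> y\<close>; the scalars of the first factor are mapped to those of the second by \<open>\<iota>\<close>.\<close>

definition tensor ::
    "('k \<Rightarrow> 'r) \<Rightarrow> ('b \<Rightarrow>\<^sub>0 'k::zero) \<Rightarrow> ('c \<Rightarrow>\<^sub>0 'r::comm_ring_1) \<Rightarrow> ('b \<times> 'c \<Rightarrow>\<^sub>0 'r)" where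
  "tensor \<iota> x y =
     (\<Sum>b\<in>Poly_Mapping.keys x. \<Sum>c\<in>Poly_Mapping.keys y.
        Poly_Mapping.single (b, c) (\<iota> (Poly_Mapping.lookup x b) * Poly_Mapping.lookup y c))"

definition op_tensor ::
    "(('b \<Rightarrow>\<^sub>0 'k) \<Rightarrow> ('b \<Rightarrow>\<^sub>0 'k)) \<Rightarrow> (('c \<Rightarrow>\<^sub>0 'k) \<Rightarrow> ('c \<Rightarrow>\<^sub>0 'k))
     \<Rightarrow> ('b \<times> 'c \<Rightarrow>\<^sub>0 'k) \<Rightarrow> ('b \<times> 'c \<Rightarrow>\<^sub>0 'k::comm_ring_1)" where
  "op_tensor X Y = lin_ext (\<lambda>(b, c). tensor (\<lambda>z. z) (X (bas b)) (Y (bas c)))"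

text \<open>The exponential of a locally nilpotent operator.\<close>

definition op_exp :: "(('b \<Rightarrow>\<^sub>0 'k) \<Rightarrow> ('b \<Rightarrow>\<^sub>0 'k)) \<Rightarrow> ('b \<Rightarrow>\<^sub>0 'k) \<Rightarrow> ('b \<Rightarrow>\<^sub>0 'k::field)" where
  "op_exp T x = (\<Sum>k | (T ^^ k) x \<noteq> 0. scl (inverse (of_nat (fact k))) ((T ^^ k) x))"

definition anticomm :: "('v \<Rightarrow> 'v) \<Rightarrow> ('v \<Rightarrow> 'v) \<Rightarrow> 'v \<Rightarrow> 'v::plus" where
  "anticomm X Y x = X (Y x) + Y (X x)"


section \<open>q-numbers\<close>

definition qint :: "real \<Rightarrow> nat \<Rightarrow> real" where
  "qint q r = (1 - q ^ r) / (1 - q)"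

definition c_q :: "real \<Rightarrow> nat \<Rightarrow> real" where
  "c_q q r = (1 + q) / 2 * qint (q\<^sup>2) r"

definition qfact :: "real \<Rightarrow> nat \<Rightarrow> real" where
  "qfact q r = (\<Prod>t=1..r. qint q t)"

definition cfact :: "real \<Rightarrow> nat \<Rightarrow> real" where
  "cfact q r = (\<Prod>t=1..r. c_q q t)"

definition s_q :: "real \<Rightarrow> nat \<Rightarrow> nat \<Rightarrow> real" where
  "s_q q m n = 1 / real n * q powi (2 * int m - 2 * int n) * qint q (2 * n)"


section \<open>Scalar polynomials\<close>

datatype ('l, 'm) bosvar = Z 'l 'm | Zb 'l 'm

type_synonym ('l, 'm) mono = "('l, 'm) bosvar \<Rightarrow>\<^sub>0 nat"
type_synonym ('l, 'm) psc = "('l, 'm) mono \<Rightarrow>\<^sub>0 complex"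

definition var :: "('l, 'm) bosvar \<Rightarrow> ('l, 'm) psc" where
  "var v = Poly_Mapping.single (Poly_Mapping.single v 1) 1"

definition pd :: "('l, 'm) bosvar \<Rightarrow> ('l, 'm) psc \<Rightarrow> ('l, 'm) psc" where
  "pd v = lin_ext (\<lambda>\<mu>. Poly_Mapping.single (\<mu> - Poly_Mapping.single v 1)
                          (of_nat (Poly_Mapping.lookup \<mu> v)))"

definition H :: "'l \<Rightarrow> 'l \<Rightarrow> ('l, 'm::finite) psc" where
  "H i j = (\<Sum>a\<in>UNIV. var (Z i a) * var (Zb j a))"

definition Lap :: "'l \<Rightarrow> 'l \<Rightarrow> ('l, 'm::finite) psc \<Rightarrow> ('l, 'm) psc" where
  "Lap i j p = (\<Sum>a\<in>UNIV. pd (Z i a) (pd (Zb j a) p))"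

definition harmonic :: "('l, 'm::finite) psc \<Rightarrow> bool" where
  "harmonic p \<longleftrightarrow> (\<forall>i j. Lap i j p = 0)"

fun bar_var :: "('l, 'm) bosvar \<Rightarrow> ('l, 'm) bosvar" where
  "bar_var (Z k a) = Zb k a"
| "bar_var (Zb k a) = Z k a"

definition dag_psc :: "('l, 'm) psc \<Rightarrow> ('l, 'm) psc" where
  "dag_psc = semilin_ext cnj (\<lambda>\<mu>. bas (Poly_Mapping.map_key bar_var \<mu>))"

definition z_degree :: "'l \<Rightarrow> ('l, 'm::finite) mono \<Rightarrow> nat" where
  "z_degree k \<mu> = (\<Sum>a\<in>UNIV. Poly_Mapping.lookup \<mu> (Z k a))"

definition zb_degree :: "'l \<Rightarrow> ('l, 'm::finite) mono \<Rightarrow> nat" where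
  "zb_degree k \<mu> = (\<Sum>a\<in>UNIV. Poly_Mapping.lookup \<mu> (Zb k a))"


section \<open>Clifford and exterior algebra\<close>

text \<open>
  The index \<open>(A, B)\<close> stands for the product \<open>f\<^sub>A f\<^sup>\<dagger>\<^sub>B\<close> with the factors in increasing order
  in \<open>A\<close> and in \<open>B\<close>.  These normally ordered monomials are a basis of \<open>Cl\<^sub>2\<^sub>m\<close>, and the
  corresponding wedge products are a basis of the exterior algebra; both algebras are therefore
  represented by the same type, and differ in their left multiplications (\<open>cl_f\<close>, \<open>cl_fd\<close>
  respectively \<open>ext_f\<close>, \<open>ext_fd\<close>).
\<close>

type_synonym 'm cidx = "'m set \<times> 'm set"
type_synonym 'm cl = "'m cidx \<Rightarrow>\<^sub>0 complex"

definition cl_one :: "'m cl" where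
  "cl_one = bas ({}, {})"

definition ksign :: "'m::linorder set \<Rightarrow> 'm \<Rightarrow> complex" where
  "ksign A a = (-1) ^ card {b\<in>A. b < a}"

definition ext_f :: "'m::linorder \<Rightarrow> 'm cl \<Rightarrow> 'm cl" where
  "ext_f a = lin_ext (\<lambda>(A, B). if a \<in> A then 0
                        else Poly_Mapping.single (insert a A, B) (ksign A a))"

definition ext_fd :: "'m::linorder \<Rightarrow> 'm cl \<Rightarrow> 'm cl" where
  "ext_fd a = lin_ext (\<lambda>(A, B). if a \<in> B then 0
                        else Poly_Mapping.single (A, insert a B) ((-1) ^ card A * ksign B a))"

text \<open>
  The odd antiderivations dual to \<open>f\<^sub>a\<close> and to \<open>f\<^sup>\<dagger>\<^sub>a\<close>.  They have the same matrix in the normally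
  ordered Clifford basis and in the wedge basis, because an antiderivation evaluates a monomial
  factor by factor; \<open>contr_f\<close> is \<open>\<delta>\<^sub>a\<close>.
\<close>

definition contr_f :: "'m::linorder \<Rightarrow> 'm cl \<Rightarrow> 'm cl" where
  "contr_f a = lin_ext (\<lambda>(A, B). if a \<in> A
                        then Poly_Mapping.single (A - {a}, B) (ksign A a) else 0)"

definition contr_fd :: "'m::linorder \<Rightarrow> 'm cl \<Rightarrow> 'm cl" where
  "contr_fd a = lin_ext (\<lambda>(A, B). if a \<in> B
                        then Poly_Mapping.single (A, B - {a}) ((-1) ^ card A * ksign B a) else 0)"

text \<open>Clifford left multiplication; the second summand of \<open>cl_fd\<close> is the normal reordering.\<close>

definition cl_f :: "'m::linorder \<Rightarrow> 'm cl \<Rightarrow> 'm cl" where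
  "cl_f a x = ext_f a x"

definition cl_fd :: "'m::linorder \<Rightarrow> 'm cl \<Rightarrow> 'm cl" where
  "cl_fd a x = ext_fd a x + contr_f a x"

text \<open>\<open>ordered_prod u v (A, B)\<close> is \<open>\<Prod>\<^sub>a\<^sub>\<in>\<^sub>A u a \<Prod>\<^sub>b\<^sub>\<in>\<^sub>B v b\<close>, increasing, applied to \<open>1\<close>.\<close>

definition ordered_prod ::
    "('m \<Rightarrow> 'm cl \<Rightarrow> 'm cl) \<Rightarrow> ('m \<Rightarrow> 'm cl \<Rightarrow> 'm cl) \<Rightarrow> 'm::linorder cidx \<Rightarrow> 'm cl" where
  "ordered_prod u v = (\<lambda>(A, B).
     foldr u (sorted_list_of_set A) (foldr v (sorted_list_of_set B) cl_one))"

text \<open>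
  The Chevalley symbol is \<open>x \<mapsto> \<gamma>(x) 1\<close> for the action of the Clifford algebra on the exterior
  algebra in which a vector \<open>v\<close> acts by \<open>v\<and> + \<iota>\<^sub>v\<close>, the contraction being taken with respect to
  the polarised form \<open>\<langle>f\<^sub>a, f\<^sup>\<dagger>\<^sub>b\<rangle> = \<delta>\<^sub>a\<^sub>b / 2\<close>.
\<close>

definition chev_f :: "'m::linorder \<Rightarrow> 'm cl \<Rightarrow> 'm cl" where
  "chev_f a x = ext_f a x + scl (1/2) (contr_fd a x)"

definition chev_fd :: "'m::linorder \<Rightarrow> 'm cl \<Rightarrow> 'm cl" where
  "chev_fd a x = ext_fd a x + scl (1/2) (contr_f a x)"

definition sigma_Ch :: "'m::linorder cl \<Rightarrow> 'm cl" where
  "sigma_Ch = lin_ext (ordered_prod chev_f chev_fd)"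

text \<open>
  The Witt relations of \<open>Cl\<^sub>2\<^sub>m\<close> and the antiderivation rule for \<open>\<delta>\<^sub>a\<close>.
\<close>

lemma ksign_insert:
  assumes "finite A" "b \<notin> A"
  shows "ksign (insert b A) a = (if b < a then - ksign A a else ksign A a)"
proof -
  have "{x\<in>insert b A. x < a} = (if b < a then insert b {x\<in>A. x < a} else {x\<in>A. x < a})"
    by auto
  then show ?thesis using assms by (simp add: ksign_def)
qed

lemma ksign_Diff:
  "finite A \<Longrightarrow> b \<in> A \<Longrightarrow> ksign (A - {b}) a = (if b < a then - ksign A a else ksign A a)"
  using ksign_insert[of "A - {b}" b a] by (auto simp: insert_absorb)

lemma ksign_cancel:
  "ksign A a * ksign A a = 1" "ksign A a * (ksign A a * c) = c" "ksign A a * (c * ksign A a) = c"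
proof -
  show 1: "ksign A a * ksign A a = 1" unfolding ksign_def by (simp flip: power_add)
  show "ksign A a * (ksign A a * c) = c" by (simp add: 1 flip: mult.assoc)
  then show "ksign A a * (c * ksign A a) = c" by (simp add: mult.commute)
qed

lemma sign_cancel: "((-1::complex) ^ n) * ((-1) ^ n * c) = c"
  by (simp flip: mult.assoc power_add)

lemma sign_pred: "finite A \<Longrightarrow> b \<in> A \<Longrightarrow> (-1::complex) ^ (card A - Suc 0) = - ((-1) ^ card A)"
  by (cases "card A") auto

lemmas generator_simps =
  ext_f_def ext_fd_def contr_f_def scl_simps lin_ext_add lin_ext_0 lin_ext_single
  ksign_insert ksign_Diff ksign_cancel sign_cancel sign_pred mult_ac

lemma generator_add:
  "ext_f a (x + y) = ext_f a x + ext_f a y"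
  "ext_fd a (x + y) = ext_fd a x + ext_fd a y"
  "contr_f a (x + y) = contr_f a x + contr_f a y"
  by (simp_all add: ext_f_def ext_fd_def contr_f_def lin_ext_add)

lemma ext_f_f:
  fixes x :: "'m::{finite,linorder} cl"
  shows "ext_f a (ext_f b x) + ext_f b (ext_f a x) = 0"
proof -
  have *: "ext_f a (ext_f b (Poly_Mapping.single (A, B) c)) + ext_f b (ext_f a (Poly_Mapping.single (A, B) c)) = (0)" for A B :: "'m set" and c
    using less_linear[of a b] by (auto simp: generator_simps insert_commute simp flip: single_add)
  show ?thesis
  proof (rule additive_eqI[where F="\<lambda>x. ext_f a (ext_f b x) + ext_f b (ext_f a x)" and G="\<lambda>x. 0"])
    show "ext_f a (ext_f b (x + y)) + ext_f b (ext_f a (x + y)) = ext_f a (ext_f b x) + ext_f b (ext_f a x) + (ext_f a (ext_f b y) + ext_f b (ext_f a y))" for x y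
      by (simp add: generator_add)
    show "(0::'m cl) = 0 + 0" for x y :: "'m cl"
      by simp
    show "ext_f a (ext_f b (Poly_Mapping.single S c)) + ext_f b (ext_f a (Poly_Mapping.single S c)) = (0)" for S c
      using *[of "fst S" "snd S" c] by (simp only: prod.collapse)
  qed
qed

lemma ext_f_fd:
  fixes x :: "'m::{finite,linorder} cl"
  shows "ext_f a (ext_fd b x) + ext_fd b (ext_f a x) = 0"
proof -
  have *: "ext_f a (ext_fd b (Poly_Mapping.single (A, B) c)) + ext_fd b (ext_f a (Poly_Mapping.single (A, B) c)) = (0)" for A B :: "'m set" and c
    using less_linear[of a b] by (auto simp: generator_simps simp flip: single_add)
  show ?thesis
  proof (rule additive_eqI[where F="\<lambda>x. ext_f a (ext_fd b x) + ext_fd b (ext_f a x)" and G="\<lambda>x. 0"])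
    show "ext_f a (ext_fd b (x + y)) + ext_fd b (ext_f a (x + y)) = ext_f a (ext_fd b x) + ext_fd b (ext_f a x) + (ext_f a (ext_fd b y) + ext_fd b (ext_f a y))" for x y
      by (simp add: generator_add)
    show "(0::'m cl) = 0 + 0" for x y :: "'m cl"
      by simp
    show "ext_f a (ext_fd b (Poly_Mapping.single S c)) + ext_fd b (ext_f a (Poly_Mapping.single S c)) = (0)" for S c
      using *[of "fst S" "snd S" c] by (simp only: prod.collapse)
  qed
qed

lemma ext_fd_fd:
  fixes x :: "'m::{finite,linorder} cl"
  shows "ext_fd a (ext_fd b x) + ext_fd b (ext_fd a x) = 0"
proof -
  have *: "ext_fd a (ext_fd b (Poly_Mapping.single (A, B) c)) + ext_fd b (ext_fd a (Poly_Mapping.single (A, B) c)) = (0)" for A B :: "'m set" and c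
    using less_linear[of a b] by (auto simp: generator_simps insert_commute simp flip: single_add)
  show ?thesis
  proof (rule additive_eqI[where F="\<lambda>x. ext_fd a (ext_fd b x) + ext_fd b (ext_fd a x)" and G="\<lambda>x. 0"])
    show "ext_fd a (ext_fd b (x + y)) + ext_fd b (ext_fd a (x + y)) = ext_fd a (ext_fd b x) + ext_fd b (ext_fd a x) + (ext_fd a (ext_fd b y) + ext_fd b (ext_fd a y))" for x y
      by (simp add: generator_add)
    show "(0::'m cl) = 0 + 0" for x y :: "'m cl"
      by simp
    show "ext_fd a (ext_fd b (Poly_Mapping.single S c)) + ext_fd b (ext_fd a (Poly_Mapping.single S c)) = (0)" for S c
      using *[of "fst S" "snd S" c] by (simp only: prod.collapse)
  qed
qed

lemma contr_f_f:
  fixes x :: "'m::{finite,linorder} cl"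
  shows "contr_f a (contr_f b x) + contr_f b (contr_f a x) = 0"
proof -
  have *: "contr_f a (contr_f b (Poly_Mapping.single (A, B) c)) + contr_f b (contr_f a (Poly_Mapping.single (A, B) c)) = (0)" for A B :: "'m set" and c
    using less_linear[of a b] by (auto simp: generator_simps Diff_insert2[symmetric] insert_commute simp flip: single_add)
  show ?thesis
  proof (rule additive_eqI[where F="\<lambda>x. contr_f a (contr_f b x) + contr_f b (contr_f a x)" and G="\<lambda>x. 0"])
    show "contr_f a (contr_f b (x + y)) + contr_f b (contr_f a (x + y)) = contr_f a (contr_f b x) + contr_f b (contr_f a x) + (contr_f a (contr_f b y) + contr_f b (contr_f a y))" for x y
      by (simp add: generator_add)
    show "(0::'m cl) = 0 + 0" for x y :: "'m cl"
      by simp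
    show "contr_f a (contr_f b (Poly_Mapping.single S c)) + contr_f b (contr_f a (Poly_Mapping.single S c)) = (0)" for S c
      using *[of "fst S" "snd S" c] by (simp only: prod.collapse)
  qed
qed

lemma contr_f_ext_f:
  fixes x :: "'m::{finite,linorder} cl"
  shows "contr_f a (ext_f b x) + ext_f b (contr_f a x) = (if a = b then x else 0)"
proof -
  have *: "contr_f a (ext_f b (Poly_Mapping.single (A, B) c)) + ext_f b (contr_f a (Poly_Mapping.single (A, B) c)) = (if a = b then (Poly_Mapping.single (A, B) c) else 0)" for A B :: "'m set" and c
    using less_linear[of a b] by (auto simp: generator_simps insert_Diff_if insert_absorb simp flip: single_add)
  show ?thesis
  proof (rule additive_eqI[where F="\<lambda>x. contr_f a (ext_f b x) + ext_f b (contr_f a x)" and G="\<lambda>x. if a = b then x else 0"])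
    show "contr_f a (ext_f b (x + y)) + ext_f b (contr_f a (x + y)) = contr_f a (ext_f b x) + ext_f b (contr_f a x) + (contr_f a (ext_f b y) + ext_f b (contr_f a y))" for x y
      by (simp add: generator_add)
    show "(if a = b then (x + y) else 0) = (if a = b then x else 0) + (if a = b then y else 0)" for x y :: "'m cl"
      by simp
    show "contr_f a (ext_f b (Poly_Mapping.single S c)) + ext_f b (contr_f a (Poly_Mapping.single S c)) = (if a = b then (Poly_Mapping.single S c) else 0)" for S c
      using *[of "fst S" "snd S" c] by (simp only: prod.collapse)
  qed
qed

lemma contr_f_ext_fd:
  fixes x :: "'m::{finite,linorder} cl"
  shows "contr_f a (ext_fd b x) + ext_fd b (contr_f a x) = 0"
proof -
  have *: "contr_f a (ext_fd b (Poly_Mapping.single (A, B) c)) + ext_fd b (contr_f a (Poly_Mapping.single (A, B) c)) = (0)" for A B :: "'m set" and c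
    using less_linear[of a b] by (auto simp: generator_simps card_gt_0_iff simp flip: single_add)
  show ?thesis
  proof (rule additive_eqI[where F="\<lambda>x. contr_f a (ext_fd b x) + ext_fd b (contr_f a x)" and G="\<lambda>x. 0"])
    show "contr_f a (ext_fd b (x + y)) + ext_fd b (contr_f a (x + y)) = contr_f a (ext_fd b x) + ext_fd b (contr_f a x) + (contr_f a (ext_fd b y) + ext_fd b (contr_f a y))" for x y
      by (simp add: generator_add)
    show "(0::'m cl) = 0 + 0" for x y :: "'m cl"
      by simp
    show "contr_f a (ext_fd b (Poly_Mapping.single S c)) + ext_fd b (contr_f a (Poly_Mapping.single S c)) = (0)" for S c
      using *[of "fst S" "snd S" c] by (simp only: prod.collapse)
  qed
qed

lemma cl_f_f:
  fixes x :: "'m::{finite,linorder} cl"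
  shows "cl_f a (cl_f b x) + cl_f b (cl_f a x) = 0"
  by (simp add: cl_f_def ext_f_f)

lemma cl_f_fd:
  fixes x :: "'m::{finite,linorder} cl"
  shows "cl_f a (cl_fd b x) + cl_fd b (cl_f a x) = (if a = b then x else 0)"
  using ext_f_fd[of a b x] contr_f_ext_f[of b a x]
  by (simp add: cl_f_def cl_fd_def generator_add algebra_simps split: if_splits)

lemma cl_fd_fd:
  fixes x :: "'m::{finite,linorder} cl"
  shows "cl_fd a (cl_fd b x) + cl_fd b (cl_fd a x) = 0"
proof -
  have "cl_fd a (cl_fd b x) + cl_fd b (cl_fd a x) =
      (ext_fd a (ext_fd b x) + ext_fd b (ext_fd a x)) +
      (contr_f b (ext_fd a x) + ext_fd a (contr_f b x)) +
      (contr_f a (ext_fd b x) + ext_fd b (contr_f a x)) +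
      (contr_f a (contr_f b x) + contr_f b (contr_f a x))"
    by (simp add: cl_fd_def generator_add)
  then show ?thesis by (simp only: ext_fd_fd contr_f_ext_fd contr_f_f) simp
qed

lemma contr_f_cl_f:
  fixes x :: "'m::{finite,linorder} cl"
  shows "contr_f a (cl_f b x) + cl_f b (contr_f a x) = (if a = b then x else 0)"
  by (simp add: cl_f_def contr_f_ext_f)

lemma contr_f_cl_fd:
  fixes x :: "'m::{finite,linorder} cl"
  shows "contr_f a (cl_fd b x) + cl_fd b (contr_f a x) = 0"
proof -
  have "contr_f a (cl_fd b x) + cl_fd b (contr_f a x) =
      (contr_f a (ext_fd b x) + ext_fd b (contr_f a x)) +
      (contr_f a (contr_f b x) + contr_f b (contr_f a x))"
    by (simp add: cl_fd_def generator_add)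
  then show ?thesis by (simp only: contr_f_ext_fd contr_f_f) simp
qed

text \<open>The order-preserving antilinear involutions \<open>f\<^sub>a \<leftrightarrow> f\<^sup>\<dagger>\<^sub>a\<close> of the two algebras.\<close>

definition dag_cl :: "'m::linorder cl \<Rightarrow> 'm cl" where
  "dag_cl = semilin_ext cnj (ordered_prod cl_fd cl_f)"

definition dag_ext :: "'m::linorder cl \<Rightarrow> 'm cl" where
  "dag_ext = semilin_ext cnj (ordered_prod ext_fd ext_f)"


section \<open>Clifford-valued polynomials and Capelli contractions\<close>

type_synonym ('l, 'm) pidx = "('l, 'm) mono \<times> 'm cidx"
type_synonym ('l, 'm) pcl = "('l, 'm) pidx \<Rightarrow>\<^sub>0 complex"

fun cliff_parity :: "('l, 'm) pidx \<Rightarrow> nat" where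
  "cliff_parity (\<mu>, A, B) = card A + card B"

definition coeffwise :: "(('l, 'm) psc \<Rightarrow> ('l, 'm) psc) \<Rightarrow> ('l, 'm) pcl \<Rightarrow> ('l, 'm) pcl" where
  "coeffwise T = op_tensor T (\<lambda>x. x)"

definition dag_pcl :: "('l, 'm::linorder) pcl \<Rightarrow> ('l, 'm) pcl" where
  "dag_pcl = semilin_ext cnj (\<lambda>(\<mu>, S). tensor (\<lambda>z. z) (dag_psc (bas \<mu>)) (dag_cl (bas S)))"

definition dag_pext :: "('l, 'm::linorder) pcl \<Rightarrow> ('l, 'm) pcl" where
  "dag_pext = semilin_ext cnj (\<lambda>(\<mu>, S). tensor (\<lambda>z. z) (dag_psc (bas \<mu>)) (dag_ext (bas S)))"

definition partial_Z :: "'l \<Rightarrow> ('l, 'm::{finite,linorder}) pcl \<Rightarrow> ('l, 'm) pcl" where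
  "partial_Z k F = (\<Sum>a\<in>UNIV. op_tensor (pd (Z k a)) (cl_fd a) F)"

definition s_contr :: "'l \<Rightarrow> ('l, 'm::{finite,linorder}) pcl \<Rightarrow> ('l, 'm) pcl" where
  "s_contr i F = (\<Sum>a\<in>UNIV. op_tensor (pd (Z i a)) (contr_f a) F)"

definition Euler_z :: "'l \<Rightarrow> 'l \<Rightarrow> ('l, 'm::finite) psc \<Rightarrow> ('l, 'm) psc" where
  "Euler_z j i p = (\<Sum>a\<in>UNIV. var (Z j a) * pd (Z i a) p)"

definition Capelli :: "'l \<Rightarrow> 'l \<Rightarrow> ('l, 'm::finite) psc \<Rightarrow> ('l, 'm) psc" where
  "Capelli i j p = (if i = j then of_nat CARD('m) * p else 0) + Euler_z j i p"

definition Capelli_mat ::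
    "('l::finite \<Rightarrow> ('l, 'm::finite) psc) \<Rightarrow> ('l \<Rightarrow> ('l, 'm) psc)" where
  "Capelli_mat P = (\<lambda>i. \<Sum>j\<in>UNIV. Capelli i j (P j))"

text \<open>Entry \<open>(i, l)\<close> of the inverse of the operator matrix.\<close>

definition Capelli_inv :: "'l::finite \<Rightarrow> 'l \<Rightarrow> ('l, 'm::finite) psc \<Rightarrow> ('l, 'm) psc" where
  "Capelli_inv i l p = inv Capelli_mat (\<lambda>k. if k = l then p else 0) i"

definition n_plus :: "'l::finite \<Rightarrow> ('l, 'm::{finite,linorder}) pcl \<Rightarrow> ('l, 'm) pcl" where
  "n_plus i F = (\<Sum>l\<in>UNIV. coeffwise (Capelli_inv i l) (s_contr l F))"

definition n_minus :: "'l::finite \<Rightarrow> ('l, 'm::{finite,linorder}) pcl \<Rightarrow> ('l, 'm) pcl" where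
  "n_minus i F = dag_pcl (n_plus i (dag_pcl F))"


section \<open>Gauge\<close>

definition H_pow :: "('l \<times> 'l \<Rightarrow> nat) \<Rightarrow> ('l::finite, 'm::finite) psc" where
  "H_pow \<alpha> = (\<Prod>(i, j)\<in>UNIV. H i j ^ \<alpha> (i, j))"

definition harmonic_expansion ::
    "(('l \<times> 'l \<Rightarrow> nat) \<Rightarrow>\<^sub>0 ('l, 'm) psc) \<Rightarrow> ('l::finite, 'm::finite) psc \<Rightarrow> bool" where
  "harmonic_expansion h P \<longleftrightarrow>
     (\<forall>\<alpha>. harmonic (Poly_Mapping.lookup h \<alpha>)) \<and>
     P = (\<Sum>\<alpha>\<in>Poly_Mapping.keys h. H_pow \<alpha> * Poly_Mapping.lookup h \<alpha>)"

definition g_coeff :: "real \<Rightarrow> ('l::finite \<times> 'l \<Rightarrow> nat) \<Rightarrow> real" where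
  "g_coeff q \<alpha> =
     (\<Prod>i\<in>UNIV. fact (\<alpha> (i, i)) / cfact q (\<alpha> (i, i))) *
     (\<Prod>(i, j)\<in>{(i, j). i \<noteq> j}. fact (\<alpha> (i, j)) / qfact q (\<alpha> (i, j)))"

definition G_nf :: "real \<Rightarrow> ('l::finite, 'm::finite) psc \<Rightarrow> ('l, 'm) psc" where
  "G_nf q P = (let h = (THE h. harmonic_expansion h P) in
     \<Sum>\<alpha>\<in>Poly_Mapping.keys h.
       scl (complex_of_real (g_coeff q \<alpha>)) (H_pow \<alpha> * Poly_Mapping.lookup h \<alpha>))"

definition sigma_Ch_pcl :: "('l, 'm::linorder) pcl \<Rightarrow> ('l, 'm) pcl" where
  "sigma_Ch_pcl = op_tensor (\<lambda>p. p) sigma_Ch"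

text \<open>
  In the exterior model \<open>n_plus\<close> has the same matrix (see \<open>contr_f\<close>); its conjugate is taken
  with the involution of the exterior algebra.
\<close>

definition n_minus_ext :: "'l::finite \<Rightarrow> ('l, 'm::{finite,linorder}) pcl \<Rightarrow> ('l, 'm) pcl" where
  "n_minus_ext i F = dag_pext (n_plus i (dag_pext F))"

definition K_ext :: "('l::finite, 'm::{finite,linorder}) pcl \<Rightarrow> ('l, 'm) pcl" where
  "K_ext F = scl (1/2) (\<Sum>i\<in>UNIV. \<Sum>j\<in>UNIV.
      coeffwise (\<lambda>p. H i j * p) (n_minus_ext j (n_plus i F)))"

definition W :: "('l::finite, 'm::{finite,linorder}) pcl \<Rightarrow> ('l, 'm) pcl" where
  "W = inv sigma_Ch_pcl \<circ> op_exp K_ext \<circ> sigma_Ch_pcl"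

definition G_nf_Lambda ::
    "real \<Rightarrow> ('l::finite, 'm::{finite,linorder}) pcl \<Rightarrow> ('l, 'm) pcl" where
  "G_nf_Lambda q = inv sigma_Ch_pcl \<circ> coeffwise (G_nf q) \<circ> sigma_Ch_pcl"

definition G_PBW :: "real \<Rightarrow> ('l::finite, 'm::{finite,linorder}) pcl \<Rightarrow> ('l, 'm) pcl" where
  "G_PBW q = W \<circ> G_nf_Lambda q \<circ> inv W"


section \<open>Fermionic coefficients\<close>

text \<open>
  A factor is indexed by a pair \<open>v = (k, j)\<close> of a label and a pair number, ordered
  lexicographically.  The complex tensor product of one copy of \<open>\<A>\<^sub>s\<^sup>m\<^sup>i\<^sup>n\<close> per factor is the
  localization \<open>A_min s\<close> of \<open>\<complex>[B\<^sub>v]\<close> at the products of the one-variable denominators; it is a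
  subring of the field of rational functions in the \<open>B\<^sub>v\<close>.
\<close>

type_synonym 'v bpoly = "('v \<Rightarrow>\<^sub>0 nat) \<Rightarrow>\<^sub>0 complex"
type_synonym 'v brat = "(('v \<Rightarrow>\<^sub>0 nat) \<Rightarrow>\<^sub>0 complex) fract"

definition bconst :: "complex \<Rightarrow> 'v bpoly" where
  "bconst z = Poly_Mapping.single 0 z"

definition Bvar :: "'v \<Rightarrow> 'v bpoly" where
  "Bvar v = Poly_Mapping.single (Poly_Mapping.single v 1) 1"

definition cst :: "complex \<Rightarrow> 'v::linorder brat" where
  "cst z = Fract (bconst z) 1"

definition Bgen :: "'v::linorder \<Rightarrow> 'v brat" where
  "Bgen v = Fract (Bvar v) 1"

inductive_set denominators :: "real \<Rightarrow> 'v::linorder bpoly set" for s :: real where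
  one: "1 \<in> denominators s"
| pole: "d \<in> denominators s \<Longrightarrow>
    (Bvar v + bconst (2 * \<i> * of_int k) - bconst \<i>) * d \<in> denominators s"
| minus: "d \<in> denominators s \<Longrightarrow>
    (bconst (of_real s) - bconst (2 * \<i>) * (Bvar v + bconst (2 * \<i> * of_int k))) * d
      \<in> denominators s"
| plus: "d \<in> denominators s \<Longrightarrow>
    (bconst (of_real s) + bconst (2 * \<i>) * (Bvar v + bconst (2 * \<i> * of_int k))) * d
      \<in> denominators s"

definition A_min :: "real \<Rightarrow> 'v::linorder brat set" where
  "A_min s = {Fract p d | p d. d \<in> denominators s}"

text \<open>Conjugation of the coefficients of a rational function; \<open>B\<^sup>\<ddagger> = B\<close>.\<close>

definition bcnj :: "'v bpoly \<Rightarrow> 'v bpoly" where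
  "bcnj p = Poly_Mapping.map cnj p"

lemma lookup_bcnj: "Poly_Mapping.lookup (bcnj p) x = cnj (Poly_Mapping.lookup p x)"
  unfolding bcnj_def by (simp add: Poly_Mapping.map.rep_eq when_def)

lemma bcnj_single: "bcnj (Poly_Mapping.single x c) = Poly_Mapping.single x (cnj c)"
  by (rule poly_mapping_eqI) (simp add: lookup_bcnj lookup_single when_def)

lemma bcnj_add: "bcnj (p + q) = bcnj p + bcnj q"
  by (rule poly_mapping_eqI) (simp add: lookup_bcnj lookup_add)

lemma bcnj_eq_0_iff: "bcnj p = 0 \<longleftrightarrow> p = 0"
  by (metis (no_types, lifting) lookup_bcnj complex_cnj_zero_iff lookup_zero poly_mapping_eqI)

lemma bcnj_sum: "bcnj (sum f A) = (\<Sum>x\<in>A. bcnj (f x))"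
  by (induction A rule: infinite_finite_induct) (auto simp: bcnj_add bcnj_eq_0_iff)

lemma bcnj_mult: "bcnj (p * q) = bcnj p * bcnj q"
proof -
  let ?S = "\<lambda>p. \<Sum>x\<in>Poly_Mapping.keys p. Poly_Mapping.single x (Poly_Mapping.lookup p x)"
  have "bcnj (?S p * ?S q) = bcnj (?S p) * bcnj (?S q)"
    by (simp add: sum_product bcnj_sum bcnj_single mult_single)
  then show ?thesis by (simp only: sum_singles)
qed

lift_definition brat_cnj :: "'v::linorder brat \<Rightarrow> 'v brat" is "\<lambda>(p, d). (bcnj p, bcnj d)"
  by (auto simp: bcnj_eq_0_iff simp flip: bcnj_mult)

lemma brat_cnj_Fract: "d \<noteq> 0 \<Longrightarrow> brat_cnj (Fract p d) = Fract (bcnj p) (bcnj d)"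
  by transfer (simp add: bcnj_eq_0_iff)

definition alpha :: "int \<Rightarrow> 'v::linorder brat \<Rightarrow> 'v brat" where
  "alpha j X = (if j \<ge> 0 then 1 else X + cst (of_int (2 * j + 1) * \<i>))"

definition beta :: "int \<Rightarrow> 'v::linorder brat \<Rightarrow> 'v brat" where
  "beta j X = (if j \<ge> 1 then X + cst (of_int (2 * j - 1) * \<i>) else 1)"

definition Phi :: "real \<Rightarrow> 'v::linorder brat \<Rightarrow> 'v brat" where
  "Phi s X = (4 - cst (of_real s) + cst (2 * \<i>) * X) / (X - cst \<i>)"

definition sigma_plus :: "real \<Rightarrow> int \<Rightarrow> 'v::linorder brat \<Rightarrow> 'v brat" where
  "sigma_plus s c X = beta (c + 1) X * Phi s (X + cst (2 * \<i> * of_int (c + 1)))"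

definition pi_plus :: "real \<Rightarrow> int \<Rightarrow> 'v::linorder brat \<Rightarrow> 'v brat" where
  "pi_plus s c X = cst (- 1 / 4) * sigma_plus s c X"

definition kappa_plus :: "real \<Rightarrow> int \<Rightarrow> 'v::linorder brat \<Rightarrow> 'v brat" where
  "kappa_plus s c X = cst (- 1 / 4) * sigma_plus s c X * alpha c X"

definition K_coeff :: "int \<Rightarrow> 'v::linorder brat \<Rightarrow> 'v brat" where
  "K_coeff c X = cst (1 / (2 * \<i>)) * alpha (c - 1) X * beta c X"


section \<open>Fermionic modules\<close>

text \<open>
  An index chooses in every factor \<open>v\<close> a charge \<open>c\<close> and one of the four basis vectors
  \<open>e\<^sub>0\<^sub>,\<^sub>c\<close>, \<open>e\<^sub>\<theta>\<^sub>,\<^sub>c\<close>, \<open>e\<^sub>\<theta>\<^sub>b\<^sub>a\<^sub>r\<^sub>,\<^sub>c\<close>, \<open>e\<^sub>2\<^sub>,\<^sub>c\<close>.  \<open>fmod\<close> is \<open>\<F>\<^sub>1 \<otimes> \<dots> \<otimes> \<F>\<^sub>N\<close> after extension of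
  scalars to rational functions; see \<open>M_space\<close> for the module over the localization.
\<close>

datatype fkind = E0 | ETh | EThb | E2

type_synonym ('l, 'p) fidx = "'l \<times> 'p \<Rightarrow> fkind \<times> int"
type_synonym ('l, 'p) fmod = "('l, 'p) fidx \<Rightarrow>\<^sub>0 ('l \<times> 'p) brat"

abbreviation kind :: "('l, 'p) fidx \<Rightarrow> 'l \<times> 'p \<Rightarrow> fkind" where
  "kind e v \<equiv> fst (e v)"

abbreviation charge :: "('l, 'p) fidx \<Rightarrow> 'l \<times> 'p \<Rightarrow> int" where
  "charge e v \<equiv> snd (e v)"

fun odd_kind :: "fkind \<Rightarrow> bool" where
  "odd_kind E0 = False"
| "odd_kind ETh = True"
| "odd_kind EThb = True"
| "odd_kind E2 = False"

text \<open>The one-pair maps in charge \<open>c\<close>, with \<open>X\<close> in the place of \<open>B\<close>.\<close>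

fun Q1_plus :: "real \<Rightarrow> int \<Rightarrow> 'v::linorder brat \<Rightarrow> fkind \<Rightarrow> (fkind \<Rightarrow>\<^sub>0 'v brat)" where
  "Q1_plus s c X ETh = Poly_Mapping.single E0 (pi_plus s c X)"
| "Q1_plus s c X E2 = Poly_Mapping.single EThb (cst (1 / (2 * \<i>)) * beta c X)"
| "Q1_plus s c X E0 = 0"
| "Q1_plus s c X EThb = 0"

fun h1_plus :: "real \<Rightarrow> int \<Rightarrow> 'v::linorder brat \<Rightarrow> fkind \<Rightarrow> (fkind \<Rightarrow>\<^sub>0 'v brat)" where
  "h1_plus s c X E0 = Poly_Mapping.single ETh (inverse (pi_plus s c X))"
| "h1_plus s c X EThb = Poly_Mapping.single E2 (cst (2 * \<i>) * inverse (beta c X))"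
| "h1_plus s c X ETh = 0"
| "h1_plus s c X E2 = 0"

text \<open>The graded embedding in factor \<open>v\<close> of an odd right-linear one-pair map.\<close>

definition hat ::
    "(int \<Rightarrow> ('l \<times> 'p) brat \<Rightarrow> fkind \<Rightarrow> (fkind \<Rightarrow>\<^sub>0 ('l \<times> 'p) brat)) \<Rightarrow> 'l \<times> 'p
     \<Rightarrow> ('l::linorder, 'p::linorder) fmod \<Rightarrow> ('l, 'p) fmod" where
  "hat f v = lin_ext (\<lambda>e.
     let y = f (charge e v) (Bgen v) (kind e v) in
     scl ((-1) ^ card {w. w < v \<and> odd_kind (kind e w)})
       (\<Sum>t\<in>Poly_Mapping.keys y.
          Poly_Mapping.single (e(v := (t, charge e v))) (Poly_Mapping.lookup y t)))"

definition Q_plus ::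
    "real \<Rightarrow> nat \<Rightarrow> 'l \<Rightarrow> ('l::{finite,linorder}, 'p::{finite,linorder}) fmod \<Rightarrow> ('l, 'p) fmod" where
  "Q_plus q m k x = (\<Sum>j\<in>UNIV. hat (Q1_plus (s_q q m CARD('p))) (k, j) x)"

definition h_plus ::
    "real \<Rightarrow> nat \<Rightarrow> 'l \<Rightarrow> ('l::{finite,linorder}, 'p::{finite,linorder}) fmod \<Rightarrow> ('l, 'p) fmod" where
  "h_plus q m k x = scl (cst (1 / of_nat CARD('p)))
     (\<Sum>j\<in>UNIV. hat (h1_plus (s_q q m CARD('p))) (k, j) x)"

text \<open>Eigenvalue of the projector on the span of \<open>e\<^sub>\<theta>\<^sub>b\<^sub>a\<^sub>r\<^sub>,\<^sub>c\<close> and \<open>e\<^sub>2\<^sub>,\<^sub>c\<close>.\<close>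

definition proj_plus :: "fkind \<Rightarrow> 'v::linorder brat" where
  "proj_plus t = (if t = EThb \<or> t = E2 then 1 else 0)"

definition delta_m :: "real \<Rightarrow> nat \<Rightarrow> real" where
  "delta_m q m = (real (2 * m) - qint q (2 * m)) / 4"

text \<open>
  Every summand of \<open>M\<^sup>+\<close> is diagonal in the basis.  The argument \<open>r\<close> is the antiholomorphic Euler
  degree, in the variables of label \<open>k\<close>, of the bosonic factor on which \<open>M\<^sup>+\<close> acts.
\<close>

definition M_plus_coeff ::
    "real \<Rightarrow> nat \<Rightarrow> nat \<Rightarrow> 'l \<Rightarrow> ('l::{finite,linorder}, 'p::{finite,linorder}) fidx
     \<Rightarrow> ('l \<times> 'p) brat" where
  "M_plus_coeff q m r k e =
     cst (of_real (delta_m q m)) +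
     (\<Sum>S\<in>{S. S \<noteq> {}}.
        (\<Prod>j\<in>S. proj_plus (kind e (k, j))) * (\<Prod>j\<in>-S. 1 - proj_plus (kind e (k, j))) *
        ((\<Sum>j\<in>S. kappa_plus (s_q q m CARD('p)) (charge e (k, j)) (Bgen (k, j)))
         - of_nat (card S)
         - cst (of_real (c_q q (r + card S) / real (r + card S)))
           * (\<Sum>j\<in>S. K_coeff (charge e (k, j)) (Bgen (k, j)))))"

definition M_plus ::
    "real \<Rightarrow> nat \<Rightarrow> nat \<Rightarrow> 'l \<Rightarrow> ('l::{finite,linorder}, 'p::{finite,linorder}) fmod
     \<Rightarrow> ('l, 'p) fmod" where
  "M_plus q m r k = lin_ext (\<lambda>e. Poly_Mapping.single e (M_plus_coeff q m r k e))"

definition N_plus ::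
    "real \<Rightarrow> nat \<Rightarrow> nat \<Rightarrow> 'l \<Rightarrow> ('l::{finite,linorder}, 'p::{finite,linorder}) fmod
     \<Rightarrow> ('l, 'p) fmod" where
  "N_plus q m r k x = - h_plus q m k (M_plus q m r k x)"

fun dag_kind :: "fkind \<Rightarrow> fkind" where
  "dag_kind E0 = E0"
| "dag_kind ETh = EThb"
| "dag_kind EThb = ETh"
| "dag_kind E2 = E2"

text \<open>
  \<open>\<ddagger>\<close> exchanges \<open>x\<^sub>c\<close> and \<open>x\<^sub>-\<^sub>c\<close>.  As it preserves the order of products it sends \<open>\<theta> \<theta>bar\<close> to
  \<open>\<theta>bar \<theta> = - \<theta> \<theta>bar\<close>, hence one sign for every factor of kind \<open>E2\<close>.
\<close>

definition dag_F :: "('l::{finite,linorder}, 'p::{finite,linorder}) fmod \<Rightarrow> ('l, 'p) fmod" where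
  "dag_F = semilin_ext brat_cnj (\<lambda>e.
     Poly_Mapping.single (\<lambda>v. (dag_kind (kind e v), - charge e v))
       ((-1) ^ card {v. kind e v = E2}))"

text \<open>Here \<open>r\<close> is the holomorphic Euler degree.\<close>

definition N_minus ::
    "real \<Rightarrow> nat \<Rightarrow> nat \<Rightarrow> 'l \<Rightarrow> ('l::{finite,linorder}, 'p::{finite,linorder}) fmod
     \<Rightarrow> ('l, 'p) fmod" where
  "N_minus q m r k x = dag_F (N_plus q m r k (dag_F x))"


section \<open>Transport\<close>

text \<open>
  \<open>\<P>\<^sup>C\<^sup>l \<otimes> \<F>\<^sub>1 \<otimes> \<dots> \<otimes> \<F>\<^sub>N\<close> is the free module over \<open>A_min s\<close>, the set \<open>M_space\<close>, inside the
  vector space \<open>tot\<close> with the same basis over rational functions.  Operators are defined on \<open>tot\<close>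
  and considered on \<open>M_space\<close>, where also their inverses \<open>M_inv\<close> are taken.
\<close>

type_synonym ('l, 'm, 'p) tot = "('l, 'm) pidx \<times> ('l, 'p) fidx \<Rightarrow>\<^sub>0 ('l \<times> 'p) brat"

definition M_space ::
    "real \<Rightarrow> ('l::{finite,linorder}, 'm::{finite,linorder}, 'p::{finite,linorder}) tot set" where
  "M_space q = {x. \<forall>b. Poly_Mapping.lookup x b \<in> A_min (s_q q CARD('m) CARD('p))}"

text \<open>\<open>X \<otimes> Y\<close> for \<open>Y\<close> of parity \<open>d\<close>.\<close>

definition graded_tensor ::
    "nat \<Rightarrow> (('l, 'm) pcl \<Rightarrow> ('l, 'm) pcl) \<Rightarrow> (('l, 'p) fmod \<Rightarrow> ('l, 'p) fmod)
     \<Rightarrow> ('l::{finite,linorder}, 'm::{finite,linorder}, 'p::{finite,linorder}) tot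
     \<Rightarrow> ('l, 'm, 'p) tot" where
  "graded_tensor d X Y = lin_ext (\<lambda>(b, e).
     scl ((-1) ^ (d * cliff_parity b)) (tensor cst (X (bas b)) (Y (bas e))))"

definition dag_tot ::
    "('l::{finite,linorder}, 'm::{finite,linorder}, 'p::{finite,linorder}) tot
     \<Rightarrow> ('l, 'm, 'p) tot" where
  "dag_tot = semilin_ext brat_cnj (\<lambda>(b, e). tensor cst (dag_pcl (bas b)) (dag_F (bas e)))"

definition A_plus ::
    "real \<Rightarrow> 'l \<Rightarrow> ('l::{finite,linorder}, 'm::{finite,linorder}, 'p::{finite,linorder}) tot
     \<Rightarrow> ('l, 'm, 'p) tot" where
  "A_plus q k x = graded_tensor 0 (partial_Z k) (\<lambda>y. y) x
                + graded_tensor 1 (\<lambda>F. F) (Q_plus q CARD('m) k) x"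

definition A_minus ::
    "real \<Rightarrow> 'l \<Rightarrow> ('l::{finite,linorder}, 'm::{finite,linorder}, 'p::{finite,linorder}) tot
     \<Rightarrow> ('l, 'm, 'p) tot" where
  "A_minus q k x = dag_tot (A_plus q k (dag_tot x))"

text \<open>
  The odd tensor products \<open>n\<^sub>i\<^sup>\<plusminus> \<otimes> N\<^sub>i\<^sup>\<plusminus>\<close>.  The Euler degree is read off the bosonic monomial; it is
  not changed by \<open>n\<^sub>i\<^sup>\<plusminus>\<close>, which acts on the variables of the opposite type.
\<close>

definition H_plus ::
    "real \<Rightarrow> 'l \<Rightarrow> ('l::{finite,linorder}, 'm::{finite,linorder}, 'p::{finite,linorder}) tot
     \<Rightarrow> ('l, 'm, 'p) tot" where
  "H_plus q i = lin_ext (\<lambda>(b, e).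
     scl ((-1) ^ cliff_parity b)
       (tensor cst (n_plus i (bas b)) (N_plus q CARD('m) (zb_degree i (fst b)) i (bas e))))"

definition H_minus ::
    "real \<Rightarrow> 'l \<Rightarrow> ('l::{finite,linorder}, 'm::{finite,linorder}, 'p::{finite,linorder}) tot
     \<Rightarrow> ('l, 'm, 'p) tot" where
  "H_minus q i = lin_ext (\<lambda>(b, e).
     scl ((-1) ^ cliff_parity b)
       (tensor cst (n_minus i (bas b)) (N_minus q CARD('m) (z_degree i (fst b)) i (bas e))))"

definition U_plus ::
    "real \<Rightarrow> ('l::{finite,linorder}, 'm::{finite,linorder}, 'p::{finite,linorder}) tot
     \<Rightarrow> ('l, 'm, 'p) tot" where
  "U_plus q = op_exp (\<lambda>x. \<Sum>i\<in>UNIV. H_plus q i x)"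

definition U_minus ::
    "real \<Rightarrow> ('l::{finite,linorder}, 'm::{finite,linorder}, 'p::{finite,linorder}) tot
     \<Rightarrow> ('l, 'm, 'p) tot" where
  "U_minus q = op_exp (\<lambda>x. \<Sum>i\<in>UNIV. H_minus q i x)"

definition G_tot ::
    "real \<Rightarrow> ('l::{finite,linorder}, 'm::{finite,linorder}, 'p::{finite,linorder}) tot
     \<Rightarrow> ('l, 'm, 'p) tot" where
  "G_tot q = graded_tensor 0 (G_PBW q) (\<lambda>y. y)"

definition M_inv ::
    "real \<Rightarrow> (('l, 'm, 'p) tot \<Rightarrow> ('l, 'm, 'p) tot)
     \<Rightarrow> ('l::{finite,linorder}, 'm::{finite,linorder}, 'p::{finite,linorder}) tot
     \<Rightarrow> ('l, 'm, 'p) tot" where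
  "M_inv q X = inv_into (M_space q) X"

definition D_plus ::
    "real \<Rightarrow> 'l \<Rightarrow> ('l::{finite,linorder}, 'm::{finite,linorder}, 'p::{finite,linorder}) tot
     \<Rightarrow> ('l, 'm, 'p) tot" where
  "D_plus q k = G_tot q \<circ> M_inv q (U_plus q) \<circ> A_plus q k \<circ> U_plus q \<circ> M_inv q (G_tot q)"

definition D_minus ::
    "real \<Rightarrow> 'l \<Rightarrow> ('l::{finite,linorder}, 'm::{finite,linorder}, 'p::{finite,linorder}) tot
     \<Rightarrow> ('l, 'm, 'p) tot" where
  "D_minus q k = G_tot q \<circ> M_inv q (U_minus q) \<circ> A_minus q k \<circ> U_minus q \<circ> M_inv q (G_tot q)"

definition L_seed ::
    "real \<Rightarrow> 'l \<Rightarrow> 'l \<Rightarrow> ('l::{finite,linorder}, 'm::{finite,linorder}, 'p::{finite,linorder}) tot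
     \<Rightarrow> ('l, 'm, 'p) tot" where
  "L_seed q i j = anticomm (A_plus q i) (A_minus q j)"

definition R_op ::
    "real \<Rightarrow> ('l::{finite,linorder}, 'm::{finite,linorder}, 'p::{finite,linorder}) tot
     \<Rightarrow> ('l, 'm, 'p) tot" where
  "R_op q = U_plus q \<circ> M_inv q (U_minus q)"

definition Omega ::
    "real \<Rightarrow> 'l \<Rightarrow> ('l::{finite,linorder}, 'm::{finite,linorder}, 'p::{finite,linorder}) tot
     \<Rightarrow> ('l, 'm, 'p) tot" where
  "Omega q j x = R_op q (A_minus q j (M_inv q (R_op q) x)) - A_minus q j x"

end

(*
The identity is a conjugation argument. With U = U_plus, V = U_minus and R = U V^-1, conjugating
A_minus by V is conjugating R A_minus R^-1 by U, so both sides are the conjugates by G U^-1 of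
A_plus (R A_minus R^-1) + (R A_minus R^-1) A_plus. This requires U, V and G to be bijections of the
module over the localization. U and V are exponentials of maps that lower the Clifford degree,
hence unitriangular. For G the point is that harmonic expansions exist and are unique. Existence
comes from orthogonal projection for the Fischer form, in which multiplication by H_ij is adjoint to
Lap i j. For uniqueness one chooses a weight on the variables for which the H_ij have pairwise
coprime leading monomials, which is possible since m >= 2 N; so the polynomial ring is free over the
algebra generated by the H_ij, and a harmonic polynomial in the ideal of the H_ij is orthogonal to
itself.
*)
theory Submission
  imports Defs
begin

section \<open>Linear maps on free modules\<close>

text \<open>The inverses in the statement are taken inside the module over the localization, so
  invertibility over rational functions does not suffice: the maps and their inverses must preserve
  coefficients in \<open>A_min\<close>. For a unitriangular map the inverse is found by ring
  operations alone. The map itself is the delicate part: \<open>h_plus\<close> divides by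
  \<open>pi_plus\<close> and \<open>beta\<close>, which are units of \<open>A_min\<close> because
  the shifts in their definitions turn numerators and denominators, up to constants, into inverted
  linear factors. \<open>G_nf\<close> is given by a definite description, so nothing is known of it
  before expansions are shown to exist and to be unique. The Fischer form alone does not give
  uniqueness, because the summands are not mutually orthogonal: for N >= 2, H_11 H_22 and H_12 H_21
  share monomials with positive coefficients. The form only separates harmonic polynomials from the
  ideal of the H_ij. Freeness supplies the rest: in a vanishing sum, a component of least total
  exponent is forced into that ideal.\<close>

abbreviation keys where "keys \<equiv> Poly_Mapping.keys"
abbreviation lookup where "lookup \<equiv> Poly_Mapping.lookup"
abbreviation single where "single \<equiv> Poly_Mapping.single"

section \<open>Linearity and determination by values on the basis\<close>

definition is_linear :: "(('b \<Rightarrow>\<^sub>0 'k) \<Rightarrow> ('c \<Rightarrow>\<^sub>0 'k::comm_ring_1)) \<Rightarrow> bool" where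
  "is_linear T \<longleftrightarrow> (\<forall>x y. T (x + y) = T x + T y) \<and> (\<forall>c x. T (scl c x) = scl c (T x))"

lemma is_linearI:
  assumes "\<And>x y. T (x + y) = T x + T y" "\<And>c x. T (scl c x) = scl c (T x)"
  shows "is_linear T"
  using assms by (simp add: is_linear_def)

lemma is_linearD:
  assumes "is_linear T"
  shows "T (x + y) = T x + T y" "T (scl c x) = scl c (T x)" "T 0 = 0"
    "T (- x) = - T x" "T (x - y) = T x - T y"
proof -
  show *: "T (x + y) = T x + T y" "T (scl c x) = scl c (T x)" for x y c
    using assms by (auto simp: is_linear_def)
  have m: "- x = scl (- 1) x" for x :: "'d \<Rightarrow>\<^sub>0 'e::comm_ring_1"
    by (simp add: scl_simps)
  show "T 0 = 0" using *(2)[of 0 0] by (simp add: scl_simps)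
  show n: "T (- x) = - T x" for x by (simp only: m *)
  show "T (x - y) = T x - T y" using *(1)[of x "- y"] by (simp add: n)
qed

lemma is_linear_sum: "is_linear T \<Longrightarrow> T (sum f A) = (\<Sum>a\<in>A. T (f a))"
  by (induction A rule: infinite_finite_induct) (auto simp: is_linearD)

lemma scl_sum: "scl c (sum f A) = (\<Sum>a\<in>A. scl c (f a))"
  by (induction A rule: infinite_finite_induct) (auto simp: scl_simps)

lemma scl_diff: "scl c (x - y) = scl c x - scl c y"
  by (rule poly_mapping_eqI) (simp add: lookup_scl lookup_minus algebra_simps)

lemma scl_semilin_ext:
  assumes "\<And>c d. \<tau> (c * d) = \<tau> c * \<tau> d" "\<tau> 0 = 0"
  shows "semilin_ext \<tau> f (scl c x) = scl (\<tau> c) (semilin_ext \<tau> f x)"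
proof -
  have "keys (scl c x) \<subseteq> keys x" by (auto simp: in_keys_iff lookup_scl)
  then have "semilin_ext \<tau> f (scl c x) = (\<Sum>b\<in>keys x. scl (\<tau> (lookup (scl c x) b)) (f b))"
    by (intro semilin_ext_superset) (use assms in auto)
  then show ?thesis unfolding semilin_ext_def[of \<tau> f x]
    by (simp add: lookup_scl assms scl_sum scl_simps)
qed

lemma is_linear_lin_ext: "is_linear (lin_ext f)"
  by (rule is_linearI) (simp_all add: lin_ext_add, simp add: lin_ext_def scl_semilin_ext)

lemma is_linear_id: "is_linear (\<lambda>x. x)"
  by (simp add: is_linear_def)

lemma is_linear_comp: "is_linear S \<Longrightarrow> is_linear T \<Longrightarrow> is_linear (S \<circ> T)"
  by (auto simp: is_linear_def)

lemma is_linear_plus: "is_linear S \<Longrightarrow> is_linear T \<Longrightarrow> is_linear (\<lambda>x. S x + T x)"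
  by (auto simp: is_linear_def scl_simps)

lemma is_linear_minus: "is_linear S \<Longrightarrow> is_linear T \<Longrightarrow> is_linear (\<lambda>x. S x - T x)"
  by (auto simp: is_linear_def scl_diff)

lemma is_linear_Sum: "(\<And>a. a \<in> A \<Longrightarrow> is_linear (T a)) \<Longrightarrow> is_linear (\<lambda>x. \<Sum>a\<in>A. T a x)"
  by (auto simp: is_linear_def sum.distrib scl_sum intro!: sum.cong)

lemma is_linear_scl: "is_linear T \<Longrightarrow> is_linear (\<lambda>x. scl c (T x))"
  by (auto simp: is_linear_def scl_simps mult.commute)

lemma is_linear_funpow:
  fixes T :: "('b \<Rightarrow>\<^sub>0 'k) \<Rightarrow> ('b \<Rightarrow>\<^sub>0 'k::comm_ring_1)"
  shows "is_linear T \<Longrightarrow> is_linear (T ^^ k)"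
  by (induction k) (auto simp: is_linear_def)

lemma is_linear_inv:
  assumes "is_linear T" "bij T"
  shows "is_linear (inv T)"
proof (rule is_linearI)
  have T: "T (inv T y) = y" "inv T (T x) = x" for x y
    using assms by (simp_all add: bij_is_surj surj_f_inv_f bij_is_inj)
  show "inv T (x + y) = inv T x + inv T y" for x y
    by (metis T is_linearD(1)[OF assms(1)])
  show "inv T (scl c x) = scl c (inv T x)" for c x
    by (metis T is_linearD(2)[OF assms(1)])
qed

lemma single_scl_bas: "single b c = scl c (bas b)"
  by (simp add: bas_def scl_simps)

lemma lin_ext_bas [simp]: "lin_ext f (bas b) = f b"
  by (simp add: bas_def lin_ext_single scl_simps)

lemma is_linear_eqI:
  assumes "is_linear F" "is_linear G" "\<And>b. F (bas b) = G (bas b)"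
  shows "F = G"
proof
  show "F x = G x" for x
    by (rule additive_eqI) (use assms in \<open>auto simp: is_linearD single_scl_bas\<close>)
qed

lemma is_linear_lin_ext_bas: "is_linear T \<Longrightarrow> T = lin_ext (\<lambda>b. T (bas b))"
  by (rule is_linear_eqI) (auto simp: is_linear_lin_ext)

lemma keys_scl: "keys (scl c x) \<subseteq> keys x"
  by (auto simp: in_keys_iff lookup_scl)

lemma keys_semilin_ext: "keys (semilin_ext \<tau> f x) \<subseteq> (\<Union>b\<in>keys x. keys (f b))"
  unfolding semilin_ext_def
  by (rule order_trans[OF keys_sum]) (use keys_scl in fastforce)

lemma keys_is_linear: "is_linear T \<Longrightarrow> keys (T x) \<subseteq> (\<Union>b\<in>keys x. keys (T (bas b)))"
  using keys_semilin_ext[of "\<lambda>c. c" "\<lambda>b. T (bas b)" x] is_linear_lin_ext_bas[of T]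
  by (simp add: lin_ext_def)

lemma keys_bas [simp]: "keys (bas b :: 'b \<Rightarrow>\<^sub>0 'k::zero_neq_one) = {b}"
  by (simp add: bas_def)

lemma keys_tensor: "keys (tensor \<iota> x y) \<subseteq> keys x \<times> keys y"
  unfolding tensor_def
  by (auto dest!: subsetD[OF keys_sum] split: if_splits)

text \<open>For S = \<open>A_min\<close> this is \<open>M_space\<close>, for S = \<open>UNIV\<close>
  the whole vector space, so one bijectivity lemma serves both.\<close>

definition coeffs_in :: "'k set \<Rightarrow> ('b \<Rightarrow>\<^sub>0 'k::zero) set" where
  "coeffs_in S = {x. \<forall>b. lookup x b \<in> S}"

definition is_subring :: "'k::comm_ring_1 set \<Rightarrow> bool" where
  "is_subring S \<longleftrightarrow> 0 \<in> S \<and> 1 \<in> S \<and> (\<forall>x\<in>S. - x \<in> S) \<and> (\<forall>x\<in>S. \<forall>y\<in>S. x + y \<in> S \<and> x * y \<in> S)"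

lemma is_subringD:
  assumes "is_subring S"
  shows "0 \<in> S" "1 \<in> S" "x \<in> S \<Longrightarrow> - x \<in> S" "x \<in> S \<Longrightarrow> y \<in> S \<Longrightarrow> x + y \<in> S"
    "x \<in> S \<Longrightarrow> y \<in> S \<Longrightarrow> x * y \<in> S" "x \<in> S \<Longrightarrow> y \<in> S \<Longrightarrow> x - y \<in> S"
    "x \<in> S \<Longrightarrow> x ^ n \<in> S" "(\<And>a. a \<in> A \<Longrightarrow> f a \<in> S) \<Longrightarrow> sum f A \<in> S"
    "(\<And>a. a \<in> A \<Longrightarrow> f a \<in> S) \<Longrightarrow> prod f A \<in> S" "of_nat n \<in> S"
proof -
  show *: "0 \<in> S" "1 \<in> S" "x \<in> S \<Longrightarrow> - x \<in> S" "x \<in> S \<Longrightarrow> y \<in> S \<Longrightarrow> x + y \<in> S"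
    "x \<in> S \<Longrightarrow> y \<in> S \<Longrightarrow> x * y \<in> S" for x y
    using assms by (auto simp: is_subring_def)
  show "x \<in> S \<Longrightarrow> y \<in> S \<Longrightarrow> x - y \<in> S" using *(4)[of x "- y"] *(3)[of y] by simp
  show "x \<in> S \<Longrightarrow> x ^ n \<in> S" by (induction n) (auto simp: *)
  show "(\<And>a. a \<in> A \<Longrightarrow> f a \<in> S) \<Longrightarrow> sum f A \<in> S"
    by (induction A rule: infinite_finite_induct) (auto simp: *)
  show "(\<And>a. a \<in> A \<Longrightarrow> f a \<in> S) \<Longrightarrow> prod f A \<in> S"
    by (induction A rule: infinite_finite_induct) (auto simp: *)
  show "of_nat n \<in> S" by (induction n) (auto simp: *)
qed

lemma coeffs_in_closed:
  assumes "is_subring S"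
  shows "0 \<in> coeffs_in S" "x \<in> coeffs_in S \<Longrightarrow> y \<in> coeffs_in S \<Longrightarrow> x + y \<in> coeffs_in S"
    "x \<in> coeffs_in S \<Longrightarrow> - x \<in> coeffs_in S"
    "x \<in> coeffs_in S \<Longrightarrow> y \<in> coeffs_in S \<Longrightarrow> x - y \<in> coeffs_in S"
    "c \<in> S \<Longrightarrow> x \<in> coeffs_in S \<Longrightarrow> scl c x \<in> coeffs_in S"
    "(\<And>a. a \<in> A \<Longrightarrow> f a \<in> coeffs_in S) \<Longrightarrow> sum f A \<in> coeffs_in S"
    "c \<in> S \<Longrightarrow> single b c \<in> coeffs_in S"
    "bas b \<in> coeffs_in S"
  by (auto simp: coeffs_in_def lookup_add lookup_minus lookup_scl lookup_sum lookup_single when_def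
      bas_def intro!: is_subringD[OF assms])

lemma coeffs_in_semilin_ext:
  assumes "is_subring S" "\<And>c. c \<in> S \<Longrightarrow> \<tau> c \<in> S" "\<And>b. f b \<in> coeffs_in S" "x \<in> coeffs_in S"
  shows "semilin_ext \<tau> f x \<in> coeffs_in S"
  unfolding semilin_ext_def
  by (intro coeffs_in_closed assms) (use assms(4) in \<open>auto simp: coeffs_in_def\<close>)

lemma coeffs_in_is_linear:
  assumes "is_subring S" "is_linear T" "\<And>b. T (bas b) \<in> coeffs_in S" "x \<in> coeffs_in S"
  shows "T x \<in> coeffs_in S"
proof -
  have "lin_ext (\<lambda>b. T (bas b)) x \<in> coeffs_in S"
    unfolding lin_ext_def using assms by (intro coeffs_in_semilin_ext) auto
  then show ?thesis using is_linear_lin_ext_bas[OF assms(2)] by metis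
qed

lemma coeffs_in_tensor:
  assumes "is_subring S" "\<And>b. \<iota> (lookup x b) \<in> S" "y \<in> coeffs_in S"
  shows "tensor \<iota> x y \<in> coeffs_in S"
  unfolding tensor_def
  by (intro coeffs_in_closed assms is_subringD) (use assms(3) in \<open>auto simp: coeffs_in_def\<close>)

lemma coeffs_in_UNIV [simp]: "coeffs_in UNIV = UNIV"
  by (auto simp: coeffs_in_def)

lemma is_subring_UNIV [simp]: "is_subring UNIV"
  by (auto simp: is_subring_def)


section \<open>Unitriangular maps and exponentials\<close>

text \<open>Degrees may be unbounded over the basis, as for the weight of monomials; the finite
  support of each vector makes induction on the degree terminate.\<close>

definition unitriangular :: "('b \<Rightarrow> nat) \<Rightarrow> (('b \<Rightarrow>\<^sub>0 'k) \<Rightarrow> ('b \<Rightarrow>\<^sub>0 'k::comm_ring_1)) \<Rightarrow> bool" where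
  "unitriangular deg T \<longleftrightarrow> is_linear T \<and> (\<forall>b. \<forall>b'\<in>keys (T (bas b) - bas b). deg b' < deg b)"

text \<open>With N = T - 1, a kernel vector satisfies z = - N z, so its support sinks below every
  degree. For surjectivity, T y = x is solved by y = x + y' with T y' = - N x, an equation of lower
  degree. Only ring operations occur, so the solution has coefficients in S.\<close>

lemma unitriangular_bij_betw:
  assumes T: "unitriangular deg T" and S: "is_subring S" and TS: "\<And>b. T (bas b) \<in> coeffs_in S"
  shows "bij_betw T (coeffs_in S) (coeffs_in S)"
proof -
  define N where "N x = T x - x" for x
  have lT: "is_linear T" using T by (simp add: unitriangular_def)
  have lN: "is_linear N" unfolding N_def by (intro is_linear_minus lT is_linear_id)
  have Nb: "\<forall>b'\<in>keys (N (bas b)). deg b' < deg b" for b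
    using T by (auto simp: unitriangular_def N_def)
  have Nlow: "keys (N x) \<subseteq> {b. deg b < d}" if "keys x \<subseteq> {b. deg b < Suc d}" for x d
    using keys_is_linear[OF lN, of x] Nb that by fastforce
  have TinS: "T x \<in> coeffs_in S" if "x \<in> coeffs_in S" for x
    by (rule coeffs_in_is_linear[OF S lT TS that])
  have ker: "z = 0" if "T z = 0" for z
  proof -
    have zN: "z = - N z" using that by (simp add: N_def)
    have "keys z \<subseteq> {b. deg b < d} \<Longrightarrow> z = 0" for d
    proof (induction d)
      case (Suc d)
      have "keys z = keys (N z)" by (subst zN) simp
      then show ?case using Suc Nlow[of z d] by simp
    qed simp
    \<comment> \<open>For z = 0 the maximum is an unspecified number, but the inclusion is then
      vacuous.\<close>
    moreover have "keys z \<subseteq> {b. deg b < Suc (Max (deg ` keys z))}"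
      by (auto simp: less_Suc_eq_le)
    ultimately show ?thesis by blast
  qed
  have surj: "\<exists>y\<in>coeffs_in S. T y = x" if "x \<in> coeffs_in S" for x
  proof -
    have "\<And>x. keys x \<subseteq> {b. deg b < d} \<Longrightarrow> x \<in> coeffs_in S \<Longrightarrow> \<exists>y\<in>coeffs_in S. T y = x" for d
    proof (induction d)
      case 0
      then show ?case by (intro bexI[of _ 0]) (auto simp: is_linearD[OF lT] coeffs_in_closed S)
    next
      case (Suc d)
      have "keys (- N x) \<subseteq> {b. deg b < d}" using Nlow[OF Suc.prems(1)] by simp
      moreover have "- N x \<in> coeffs_in S"
        using Suc.prems TinS by (auto simp: N_def intro!: coeffs_in_closed S)
      ultimately obtain y where y: "y \<in> coeffs_in S" "T y = - N x" using Suc.IH by blast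
      have "T (x + y) = x" using y by (simp add: is_linearD[OF lT] N_def)
      then show ?case using y Suc.prems by (intro bexI[of _ "x + y"] coeffs_in_closed S)
    qed
    moreover have "keys x \<subseteq> {b. deg b < Suc (Max (deg ` keys x))}"
      by (auto simp: less_Suc_eq_le)
    ultimately show ?thesis using that by blast
  qed
  show ?thesis
  proof (rule bij_betwI')
    show "(T x = T y) = (x = y)" for x y
      using ker[of "x - y"] by (auto simp: is_linearD[OF lT])
  qed (use TinS surj in \<open>auto simp: eq_commute\<close>)
qed

lemma unitriangular_bij: "unitriangular deg T \<Longrightarrow> bij T"
  using unitriangular_bij_betw[of deg T UNIV] by simp

text \<open>At k = D the right-hand set is empty, so T is nilpotent.\<close>

lemma funpow_lower:
  fixes T :: "('b \<Rightarrow>\<^sub>0 'k) \<Rightarrow> ('b \<Rightarrow>\<^sub>0 'k::comm_ring_1)"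
  assumes T: "is_linear T" and low: "\<And>b b'. b' \<in> keys (T (bas b)) \<Longrightarrow> deg b' < deg b"
    and bnd: "\<And>b. deg b < (D::nat)"
  shows "keys ((T ^^ k) x) \<subseteq> {b. deg b + k < D}"
proof (induction k)
  case 0
  then show ?case using bnd by auto
next
  case (Suc k)
  then show ?case using keys_is_linear[OF T, of "(T ^^ k) x"] low by fastforce
qed

text \<open>The index set in \<open>op_exp\<close> depends on x; a common truncation exposes
  linearity. The bound is \<open>Suc D\<close> so that the term k = 0 can be split off.\<close>

lemma op_exp_altdef:
  fixes T :: "('b \<Rightarrow>\<^sub>0 'k) \<Rightarrow> ('b \<Rightarrow>\<^sub>0 'k::field)"
  assumes T: "is_linear T" and low: "\<And>b b'. b' \<in> keys (T (bas b)) \<Longrightarrow> deg b' < deg b"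
    and bnd: "\<And>b. deg b < (D::nat)"
  shows "op_exp T x = (\<Sum>k<Suc D. scl (inverse (of_nat (fact k))) ((T ^^ k) x))"
proof -
  have "(T ^^ k) x = 0" if "k \<ge> D" for k
    using funpow_lower[OF assms, where k=k and x=x] that by auto
  then have "{k. (T ^^ k) x \<noteq> 0} \<subseteq> {..<Suc D}"
    by (metis (mono_tags, lifting) lessThan_iff less_Suc_eq linorder_not_le mem_Collect_eq subsetI)
  then show ?thesis unfolding op_exp_def
    by (intro sum.mono_neutral_left) (auto simp: scl_simps)
qed

lemma unitriangular_op_exp:
  fixes T :: "('b \<Rightarrow>\<^sub>0 'k) \<Rightarrow> ('b \<Rightarrow>\<^sub>0 'k::field)"
  assumes T: "is_linear T" and low: "\<And>b b'. b' \<in> keys (T (bas b)) \<Longrightarrow> deg b' < deg b"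
    and bnd: "\<And>b. deg b < (D::nat)"
  shows "unitriangular deg (op_exp T)"
proof -
  have eq: "op_exp T = (\<lambda>x. \<Sum>k<Suc D. scl (inverse (of_nat (fact k))) ((T ^^ k) x))"
    by (rule ext) (rule op_exp_altdef[OF assms])
  have "is_linear (op_exp T)"
    unfolding eq by (intro is_linear_Sum is_linear_scl is_linear_funpow T)
  moreover have "deg b' < deg b" if "b' \<in> keys (op_exp T (bas b) - bas b)" for b b'
  proof -
    have pos: "keys ((T ^^ Suc k) (bas b)) \<subseteq> {b'. deg b' < deg b}" for k
    proof (induction k)
      case (Suc k)
      then show ?case
        using keys_is_linear[OF T, of "(T ^^ Suc k) (bas b)"] low by fastforce
    qed (use low in auto)
    have "op_exp T (bas b) - bas b = (\<Sum>k<D. scl (inverse (of_nat (fact (Suc k)))) ((T ^^ Suc k) (bas b)))"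
      unfolding eq sum.lessThan_Suc_shift by (simp add: scl_simps)
    then show ?thesis using that pos keys_scl
      by (fastforce dest!: subsetD[OF keys_sum])
  qed
  ultimately show ?thesis by (auto simp: unitriangular_def)
qed

lemma op_exp_coeffs_in:
  fixes T :: "('b \<Rightarrow>\<^sub>0 'k) \<Rightarrow> ('b \<Rightarrow>\<^sub>0 'k::field)"
  assumes T: "is_linear T" and low: "\<And>b b'. b' \<in> keys (T (bas b)) \<Longrightarrow> deg b' < deg b"
    and bnd: "\<And>b. deg b < (D::nat)"
    and S: "is_subring S" "\<And>n. inverse (of_nat (fact n)) \<in> S" and TS: "\<And>b. T (bas b) \<in> coeffs_in S"
    and x: "x \<in> coeffs_in S"
  shows "op_exp T x \<in> coeffs_in S"
proof -
  have "(T ^^ k) x \<in> coeffs_in S" for k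
    by (induction k) (auto simp: x intro: coeffs_in_is_linear[OF S(1) T TS])
  then have "(\<Sum>k<Suc D. scl (inverse (of_nat (fact k))) ((T ^^ k) x)) \<in> coeffs_in S"
    by (intro coeffs_in_closed S)
  then show ?thesis using op_exp_altdef[OF T low bnd, where x=x] by simp
qed


section \<open>Tensor products\<close>

text \<open>\<open>tensor\<close> runs over supports only; \<open>\<iota> 0 = 0\<close> extends the
  product formula to all indices, and bilinearity then follows coefficientwise.\<close>

lemma lookup_tensor:
  assumes "\<iota> 0 = 0"
  shows "lookup (tensor \<iota> x y) (b, c) = \<iota> (lookup x b) * lookup y c"
proof -
  have "lookup (tensor \<iota> x y) (b, c) =
      (\<Sum>b'\<in>keys x. \<Sum>c'\<in>keys y. if b' = b then if c' = c then \<iota> (lookup x b) * lookup y c else 0 else 0)"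
    unfolding tensor_def lookup_sum lookup_single when_def by (intro sum.cong refl) auto
  also have "\<dots> = (\<Sum>b'\<in>keys x. if b' = b then \<iota> (lookup x b) * lookup y c else 0)"
    by (intro sum.cong refl) (auto simp: in_keys_iff)
  also have "\<dots> = \<iota> (lookup x b) * lookup y c"
    by (auto simp: in_keys_iff assms)
  finally show ?thesis .
qed

lemma tensor_simps:
  assumes "\<iota> 0 = 0"
  shows "tensor \<iota> x (y + y') = tensor \<iota> x y + tensor \<iota> x y'"
    "tensor \<iota> x (y - y') = tensor \<iota> x y - tensor \<iota> x y'"
    "tensor \<iota> x (scl c y) = scl c (tensor \<iota> x y)"
    "tensor \<iota> x (sum f A) = (\<Sum>a\<in>A. tensor \<iota> x (f a))"
proof -
  show "tensor \<iota> x (y + y') = tensor \<iota> x y + tensor \<iota> x y'" for y y'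
    by (rule poly_mapping_eqI) (auto simp: lookup_tensor[where \<iota>=\<iota>, OF assms] lookup_add algebra_simps split_paired_all)
  show "tensor \<iota> x (y - y') = tensor \<iota> x y - tensor \<iota> x y'"
    by (rule poly_mapping_eqI) (auto simp: lookup_tensor[where \<iota>=\<iota>, OF assms] lookup_minus algebra_simps split_paired_all)
  show "tensor \<iota> x (scl c y) = scl c (tensor \<iota> x y)"
    by (rule poly_mapping_eqI) (auto simp: lookup_tensor[where \<iota>=\<iota>, OF assms] lookup_scl algebra_simps split_paired_all)
  show "tensor \<iota> x (sum f A) = (\<Sum>a\<in>A. tensor \<iota> x (f a))"
    by (rule poly_mapping_eqI) (auto simp: lookup_tensor[where \<iota>=\<iota>, OF assms] lookup_sum sum_distrib_left split_paired_all)
qed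

lemma tensor_left_simps:
  "tensor (\<lambda>z. z) (x + x') y = tensor (\<lambda>z. z) x y + tensor (\<lambda>z. z) x' y"
  "tensor (\<lambda>z. z) (scl c x) y = scl c (tensor (\<lambda>z. z) x y)"
  by (rule poly_mapping_eqI;
      auto simp: lookup_tensor lookup_add lookup_scl algebra_simps split_paired_all)+

lemma tensor_bas: "\<iota> 0 = 0 \<Longrightarrow> \<iota> 1 = 1 \<Longrightarrow> tensor \<iota> (bas b) (bas c) = bas (b, c)"
  by (rule poly_mapping_eqI) (auto simp: lookup_tensor bas_def lookup_single when_def split_paired_all)

lemma is_linear_op_tensor: "is_linear (op_tensor X Y)"
  unfolding op_tensor_def by (rule is_linear_lin_ext)

lemma op_tensor_bas: "op_tensor X Y (bas (b, c)) = tensor (\<lambda>z. z) (X (bas b)) (Y (bas c))"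
  by (simp add: op_tensor_def)

text \<open>\<open>op_tensor\<close> knows X and Y on basis vectors only; linearity extends the
  formula first in y, against a basis vector, then in x.\<close>

lemma op_tensor_tensor:
  assumes "is_linear X" "is_linear Y"
  shows "op_tensor X Y (tensor (\<lambda>z. z) x y) = tensor (\<lambda>z. z) (X x) (Y y)"
proof -
  have "(\<lambda>y. op_tensor X Y (tensor (\<lambda>z. z) (bas b) y)) = (\<lambda>y. tensor (\<lambda>z. z) (X (bas b)) (Y y))" for b
    by (rule is_linear_eqI; (rule is_linearI)?)
       (simp_all add: tensor_simps is_linearD[OF is_linear_op_tensor] is_linearD[OF assms(2)]
         tensor_bas op_tensor_bas)
  then have "op_tensor X Y (tensor (\<lambda>z. z) (bas b) y) = tensor (\<lambda>z. z) (X (bas b)) (Y y)" for b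
    by metis
  then have "(\<lambda>x. op_tensor X Y (tensor (\<lambda>z. z) x y)) = (\<lambda>x. tensor (\<lambda>z. z) (X x) (Y y))"
    by (intro is_linear_eqI is_linearI)
       (simp_all add: tensor_left_simps is_linearD[OF is_linear_op_tensor] is_linearD[OF assms(1)])
  then show ?thesis by metis
qed

text \<open>The inner factors are evaluated on basis vectors, the outer ones on general tensors, so
  linearity is asked of X and Y.\<close>

lemma op_tensor_comp:
  assumes "is_linear X" "is_linear Y"
  shows "op_tensor X Y \<circ> op_tensor X' Y' = op_tensor (X \<circ> X') (Y \<circ> Y')"
  by (intro is_linear_eqI is_linear_comp is_linear_op_tensor)
     (auto simp: op_tensor_bas op_tensor_tensor[OF assms] split_paired_all)

lemma op_tensor_id: "op_tensor (\<lambda>x. x) (\<lambda>y. y) = (\<lambda>z. z)"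
  by (intro is_linear_eqI is_linear_op_tensor is_linear_id)
     (auto simp: op_tensor_bas tensor_bas split_paired_all)

lemma coeffwise_bij:
  assumes "is_linear T" "bij T"
  shows "bij (coeffwise T)"
proof -
  have T: "T \<circ> inv T = (\<lambda>x. x)" "inv T \<circ> T = (\<lambda>x. x)"
    using assms(2) by (auto simp: fun_eq_iff bij_is_surj surj_f_inv_f bij_is_inj)
  have I: "(\<lambda>x. x) \<circ> (\<lambda>x. x) = (\<lambda>x. x)" by auto
  have "coeffwise T \<circ> coeffwise (inv T) = (\<lambda>x. x)" "coeffwise (inv T) \<circ> coeffwise T = (\<lambda>x. x)"
    unfolding coeffwise_def
    by (simp_all only: op_tensor_comp assms is_linear_inv is_linear_id T I op_tensor_id)
  then show ?thesis by (intro o_bij[of "coeffwise (inv T)"]) (simp_all add: id_def)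
qed


section \<open>Filtration by Clifford degree\<close>

fun cdeg :: "'m cidx \<Rightarrow> nat" where
  "cdeg (A, B) = card A + card B"

text \<open>The strict bound makes level 0 the zero space and lets a contraction map level
  \<open>Suc d\<close> to level d without a separate case for degree 0.\<close>

definition cfil :: "nat \<Rightarrow> 'm cl set" where
  "cfil d = {x. \<forall>S\<in>keys x. cdeg S < d}"

lemma cfil_closed:
  "x \<in> cfil d \<Longrightarrow> y \<in> cfil d \<Longrightarrow> x + y \<in> cfil d" "x \<in> cfil d \<Longrightarrow> scl c x \<in> cfil d"
  "x \<in> cfil d \<Longrightarrow> d \<le> d' \<Longrightarrow> x \<in> cfil d'" "cdeg S < d \<Longrightarrow> bas S \<in> cfil d"
  using Poly_Mapping.keys_add[of x y] keys_scl[of c x] by (fastforce simp: cfil_def)+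

lemma is_linear_generators:
  "is_linear (ext_f a)" "is_linear (ext_fd a)" "is_linear (contr_f a)" "is_linear (contr_fd a)"
  "is_linear (cl_f a)" "is_linear (cl_fd a)" "is_linear (chev_f a)" "is_linear (chev_fd a)"
proof -
  show *: "is_linear (ext_f a)" "is_linear (ext_fd a)" "is_linear (contr_f a)" "is_linear (contr_fd a)"
    unfolding ext_f_def ext_fd_def contr_f_def contr_fd_def by (rule is_linear_lin_ext)+
  have "cl_f a = (\<lambda>x. ext_f a x)" "cl_fd a = (\<lambda>x. ext_fd a x + contr_f a x)"
    "chev_f a = (\<lambda>x. ext_f a x + scl (1/2) (contr_fd a x))"
    "chev_fd a = (\<lambda>x. ext_fd a x + scl (1/2) (contr_f a x))"
    by (simp_all add: fun_eq_iff cl_f_def cl_fd_def chev_f_def chev_fd_def)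
  then show "is_linear (cl_f a)" "is_linear (cl_fd a)" "is_linear (chev_f a)" "is_linear (chev_fd a)"
    using * by (auto intro!: is_linear_plus is_linear_scl)
qed

lemma cfil_is_linear:
  assumes "is_linear T" "\<And>S. S \<in> keys x \<Longrightarrow> T (bas S) \<in> cfil d'"
  shows "T x \<in> cfil d'"
  using keys_is_linear[OF assms(1), of x] assms(2) by (fastforce simp: cfil_def)

lemma cfil_ext:
  fixes x :: "'m::{finite,linorder} cl"
  assumes "x \<in> cfil d"
  shows "ext_f a x \<in> cfil (Suc d)" "ext_fd a x \<in> cfil (Suc d)"
proof -
  show "ext_f a x \<in> cfil (Suc d)"
    using assms
    by - (rule cfil_is_linear[OF is_linear_generators(1)], auto simp: ext_f_def cfil_def split_paired_all split: if_splits)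
  show "ext_fd a x \<in> cfil (Suc d)"
    using assms
    by - (rule cfil_is_linear[OF is_linear_generators(2)], auto simp: ext_fd_def cfil_def split_paired_all split: if_splits)
qed

lemma cfil_contr:
  fixes x :: "'m::{finite,linorder} cl"
  assumes "x \<in> cfil (Suc d)"
  shows "contr_f a x \<in> cfil d" "contr_fd a x \<in> cfil d"
proof -
  have *: "card (A - {a}) < card A" if "a \<in> A" for A :: "'m set"
    using that by (intro psubset_card_mono) auto
  show "contr_f a x \<in> cfil d"
    using assms *
    by - (rule cfil_is_linear[OF is_linear_generators(3)], fastforce simp: contr_f_def cfil_def split_paired_all split: if_splits)
  show "contr_fd a x \<in> cfil d"
    using assms *
    by - (rule cfil_is_linear[OF is_linear_generators(4)], fastforce simp: contr_fd_def cfil_def split_paired_all split: if_splits)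
qed

text \<open>The contraction summands lower the degree, so these multiplications raise it no more
  than the exterior ones do.\<close>

lemma cfil_cl:
  fixes x :: "'m::{finite,linorder} cl"
  assumes "x \<in> cfil d"
  shows "cl_f a x \<in> cfil (Suc d)" "cl_fd a x \<in> cfil (Suc d)"
    "chev_f a x \<in> cfil (Suc d)" "chev_fd a x \<in> cfil (Suc d)"
proof -
  have "x \<in> cfil (Suc d)" using assms by (rule cfil_closed) simp
  then have "contr_f a x \<in> cfil d" "contr_fd a x \<in> cfil d" by (simp_all add: cfil_contr)
  then have "contr_f a x \<in> cfil (Suc d)" "contr_fd a x \<in> cfil (Suc d)"
    by (auto intro: cfil_closed(3))
  then show "cl_f a x \<in> cfil (Suc d)" "cl_fd a x \<in> cfil (Suc d)"
    "chev_f a x \<in> cfil (Suc d)" "chev_fd a x \<in> cfil (Suc d)"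
    using cfil_ext[OF assms]
    by (auto simp: cl_f_def cl_fd_def chev_f_def chev_fd_def intro!: cfil_closed(1,2))
qed

lemma cfil_foldr:
  assumes "\<And>a x d. x \<in> cfil d \<Longrightarrow> u a x \<in> cfil (Suc d)" "x \<in> cfil d"
  shows "foldr u xs x \<in> cfil (d + length xs)"
  using assms by (induction xs) auto

lemma cfil_ordered_prod:
  fixes A :: "'m::{finite,linorder} set"
  assumes "\<And>a x d. x \<in> cfil d \<Longrightarrow> u a x \<in> cfil (Suc d)" "\<And>a x d. x \<in> cfil d \<Longrightarrow> v a x \<in> cfil (Suc d)"
  shows "ordered_prod u v (A, B) \<in> cfil (Suc (card A + card B))"
proof -
  have "cl_one \<in> cfil (Suc 0)" by (auto simp: cl_one_def intro: cfil_closed)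
  then have "foldr v (sorted_list_of_set B) cl_one \<in> cfil (Suc 0 + card B)"
    using cfil_foldr[where u=v and xs="sorted_list_of_set B", OF assms(2)] by fastforce
  then have "foldr u (sorted_list_of_set A) (foldr v (sorted_list_of_set B) cl_one)
      \<in> cfil (Suc 0 + card B + card A)"
    using cfil_foldr[where u=u and xs="sorted_list_of_set A", OF assms(1)] by fastforce
  then show ?thesis by (simp add: ordered_prod_def add_ac)
qed

text \<open>\<open>foldr\<close> over an increasing list inserts the smallest index last, hence with
  sign 1.\<close>

lemma ksign_minimal: "(\<And>b. b \<in> A \<Longrightarrow> a < b) \<Longrightarrow> ksign A a = 1"
proof -
  assume "\<And>b. b \<in> A \<Longrightarrow> a < b"
  then have "{b\<in>A. b < a} = {}" by (auto dest: less_asym)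
  then show ?thesis by (simp only: ksign_def) simp
qed

text \<open>Each new index is the smallest so far, so the wedge part builds the next monomial with
  sign 1; the contraction and the image of the previous error stay below the top degree.\<close>

lemma chev_prod_fd:
  fixes xs :: "'m::{finite,linorder} list"
  assumes "sorted_wrt (<) xs"
  shows "foldr chev_fd xs cl_one - bas ({}, set xs) \<in> cfil (length xs)"
  using assms
proof (induction xs)
  case Nil
  then show ?case by (simp add: cl_one_def cfil_def)
next
  case (Cons a xs)
  let ?r = "foldr chev_fd xs cl_one - bas ({}, set xs)" and ?e = "bas ({}, set xs) :: 'm cl"
  have len: "card (set xs) = length xs"
    using Cons.prems by (intro distinct_card) (auto simp: strict_sorted_iff)
  have "ext_fd a ?e = bas ({}, insert a (set xs))"
    using Cons.prems by (auto simp: ext_fd_def ksign_minimal) (simp add: bas_def)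
  then have "chev_fd a ?e - bas ({}, insert a (set xs)) = scl (1/2) (contr_f a ?e)"
    by (simp add: chev_fd_def)
  also have "\<dots> \<in> cfil (Suc (length xs))"
    using cfil_contr(1)[of ?e "length xs" a]
    by (auto intro!: cfil_closed(2) intro: cfil_closed(3) simp: cfil_closed(4) len)
  finally have "(chev_fd a ?e - bas ({}, insert a (set xs))) + chev_fd a ?r \<in> cfil (Suc (length xs))"
    using Cons by (intro cfil_closed(1) cfil_cl) auto
  then show ?case
    by (simp add: is_linearD[OF is_linear_generators(8)])
qed

text \<open>The factors of A are multiplied from the left, so those of B contribute no sign. The
  hypothesis on y is what \<open>chev_prod_fd\<close> delivers for the B part.\<close>

lemma chev_prod_f:
  fixes xs :: "'m::{finite,linorder} list"
  assumes "sorted_wrt (<) xs" "y - bas ({}, B) \<in> cfil (card B)"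
  shows "foldr chev_f xs y - bas (set xs, B) \<in> cfil (length xs + card B)"
  using assms(1)
proof (induction xs)
  case Nil
  then show ?case using assms by simp
next
  case (Cons a xs)
  let ?r = "foldr chev_f xs y - bas (set xs, B)" and ?e = "bas (set xs, B) :: 'm cl"
  have len: "card (set xs) = length xs"
    using Cons.prems by (intro distinct_card) (auto simp: strict_sorted_iff)
  have "ext_f a ?e = bas (insert a (set xs), B)"
    using Cons.prems by (auto simp: ext_f_def ksign_minimal) (simp add: bas_def)
  then have "chev_f a ?e - bas (insert a (set xs), B) = scl (1/2) (contr_fd a ?e)"
    by (simp add: chev_f_def)
  also have "\<dots> \<in> cfil (Suc (length xs + card B))"
    using cfil_contr(2)[of ?e "length xs + card B" a]
    by (auto intro!: cfil_closed(2) intro: cfil_closed(3) simp: cfil_closed(4) len)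
  finally have "(chev_f a ?e - bas (insert a (set xs), B)) + chev_f a ?r \<in> cfil (Suc (length xs + card B))"
    using Cons by (intro cfil_closed(1) cfil_cl) auto
  then show ?case
    by (simp add: is_linearD[OF is_linear_generators(7)])
qed

text \<open>This makes the symbol map unitriangular for the Clifford degree, hence
  invertible.\<close>

lemma sigma_Ch_bas:
  fixes S :: "'m::{finite,linorder} cidx"
  shows "sigma_Ch (bas S) - bas S \<in> cfil (cdeg S)"
proof (cases S)
  case (Pair A B)
  show ?thesis
    using chev_prod_f[of "sorted_list_of_set A" "foldr chev_fd (sorted_list_of_set B) cl_one" B]
      chev_prod_fd[of "sorted_list_of_set B"]
    by (simp add: Pair sigma_Ch_def ordered_prod_def)
qed

text \<open>\<open>cliff_parity\<close> counts all Clifford generators, not just modulo 2, so it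
  also serves as the degree.\<close>

definition pfil :: "nat \<Rightarrow> ('l, 'm) pcl set" where
  "pfil d = {x. \<forall>b\<in>keys x. cliff_parity b < d}"

lemma cliff_parity_cdeg: "cliff_parity (\<mu>, S) = cdeg S"
  by (cases S) simp

lemma pfil_closed:
  "x \<in> pfil d \<Longrightarrow> scl c x \<in> pfil d" "(\<And>a. a \<in> A \<Longrightarrow> f a \<in> pfil d) \<Longrightarrow> sum f A \<in> pfil d"
  "x \<in> pfil d \<Longrightarrow> d \<le> d' \<Longrightarrow> x \<in> pfil d'" "cliff_parity b < d \<Longrightarrow> bas b \<in> pfil d"
  using keys_scl[of c x] by (fastforce simp: pfil_def dest!: subsetD[OF keys_sum])+

lemma pfil_tensor: "y \<in> cfil d \<Longrightarrow> tensor (\<lambda>z. z) x y \<in> pfil d"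
  using keys_tensor[of "\<lambda>z. z" x y] by (force simp: pfil_def cfil_def cliff_parity_cdeg)

lemma pfil_op_tensor:
  assumes "F \<in> pfil d" "\<And>y. y \<in> cfil d \<Longrightarrow> Y y \<in> cfil d'"
  shows "op_tensor X Y F \<in> pfil d'"
proof -
  have "op_tensor X Y (bas b) \<in> pfil d'" if "b \<in> keys F" for b
  proof -
    obtain \<mu> S where Pair: "b = (\<mu>, S)" by (rule prod.exhaust)
    then have "cdeg S < d" using that assms(1) by (auto simp: pfil_def cliff_parity_cdeg)
    then show ?thesis by (simp add: Pair op_tensor_bas pfil_tensor assms(2) cfil_closed(4))
  qed
  then show ?thesis
    using keys_is_linear[OF is_linear_op_tensor, of X Y F] by (fastforce simp: pfil_def)
qed

lemma pfil_coeffwise: "F \<in> pfil d \<Longrightarrow> coeffwise T F \<in> pfil d"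
  unfolding coeffwise_def by (rule pfil_op_tensor)

text \<open>\<open>s_contr\<close> removes one generator; \<open>Capelli_inv\<close> touches only
  the polynomial coefficients.\<close>

lemma pfil_n_plus:
  fixes F :: "('l::finite, 'm::{finite,linorder}) pcl"
  assumes "F \<in> pfil (Suc d)"
  shows "n_plus i F \<in> pfil d"
proof -
  have "s_contr l F \<in> pfil d" for l unfolding s_contr_def
    by (rule pfil_closed(2), rule pfil_op_tensor[OF assms], rule cfil_contr(1))
  then show ?thesis unfolding n_plus_def
    by (intro pfil_closed(2) pfil_coeffwise)
qed

lemma dag_cl_bas: "dag_cl (bas S) = ordered_prod cl_fd cl_f S"
  by (simp add: dag_cl_def semilin_ext_def) (simp add: bas_def scl_simps)

lemma dag_ext_bas: "dag_ext (bas S) = ordered_prod ext_fd ext_f S"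
  by (simp add: dag_ext_def semilin_ext_def) (simp add: bas_def scl_simps)

lemma pfil_semilin_ext:
  assumes "F \<in> pfil d" "\<And>b. f b \<in> pfil (Suc (cliff_parity b))"
  shows "semilin_ext \<tau> f F \<in> pfil d"
  using keys_semilin_ext[of \<tau> f F] assms by (fastforce simp: pfil_def)

text \<open>Conjugation puts the generators in the wrong order; bringing them back to normal order
  changes signs and, in the Clifford case, adds terms with fewer generators.\<close>

lemma pfil_dag:
  fixes F :: "('l, 'm::{finite,linorder}) pcl"
  assumes "F \<in> pfil d"
  shows "dag_pcl F \<in> pfil d" "dag_pext F \<in> pfil d"
proof -
  have "dag_cl (bas S) \<in> cfil (Suc (cdeg S))" for S :: "'m cidx"
    by (cases S) (simp add: dag_cl_bas cfil_ordered_prod cfil_cl)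
  then have "(case b of (\<mu>, S) \<Rightarrow> tensor (\<lambda>z. z) (dag_psc (bas \<mu>)) (dag_cl (bas S)))
      \<in> pfil (Suc (cliff_parity b))" for b :: "('l, 'm) pidx"
    by (cases b rule: prod.exhaust) (simp only: prod.case cliff_parity_cdeg pfil_tensor)
  then show "dag_pcl F \<in> pfil d"
    unfolding dag_pcl_def by (rule pfil_semilin_ext[OF assms])
  have "dag_ext (bas S) \<in> cfil (Suc (cdeg S))" for S :: "'m cidx"
    by (cases S) (simp add: dag_ext_bas cfil_ordered_prod cfil_ext)
  then have "(case b of (\<mu>, S) \<Rightarrow> tensor (\<lambda>z. z) (dag_psc (bas \<mu>)) (dag_ext (bas S)))
      \<in> pfil (Suc (cliff_parity b))" for b :: "('l, 'm) pidx"
    by (cases b rule: prod.exhaust) (simp only: prod.case cliff_parity_cdeg pfil_tensor)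
  then show "dag_pext F \<in> pfil d"
    unfolding dag_pext_def by (rule pfil_semilin_ext[OF assms])
qed

lemma pfil_n_minus:
  fixes F :: "('l::finite, 'm::{finite,linorder}) pcl"
  assumes "F \<in> pfil (Suc d)"
  shows "n_minus i F \<in> pfil d" "n_minus_ext i F \<in> pfil d"
  unfolding n_minus_def n_minus_ext_def
  by (rule pfil_dag(1), rule pfil_n_plus, rule pfil_dag(1), rule assms)
    (rule pfil_dag(2), rule pfil_n_plus, rule pfil_dag(2), rule assms)

text \<open>\<open>coeffwise\<close> extends linearly from monomials, so linearity holds whatever \<open>Capelli_inv\<close> is.\<close>

lemma is_linear_s_contr: "is_linear (s_contr l)"
  unfolding s_contr_def by (intro is_linear_Sum is_linear_op_tensor)

lemma is_linear_coeffwise: "is_linear (coeffwise T)"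
  unfolding coeffwise_def by (rule is_linear_op_tensor)

lemma is_linear_n_plus: "is_linear (n_plus i)"
proof -
  have "is_linear (coeffwise (Capelli_inv i l) \<circ> s_contr l)" for l
    by (intro is_linear_comp is_linear_coeffwise is_linear_s_contr)
  then have "is_linear (\<lambda>F. coeffwise (Capelli_inv i l) (s_contr l F))" for l
    by (simp add: comp_def)
  then have "is_linear (\<lambda>F. \<Sum>l\<in>UNIV. coeffwise (Capelli_inv i l) (s_contr l F))"
    by (intro is_linear_Sum)
  then show ?thesis by (simp add: n_plus_def[abs_def])
qed

text \<open>Both conjugations are antilinear, so their effects on scalars cancel.\<close>

lemma is_linear_n_minus_ext: "is_linear (n_minus_ext i)"
proof -
  have dag: "dag_pext (x + y) = dag_pext x + dag_pext y" "dag_pext (scl c x) = scl (cnj c) (dag_pext x)"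
    for x y :: "('c, 'd::linorder) pcl" and c
    unfolding dag_pext_def by (simp_all add: semilin_ext_add scl_semilin_ext)
  show ?thesis
    by (rule is_linearI) (simp_all add: n_minus_ext_def dag is_linearD[OF is_linear_n_plus])
qed

lemma is_linear_K_ext: "is_linear K_ext"
proof -
  have "is_linear (coeffwise (\<lambda>p. H i j * p) \<circ> (n_minus_ext j \<circ> n_plus i))" for i j
    by (intro is_linear_comp is_linear_coeffwise is_linear_n_plus is_linear_n_minus_ext)
  then have "is_linear (\<lambda>F. coeffwise (\<lambda>p. H i j * p) (n_minus_ext j (n_plus i F)))" for i j
    by (simp add: comp_def)
  then show ?thesis unfolding K_ext_def[abs_def]
    by (intro is_linear_scl is_linear_Sum)
qed

lemma K_ext_lower:
  fixes b :: "('l::finite, 'm::{finite,linorder}) pidx"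
  assumes "b' \<in> keys (K_ext (bas b))"
  shows "cliff_parity b' < cliff_parity b"
proof -
  have "bas b \<in> pfil (Suc (cliff_parity b))" by (simp add: pfil_closed)
  then have n: "n_plus i (bas b) \<in> pfil (cliff_parity b)" for i by (rule pfil_n_plus)
  have "n_minus_ext j (n_plus i (bas b)) \<in> pfil (cliff_parity b)" for i j
  proof -
    \<comment> \<open>Weakening the level by one gives the successor that
      \<open>pfil_n_minus\<close> asks for, also when b has degree 0.\<close>
    have "n_plus i (bas b) \<in> pfil (Suc (cliff_parity b))" using n by (rule pfil_closed) simp
    then show ?thesis by (rule pfil_n_minus)
  qed
  then have "K_ext (bas b) \<in> pfil (cliff_parity b)"
    unfolding K_ext_def by (intro pfil_closed(1,2) pfil_coeffwise)
  then show ?thesis using assms by (auto simp: pfil_def)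
qed

lemma cliff_parity_bound:
  fixes b :: "('l, 'm::finite) pidx"
  shows "cliff_parity b < Suc (2 * CARD('m))"
proof (cases b)
  case (fields \<mu> A B)
  then show ?thesis using card_mono[of UNIV A] card_mono[of UNIV B] by simp
qed

section \<open>Invertibility of the symbol map, of \<open>W\<close> and, given that of
  \<open>G_nf\<close>, of the PBW gauge\<close>

lemma op_exp_K_ext_linear_bij: "is_linear (op_exp K_ext)" "bij (op_exp K_ext)"
proof -
  have u: "unitriangular cliff_parity (op_exp K_ext)"
    by (rule unitriangular_op_exp[OF is_linear_K_ext K_ext_lower cliff_parity_bound])
  then show "is_linear (op_exp K_ext)" unfolding unitriangular_def by (rule conjunct1)
  show "bij (op_exp K_ext)" using u by (rule unitriangular_bij)
qed

lemma sigma_Ch_pcl_linear_bij: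
  shows "is_linear (sigma_Ch_pcl :: ('l, 'm::{finite,linorder}) pcl \<Rightarrow> _)"
    and "bij (sigma_Ch_pcl :: ('l, 'm::{finite,linorder}) pcl \<Rightarrow> _)"
proof -
  show l: "is_linear (sigma_Ch_pcl :: ('l, 'm) pcl \<Rightarrow> _)"
    unfolding sigma_Ch_pcl_def by (rule is_linear_op_tensor)
  have "cliff_parity b' < cliff_parity b" if "b' \<in> keys (sigma_Ch_pcl (bas b) - bas b)" for b b' :: "('l, 'm) pidx"
  proof -
    obtain \<mu> S where Pair: "b = (\<mu>, S)" by (rule prod.exhaust)
    have "sigma_Ch_pcl (bas b) - bas b = tensor (\<lambda>z. z) (bas \<mu>) (sigma_Ch (bas S) - bas S)"
      by (simp add: Pair sigma_Ch_pcl_def op_tensor_bas tensor_simps tensor_bas)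
    then have "sigma_Ch_pcl (bas b) - bas b \<in> pfil (cliff_parity b)"
      by (simp add: Pair pfil_tensor sigma_Ch_bas cliff_parity_cdeg)
    then show ?thesis using that by (auto simp: pfil_def)
  qed
  then have "unitriangular cliff_parity (sigma_Ch_pcl :: ('l, 'm) pcl \<Rightarrow> _)"
    using l by (auto simp: unitriangular_def)
  then show "bij (sigma_Ch_pcl :: ('l, 'm) pcl \<Rightarrow> _)" by (rule unitriangular_bij)
qed

lemma W_linear_bij:
  shows "is_linear (W :: ('l::finite, 'm::{finite,linorder}) pcl \<Rightarrow> _)"
    and "bij (W :: ('l::finite, 'm::{finite,linorder}) pcl \<Rightarrow> _)"
proof -
  show "is_linear (W :: ('l, 'm) pcl \<Rightarrow> _)" unfolding W_def
    by (rule is_linear_comp, rule is_linear_comp, rule is_linear_inv)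
      (rule sigma_Ch_pcl_linear_bij op_exp_K_ext_linear_bij)+
  show "bij (W :: ('l, 'm) pcl \<Rightarrow> _)" unfolding W_def
    by (rule bij_comp, rule sigma_Ch_pcl_linear_bij, rule bij_comp, rule op_exp_K_ext_linear_bij)
       (rule bij_imp_bij_inv, rule sigma_Ch_pcl_linear_bij)
qed

lemma G_PBW_linear_bij:
  assumes "is_linear (G_nf q :: ('l::finite, 'm::{finite,linorder}) psc \<Rightarrow> _)"
    "bij (G_nf q :: ('l, 'm) psc \<Rightarrow> _)"
  shows "is_linear (G_PBW q :: ('l, 'm) pcl \<Rightarrow> _)" "bij (G_PBW q :: ('l, 'm) pcl \<Rightarrow> _)"
proof -
  have "is_linear (coeffwise (G_nf q) :: ('l, 'm) pcl \<Rightarrow> _)"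
    unfolding coeffwise_def by (rule is_linear_op_tensor)
  then show "is_linear (G_PBW q :: ('l, 'm) pcl \<Rightarrow> _)" "bij (G_PBW q :: ('l, 'm) pcl \<Rightarrow> _)"
    unfolding G_PBW_def G_nf_Lambda_def
    by (intro is_linear_comp is_linear_inv bij_comp bij_imp_bij_inv sigma_Ch_pcl_linear_bij W_linear_bij
        coeffwise_bij assms; assumption)+
qed


section \<open>The Fischer form\<close>

text \<open>With finitely many variables there are finitely many monomials of bounded degree, so
  projections are onto finite spans.\<close>

instance bosvar :: (finite, finite) finite
proof
  have "(UNIV :: ('a, 'b) bosvar set) \<subseteq> (\<lambda>(i, a). Z i a) ` UNIV \<union> (\<lambda>(i, a). Zb i a) ` UNIV"
  proof
    fix v :: "('a, 'b) bosvar"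
    show "v \<in> (\<lambda>(i, a). Z i a) ` UNIV \<union> (\<lambda>(i, a). Zb i a) ` UNIV"
      by (cases v) auto
  qed
  then show "finite (UNIV :: ('a, 'b) bosvar set)" by (rule finite_subset) simp
qed

lemma bas_mult: "bas \<mu> * bas \<nu> = (bas (\<mu> + \<nu>) :: 'b::monoid_add \<Rightarrow>\<^sub>0 'k::semiring_1)"
  by (simp add: bas_def mult_single)

lemma scl_mult: "scl c p = single 0 c * (p :: 'b::monoid_add \<Rightarrow>\<^sub>0 'k::comm_ring_1)"
  by (simp add: scl_def mult_map_scale_conv_mult)

lemma mult_scl: "p * scl c r = scl c (p * r :: 'b::comm_monoid_add \<Rightarrow>\<^sub>0 'k::comm_ring_1)"
  "scl c p * r = scl c (p * r)"
  unfolding scl_mult by (simp_all only: mult_ac)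

lemma is_linear_mult: "is_linear (\<lambda>p. r * p :: 'b::comm_monoid_add \<Rightarrow>\<^sub>0 'k::comm_ring_1)"
  by (rule is_linearI) (simp_all add: mult_scl algebra_simps)

lemma sum_scl_bas: "(\<Sum>b\<in>keys p. scl (lookup p b) (bas b)) = p"
  using sum_singles[of p] by (simp add: single_scl_bas)

lemma lookup_bas: "lookup (bas b) c = (if b = c then 1 else 0)"
  by (simp add: bas_def lookup_single when_def)

lemma lookup_bas_mult:
  fixes \<epsilon> :: "'v \<Rightarrow>\<^sub>0 nat" and p :: "('v \<Rightarrow>\<^sub>0 nat) \<Rightarrow>\<^sub>0 'k::comm_ring_1"
  shows "lookup (bas \<epsilon> * p) (\<epsilon> + \<mu>) = lookup p \<mu>"
proof -
  have eq: "bas \<epsilon> * p = (\<Sum>\<kappa>\<in>keys p. scl (lookup p \<kappa>) (bas (\<epsilon> + \<kappa>)))"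
    by (subst sum_scl_bas[of p, symmetric]) (simp add: sum_distrib_left mult_scl bas_mult)
  have "lookup (bas \<epsilon> * p) (\<epsilon> + \<mu>) = (\<Sum>\<kappa>\<in>keys p. if \<kappa> = \<mu> then lookup p \<mu> else 0)"
    unfolding eq lookup_sum lookup_scl lookup_bas by (intro sum.cong) auto
  then show ?thesis by (simp add: in_keys_iff)
qed

text \<open>The multifactorial \<mu>!, which is the squared Fischer norm of the monomial.\<close>

definition mfact :: "('v \<Rightarrow>\<^sub>0 nat) \<Rightarrow> nat" where
  "mfact \<mu> = (\<Prod>v\<in>keys \<mu>. fact (lookup \<mu> v))"

lemma mfact_Suc: "mfact (\<mu> + single v 1) = Suc (lookup \<mu> v) * mfact \<mu>"
proof -
  let ?S = "insert v (keys \<mu>)"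
  have *: "mfact \<nu> = (\<Prod>v\<in>?S. fact (lookup \<nu> v))" if "keys \<nu> \<subseteq> ?S" for \<nu>
    unfolding mfact_def using that by (intro prod.mono_neutral_left) (auto simp: in_keys_iff)
  have 1: "keys (\<mu> + single v 1) \<subseteq> ?S" "keys \<mu> \<subseteq> ?S"
    using Poly_Mapping.keys_add[of \<mu> "single v 1"] by auto
  have S: "?S = insert v (keys \<mu> - {v})" by auto
  have "(\<Prod>x\<in>keys \<mu> - {v}. fact (lookup (\<mu> + single v 1) x)) = (\<Prod>x\<in>keys \<mu> - {v}. fact (lookup \<mu> x) :: nat)"
    by (intro prod.cong) (auto simp: lookup_add lookup_single when_def)
  then show ?thesis
    unfolding *[OF 1(1)] *[OF 1(2)] S
    by (simp add: lookup_add lookup_single algebra_simps del: insert_Diff_single)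
qed

lemma mfact_pos: "mfact \<mu> > 0"
  by (auto simp: mfact_def intro: prod_pos)

text \<open>The Fischer (or Bombieri) form: the value at 0 of the result of applying to p the
  differential operator obtained from r by conjugating coefficients and replacing variables by
  derivatives.\<close>

definition fischer :: "('l, 'm) psc \<Rightarrow> ('l, 'm) psc \<Rightarrow> complex" where
  "fischer p r = (\<Sum>\<mu>\<in>keys p. lookup p \<mu> * cnj (lookup r \<mu>) * of_nat (mfact \<mu>))"

lemma fischer_superset:
  assumes "finite S" "keys p \<subseteq> S"
  shows "fischer p r = (\<Sum>\<mu>\<in>S. lookup p \<mu> * cnj (lookup r \<mu>) * of_nat (mfact \<mu>))"
  unfolding fischer_def using assms by (intro sum.mono_neutral_left) (auto simp: in_keys_iff)

lemma fischer_simps: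
  "fischer (p + p') r = fischer p r + fischer p' r" "fischer (scl c p) r = c * fischer p r"
  "fischer p (r + r') = fischer p r + fischer p r'" "fischer p (scl c r) = cnj c * fischer p r"
  "fischer 0 r = 0" "fischer p 0 = 0" "fischer p (r - r') = fischer p r - fischer p r'"
  "fischer (sum f A) r = (\<Sum>a\<in>A. fischer (f a) r)" "fischer p (sum f A) = (\<Sum>a\<in>A. fischer p (f a))"
proof -
  show *: "fischer (p + p') r = fischer p r + fischer p' r" for p p' r
  proof -
    have S: "keys (p + p') \<subseteq> keys p \<union> keys p'" by (rule Poly_Mapping.keys_add)
    show ?thesis
      by (simp add: fischer_superset[OF _ S] fischer_superset[of "keys p \<union> keys p'" p]
          fischer_superset[of "keys p \<union> keys p'" p'] lookup_add distrib_right sum.distrib)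
  qed
  show "fischer (scl c p) r = c * fischer p r"
    using keys_scl[of c p]
    by (simp add: fischer_superset[of "keys p" "scl c p"] fischer_def[of p] lookup_scl
        sum_distrib_left mult.assoc)
  show **: "fischer p (r + r') = fischer p r + fischer p r'" "fischer p (scl c r) = cnj c * fischer p r"
    "fischer p (r - r') = fischer p r - fischer p r'" for r r'
    by (simp_all add: fischer_def lookup_add lookup_scl lookup_minus algebra_simps sum.distrib
        sum_subtractf sum_distrib_left)
  show 0: "fischer 0 r = 0" "fischer p 0 = 0" for r by (simp_all add: fischer_def)
  show "fischer (sum f A) r = (\<Sum>a\<in>A. fischer (f a) r)"
    by (induction A rule: infinite_finite_induct) (auto simp: * 0)
  show "fischer p (sum f A) = (\<Sum>a\<in>A. fischer p (f a))"
    by (induction A rule: infinite_finite_induct) (auto simp: ** 0)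
qed

lemma fischer_bas: "fischer (bas \<mu>) r = cnj (lookup r \<mu>) * of_nat (mfact \<mu>)"
  by (simp add: fischer_def) (simp add: bas_def)

lemma fischer_definite: "fischer p p = 0 \<Longrightarrow> p = 0"
proof (rule ccontr)
  assume "p \<noteq> 0" and 0: "fischer p p = 0"
  define X where "X = (\<Sum>\<mu>\<in>keys p. (cmod (lookup p \<mu>))\<^sup>2 * real (mfact \<mu>))"
  have "fischer p p = complex_of_real X"
    by (simp add: X_def fischer_def complex_norm_square flip: of_real_power)
  moreover have "X > 0"
    unfolding X_def using \<open>p \<noteq> 0\<close> by (intro sum_pos) (auto simp: mfact_pos in_keys_iff)
  ultimately show False using 0 by simp
qed

section \<open>Adjointness of multiplication and differentiation\<close>

lemma is_linear_pd: "is_linear (pd v)"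
  unfolding pd_def by (rule is_linear_lin_ext)

text \<open>Exponents are subtracted with truncation; the monomials without v, where this goes
  wrong, carry the factor 0.\<close>

lemma lookup_pd: "lookup (pd v r) \<mu> = of_nat (Suc (lookup \<mu> v)) * lookup r (\<mu> + single v 1)"
proof -
  have eq: "\<nu> - single v 1 = \<mu> \<longleftrightarrow> \<nu> = \<mu> + single v 1" if "lookup \<nu> v \<noteq> 0" for \<nu> :: "('a, 'b) mono"
  proof
    assume "\<nu> - single v 1 = \<mu>"
    then show "\<nu> = \<mu> + single v 1"
      using that by (intro poly_mapping_eqI) (auto simp: lookup_add lookup_minus lookup_single when_def)
  qed simp
  have "lookup (pd v (bas \<nu>)) \<mu> = of_nat (Suc (lookup \<mu> v)) * lookup (bas \<nu>) (\<mu> + single v 1)"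
    for \<nu> :: "('a, 'b) mono"
  proof (cases "lookup \<nu> v = 0")
    case True
    then have "\<nu> \<noteq> \<mu> + single v 1" by (auto simp: lookup_add)
    with True show ?thesis by (simp add: pd_def lookup_bas)
  next
    case False
    then show ?thesis using eq[OF False]
      by (auto simp: pd_def lookup_bas lookup_single when_def)
        (auto simp: lookup_add simp flip: of_nat_Suc)
  qed
  then have "lookup (pd v (\<Sum>\<nu>\<in>keys r. scl (lookup r \<nu>) (bas \<nu>))) \<mu> =
      of_nat (Suc (lookup \<mu> v)) * lookup (\<Sum>\<nu>\<in>keys r. scl (lookup r \<nu>) (bas \<nu>)) (\<mu> + single v 1)"
    by (simp add: is_linear_sum[OF is_linear_pd] is_linearD[OF is_linear_pd] lookup_sum lookup_scl
        sum_distrib_left mult_ac del: of_nat_Suc)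
  then show ?thesis by (simp only: sum_scl_bas)
qed

text \<open>On monomials this comes from (\<mu> + e_v)! = (\<mu>_v + 1) \<mu>!.\<close>

lemma fischer_var: "fischer (var v * p) r = fischer p (pd v r)"
proof -
  have "fischer (var v * bas \<mu>) r = fischer (bas \<mu>) (pd v r)" for \<mu>
  proof -
    have "var v * bas \<mu> = bas (\<mu> + single v 1)"
      by (simp add: var_def bas_def mult_single add.commute)
    then show ?thesis
      using mfact_Suc[of \<mu> v] by (simp add: fischer_bas lookup_pd algebra_simps)
  qed
  then have "fischer (var v * (\<Sum>\<mu>\<in>keys p. scl (lookup p \<mu>) (bas \<mu>))) r =
      fischer (\<Sum>\<mu>\<in>keys p. scl (lookup p \<mu>) (bas \<mu>)) (pd v r)"
    by (simp add: sum_distrib_left mult_scl fischer_simps)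
  then show ?thesis by (simp only: sum_scl_bas)
qed

lemma fischer_H: "fischer (H i j * p) r = fischer p (Lap i j r)"
proof -
  \<comment> \<open>With the factors in this order the two adjunctions produce the derivatives in
    the order of \<open>Lap\<close>.\<close>
  have "H i j * p = (\<Sum>a\<in>UNIV. var (Zb j a) * (var (Z i a) * p))"
    unfolding H_def sum_distrib_right by (simp only: mult_ac)
  then show ?thesis by (simp add: fischer_simps fischer_var Lap_def)
qed

lemma H_pow_add: "H_pow (\<lambda>v. \<alpha> v + \<beta> v) = H_pow \<alpha> * H_pow \<beta>"
  by (simp add: H_pow_def power_add prod.distrib split_def)

lemma H_pow_0: "H_pow (\<lambda>_. 0) = 1"
  by (simp add: H_pow_def split_def)

lemma H_pow_upd:
  "H_pow (\<alpha>((i, j) := Suc (\<alpha> (i, j)))) = (H i j * H_pow \<alpha> :: ('a::finite, 'b::finite) psc)"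
proof -
  define \<alpha>' where "\<alpha>' = \<alpha>((i, j) := Suc (\<alpha> (i, j)))"
  have "(\<Prod>v\<in>UNIV - {(i, j)}. H (fst v) (snd v) ^ \<alpha>' v) =
      (\<Prod>v\<in>UNIV - {(i, j)}. H (fst v) (snd v) ^ \<alpha> v :: ('a::finite, 'b::finite) psc)"
    by (intro prod.cong) (auto simp: \<alpha>'_def)
  moreover have "\<alpha>' (i, j) = Suc (\<alpha> (i, j))" by (simp add: \<alpha>'_def)
  ultimately have "H_pow \<alpha>' = (H i j * H_pow \<alpha> :: ('a, 'b) psc)"
    by (simp add: H_pow_def split_def prod.remove[of UNIV "(i, j)"] mult.assoc)
  then show ?thesis by (simp only: \<alpha>'_def)
qed

text \<open>Some exponent is positive, so one factor H_ij splits off and moves over as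
  \<open>Lap i j\<close>, which kills h.\<close>

lemma fischer_H_pow_harmonic:
  fixes h :: "('a::finite, 'b::finite) psc"
  assumes "harmonic h" "\<alpha> \<noteq> (\<lambda>_. 0)"
  shows "fischer (H_pow \<alpha> * p) h = 0"
proof -
  obtain i j where ij: "\<alpha> (i, j) \<noteq> 0" using assms(2) by (auto simp: fun_eq_iff)
  define \<beta> where "\<beta> = \<alpha>((i, j) := \<alpha> (i, j) - 1)"
  have "\<alpha> = \<beta>((i, j) := Suc (\<beta> (i, j)))" using ij by (auto simp: \<beta>_def)
  then have "H_pow \<alpha> = (H i j * H_pow \<beta> :: ('a, 'b) psc)" using H_pow_upd[of \<beta> i j] by simp
  then have "fischer (H_pow \<alpha> * p) h = fischer (H i j * (H_pow \<beta> * p)) h"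
    by (simp add: mult.assoc)
  then show ?thesis using assms(1) by (simp only: fischer_H harmonic_def fischer_simps)
qed

text \<open>The vectors may be linearly dependent. In the step, the new vector is made orthogonal to
  the earlier ones by the induction hypothesis with \<open>v k\<close> in place of p, and the
  residue of p is corrected along the result e.\<close>

lemma gram_schmidt:
  assumes "finite I"
  shows "\<exists>c. \<forall>k\<in>I. fischer (v k) (p - (\<Sum>l\<in>I. scl (c l) (v l))) = 0"
  using assms
proof (induction I arbitrary: p)
  case (insert k I)
  obtain c' where c': "\<forall>l\<in>I. fischer (v l) (v k - (\<Sum>l\<in>I. scl (c' l) (v l))) = 0"
    using insert.IH by blast
  obtain c where c: "\<forall>l\<in>I. fischer (v l) (p - (\<Sum>l\<in>I. scl (c l) (v l))) = 0"
    using insert.IH by blast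
  define e where "e = v k - (\<Sum>l\<in>I. scl (c' l) (v l))"
  define r where "r = p - (\<Sum>l\<in>I. scl (c l) (v l))"
  \<comment> \<open>The form is antilinear in the second argument, hence the conjugate; for e = 0
    division by zero gives t = 0.\<close>
  define t where "t = cnj (fischer e r / fischer e e)"
  define d where "d l = (if l = k then t else c l - t * c' l)" for l
  have eq: "p - (\<Sum>l\<in>insert k I. scl (d l) (v l)) = r - scl t e"
  proof -
    have "(\<Sum>l\<in>I. scl (d l) (v l)) = (\<Sum>l\<in>I. scl (c l) (v l)) - scl t (\<Sum>l\<in>I. scl (c' l) (v l))"
      unfolding scl_sum sum_subtractf[symmetric] using insert.hyps
      by (intro sum.cong refl poly_mapping_eqI) (auto simp: d_def lookup_scl lookup_minus algebra_simps)
    then show ?thesis using insert.hyps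
      by (simp add: r_def e_def d_def scl_diff)
  qed
  have I: "fischer (v l) (r - scl t e) = 0" if "l \<in> I" for l
    using c c' that by (simp add: fischer_simps r_def e_def)
  have "fischer e (r - scl t e) = 0"
  proof (cases "e = 0")
    case False
    then have "fischer e e \<noteq> 0" using fischer_definite by blast
    then show ?thesis by (simp add: fischer_simps t_def)
  qed (simp add: fischer_simps)
  moreover have "v k = e + (\<Sum>l\<in>I. scl (c' l) (v l))" by (simp add: e_def)
  ultimately have "fischer (v k) (r - scl t e) = 0"
    using I by (simp add: fischer_simps(1,2,8))
  with I show ?case unfolding eq[symmetric] by blast
qed simp

text \<open>Weight 1 gives the total degree, \<open>wvar\<close> the weight that selects leading
  monomials.\<close>

definition wt :: "('v \<Rightarrow> nat) \<Rightarrow> ('v \<Rightarrow>\<^sub>0 nat) \<Rightarrow> nat" where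
  "wt w \<mu> = (\<Sum>v\<in>keys \<mu>. w v * lookup \<mu> v)"

lemma wt_add: "wt w (\<mu> + \<nu>) = wt w \<mu> + wt w \<nu>"
proof -
  let ?S = "keys \<mu> \<union> keys \<nu>"
  have "wt w \<kappa> = (\<Sum>v\<in>?S. w v * lookup \<kappa> v)" if "keys \<kappa> \<subseteq> ?S" for \<kappa>
    unfolding wt_def using that by (intro sum.mono_neutral_left) (auto simp: in_keys_iff)
  then show ?thesis using Poly_Mapping.keys_add[of \<mu> \<nu>]
    by (simp add: lookup_add algebra_simps sum.distrib)
qed

lemma wt_single: "wt w (single v k) = w v * k"
  by (simp add: wt_def)

definition mdeg :: "('v \<Rightarrow>\<^sub>0 nat) \<Rightarrow> nat" where
  "mdeg \<mu> = wt (\<lambda>_. 1) \<mu>"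

lemma mdeg_simps: "mdeg (\<mu> + \<nu>) = mdeg \<mu> + mdeg \<nu>" "mdeg (single v k) = k"
  by (simp_all add: mdeg_def wt_add wt_single)

lemma finite_monomials:
  "finite {\<mu> :: 'v::finite \<Rightarrow>\<^sub>0 nat. mdeg \<mu> < d}"
proof -
  have "lookup \<mu> v < d" if "mdeg \<mu> < d" for \<mu> :: "'v \<Rightarrow>\<^sub>0 nat" and v
  proof (cases "v \<in> keys \<mu>")
    case True
    then have "lookup \<mu> v \<le> mdeg \<mu>" by (simp add: mdeg_def wt_def member_le_sum)
    then show ?thesis using that by simp
  qed (use that in \<open>auto simp: in_keys_iff\<close>)
  then have "lookup ` {\<mu> :: 'v \<Rightarrow>\<^sub>0 nat. mdeg \<mu> < d} \<subseteq> {f. \<forall>v. (v \<in> UNIV \<longrightarrow> f v \<in> {..<d}) \<and> (v \<notin> UNIV \<longrightarrow> f v = 0)}"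
    by auto
  moreover have "finite {f :: 'v \<Rightarrow> nat. \<forall>v. (v \<in> UNIV \<longrightarrow> f v \<in> {..<d}) \<and> (v \<notin> UNIV \<longrightarrow> f v = 0)}"
    by (rule finite_set_of_finite_funs) auto
  ultimately have "finite (lookup ` {\<mu> :: 'v \<Rightarrow>\<^sub>0 nat. mdeg \<mu> < d})" by (rule finite_subset)
  then show ?thesis by (rule finite_imageD) (auto simp: inj_on_def lookup_inject)
qed


section \<open>Existence of harmonic expansions\<close>

text \<open>Let h be p minus its projection to the span of the products of an H_ij with a monomial
  of degree below d. By adjunction \<open>Lap i j h\<close> is orthogonal to all monomials of degree
  below d; from degree d on it has no terms, because h has degree below d + 2.\<close>

lemma fischer_decomposition:
  fixes p :: "('l::finite, 'm::finite) psc"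
  assumes "\<And>\<mu>. \<mu> \<in> keys p \<Longrightarrow> mdeg \<mu> < d + 2"
  obtains h f where "harmonic h" "p = h + (\<Sum>(i, j)\<in>UNIV. H i j * f i j)"
    "\<And>i j \<mu>. \<mu> \<in> keys (f i j) \<Longrightarrow> mdeg \<mu> < d"
proof -
  let ?M = "{\<mu> :: ('l, 'm) mono. mdeg \<mu> < d}"
  let ?v = "\<lambda>((i, j), \<mu>). H i j * bas \<mu> :: ('l, 'm) psc"
  have fin: "finite ((UNIV :: ('l \<times> 'l) set) \<times> ?M)" by (intro finite_cartesian_product finite_monomials) simp
  obtain c where c: "\<forall>k\<in>UNIV \<times> ?M. fischer (?v k) (p - (\<Sum>l\<in>UNIV \<times> ?M. scl (c l) (?v l))) = 0"
    using gram_schmidt[OF fin, of ?v p] by blast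
  define f where "f i j = (\<Sum>\<mu>\<in>?M. scl (c ((i, j), \<mu>)) (bas \<mu> :: ('l, 'm) psc))" for i j
  define h where "h = p - (\<Sum>(i, j)\<in>UNIV. H i j * f i j)"
  have keysf: "mdeg \<mu> < d" if \<mu>: "\<mu> \<in> keys (f i j)" for i j \<mu>
  proof -
    obtain \<nu> where "\<nu> \<in> ?M" "\<mu> \<in> keys (scl (c ((i, j), \<nu>)) (bas \<nu> :: ('l, 'm) psc))"
      using \<mu> subsetD[OF keys_sum, of \<mu> "\<lambda>\<nu>. scl (c ((i, j), \<nu>)) (bas \<nu> :: ('l, 'm) psc)" ?M]
      unfolding f_def by blast
    then show ?thesis using keys_scl[of _ "bas \<nu> :: ('l, 'm) psc"] by auto
  qed
  have "(\<Sum>(i, j)\<in>UNIV. H i j * f i j) = (\<Sum>ij\<in>UNIV. \<Sum>\<mu>\<in>?M. scl (c (ij, \<mu>)) (?v (ij, \<mu>)))"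
    by (intro sum.cong refl) (auto simp: f_def sum_distrib_left mult_scl)
  also have "\<dots> = (\<Sum>l\<in>UNIV \<times> ?M. scl (c l) (?v l))"
    unfolding sum.cartesian_product by (intro sum.cong refl) auto
  finally have h: "h = p - (\<Sum>l\<in>UNIV \<times> ?M. scl (c l) (?v l))" by (simp only: h_def)
  have orth: "fischer (H i j * bas \<mu>) h = 0" if "\<mu> \<in> ?M" for i j \<mu>
    using bspec[OF c, of "((i, j), \<mu>)"] that by (simp add: h)
  have Hdeg: "mdeg \<mu> = 2" if "\<mu> \<in> keys (H i j)" for i j and \<mu> :: "('l, 'm) mono"
    using that unfolding H_def
    by (auto dest!: subsetD[OF keys_sum] simp: var_def mult_single mdeg_simps)
  have keysh: "mdeg \<mu> < d + 2" if "\<mu> \<in> keys h" for \<mu>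
  proof (cases "\<mu> \<in> keys p")
    case False
    then have "\<mu> \<in> keys (\<Sum>(i, j)\<in>UNIV. H i j * f i j)"
      using that keys_diff[of p] unfolding h_def by blast
    then obtain i j where "\<mu> \<in> keys (H i j * f i j)" by (auto dest!: subsetD[OF keys_sum])
    then obtain \<nu> \<kappa> where "\<mu> = \<nu> + \<kappa>" "\<nu> \<in> keys (H i j)" "\<kappa> \<in> keys (f i j)"
      using keys_mult[of "H i j" "f i j"] by auto
    then show ?thesis using Hdeg keysf by (fastforce simp: mdeg_simps)
  qed (use assms in auto)
  have "Lap i j h = 0" for i j
  proof (rule poly_mapping_eqI)
    fix \<mu>
    show "lookup (Lap i j h) \<mu> = lookup 0 \<mu>"
    proof (cases "\<mu> \<in> ?M")
      case True
      then have "fischer (bas \<mu>) (Lap i j h) = 0" using orth by (simp flip: fischer_H)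
      then show ?thesis using mfact_pos[of \<mu>] by (simp add: fischer_bas)
    next
      case False
      then have "\<mu> + single (Z i a) 1 + single (Zb j a) 1 \<notin> keys h" for a
        using keysh by (fastforce simp: mdeg_simps)
      then show ?thesis by (simp add: Lap_def lookup_sum lookup_pd in_keys_iff)
    qed
  qed
  then have "harmonic h" by (simp add: harmonic_def)
  moreover have "p = h + (\<Sum>(i, j)\<in>UNIV. H i j * f i j)" by (simp add: h_def)
  ultimately show ?thesis by (rule that[OF _ _ keysf])
qed

text \<open>The constant g = 1 evaluates an expansion; g = \<open>g_coeff\<close> yields
  \<open>G_nf\<close>.\<close>

definition hsum :: "(('l \<times> 'l \<Rightarrow> nat) \<Rightarrow> complex) \<Rightarrow> (('l \<times> 'l \<Rightarrow> nat) \<Rightarrow>\<^sub>0 ('l, 'm) psc)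
    \<Rightarrow> ('l::finite, 'm::finite) psc" where
  "hsum g h = (\<Sum>\<alpha>\<in>keys h. scl (g \<alpha>) (H_pow \<alpha> * lookup h \<alpha>))"

lemma hsum_superset:
  assumes "finite S" "keys h \<subseteq> S"
  shows "hsum g h = (\<Sum>\<alpha>\<in>S. scl (g \<alpha>) (H_pow \<alpha> * lookup h \<alpha>))"
  unfolding hsum_def using assms by (intro sum.mono_neutral_left) (auto simp: in_keys_iff scl_simps)

lemma hsum_add: "hsum g (h + h') = hsum g h + hsum g h'"
proof -
  have S: "keys (h + h') \<subseteq> keys h \<union> keys h'" by (rule Poly_Mapping.keys_add)
  show ?thesis
    by (simp add: hsum_superset[OF _ S] hsum_superset[of "keys h \<union> keys h'" h]
        hsum_superset[of "keys h \<union> keys h'" h'] lookup_add algebra_simps scl_simps sum.distrib)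
qed

lemma hsum_0: "hsum g 0 = 0"
  by (simp add: hsum_def)

lemma hsum_sum: "hsum g (sum f A) = (\<Sum>a\<in>A. hsum g (f a))"
  by (induction A rule: infinite_finite_induct) (auto simp: hsum_add hsum_0)

lemma hsum_single: "hsum g (single \<alpha> p) = scl (g \<alpha>) (H_pow \<alpha> * p)"
  by (simp add: hsum_def scl_simps)

lemma harmonic_expansion_hsum:
  "harmonic_expansion h P \<longleftrightarrow> (\<forall>\<alpha>. harmonic (lookup h \<alpha>)) \<and> P = hsum (\<lambda>_. 1) h"
  by (simp add: harmonic_expansion_def hsum_def scl_simps)

lemma is_linear_Lap: "is_linear (Lap i j)"
proof -
  have "is_linear (pd (Z i a) \<circ> pd (Zb j a))" for a
    by (intro is_linear_comp is_linear_pd)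
  then have "is_linear (\<lambda>p. pd (Z i a) (pd (Zb j a) p))" for a by (simp add: comp_def)
  then have "is_linear (\<lambda>p. \<Sum>a\<in>UNIV. pd (Z i a) (pd (Zb j a) p))" by (intro is_linear_Sum)
  then show ?thesis by (simp add: Lap_def[abs_def])
qed

lemma harmonic_closed:
  "harmonic 0" "harmonic p \<Longrightarrow> harmonic r \<Longrightarrow> harmonic (p + r)"
  "harmonic p \<Longrightarrow> harmonic r \<Longrightarrow> harmonic (p - r)" "harmonic p \<Longrightarrow> harmonic (scl c p)"
  by (auto simp: harmonic_def is_linearD[OF is_linear_Lap] scl_simps)

lemma harmonic_sum: "(\<And>a. a \<in> A \<Longrightarrow> harmonic (f a)) \<Longrightarrow> harmonic (sum f A)"
  by (induction A rule: infinite_finite_induct) (auto simp: harmonic_closed)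

lemma harmonic_expansion_add:
  "harmonic_expansion h P \<Longrightarrow> harmonic_expansion h' P' \<Longrightarrow> harmonic_expansion (h + h') (P + P')"
  by (simp add: harmonic_expansion_hsum hsum_add lookup_add harmonic_closed)

lemma harmonic_expansion_H:
  assumes "harmonic_expansion h P"
  shows "\<exists>h'. harmonic_expansion h' (H i j * P)"
proof -
  define s where "s \<alpha> = \<alpha>((i, j) := Suc (\<alpha> (i, j)))" for \<alpha> :: "'a \<times> 'a \<Rightarrow> nat"
  define h' where "h' = (\<Sum>\<alpha>\<in>keys h. single (s \<alpha>) (lookup h \<alpha>))"
  have "hsum (\<lambda>_. 1) h' = (\<Sum>\<alpha>\<in>keys h. H i j * (H_pow \<alpha> * lookup h \<alpha>))"
    by (simp add: h'_def hsum_sum hsum_single scl_simps s_def H_pow_upd mult.assoc)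
  also have "\<dots> = H i j * P"
    using assms by (simp add: harmonic_expansion_def sum_distrib_left)
  finally have "harmonic_expansion h' (H i j * P)"
    using assms by (auto simp: harmonic_expansion_hsum h'_def lookup_sum lookup_single when_def
        harmonic_closed intro!: harmonic_sum)
  then show ?thesis by blast
qed

lemma harmonic_expansion_exists:
  fixes P :: "('l::finite, 'm::finite) psc"
  shows "\<exists>h. harmonic_expansion h P"
proof -
  have "\<exists>h. harmonic_expansion h P" if "\<And>\<mu>. \<mu> \<in> keys P \<Longrightarrow> mdeg \<mu> < d" for d and P :: "('l, 'm) psc"
    using that
  proof (induction d arbitrary: P)
    case 0
    then have "P = 0" by (metis all_not_in_conv keys_eq_empty not_less0) 
    then show ?case by (intro exI[of _ 0]) (simp add: harmonic_expansion_hsum hsum_0 harmonic_closed)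
  next
    case (Suc d)
    \<comment> \<open>The available bound d + 1 is loosened so that the cofactors
      \<open>f i j\<close> have degree below d, where the induction hypothesis applies.\<close>
    have "mdeg \<mu> < d + 2" if "\<mu> \<in> keys P" for \<mu> using Suc.prems[OF that] by simp
    from fischer_decomposition[OF this]
    obtain h f where hf: "harmonic h" "P = h + (\<Sum>(i, j)\<in>UNIV. H i j * f i j)"
      "\<And>i j \<mu>. \<mu> \<in> keys (f i j) \<Longrightarrow> mdeg \<mu> < d"
      by blast
    have h: "harmonic_expansion (single (\<lambda>_. 0) h) h"
      using hf(1) by (auto simp: harmonic_expansion_hsum hsum_single H_pow_0 scl_simps lookup_single
          when_def harmonic_closed)
    have "\<exists>g. harmonic_expansion g (\<Sum>(i, j)\<in>A. H i j * f i j)" for A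
    proof (induction A rule: infinite_finite_induct)
      case (insert k A)
      obtain i j where k: "k = (i, j)" by (rule prod.exhaust)
      obtain g where g: "harmonic_expansion g (\<Sum>(i, j)\<in>A. H i j * f i j)" using insert.IH by blast
      obtain g' where "harmonic_expansion g' (f i j)" using Suc.IH[of "f i j"] hf(3) by blast
      then obtain g'' where "harmonic_expansion g'' (H i j * f i j)" using harmonic_expansion_H by blast
      from harmonic_expansion_add[OF this g] show ?case using insert.hyps by (auto simp: k)
    qed (auto intro!: exI[of _ 0] simp: harmonic_expansion_hsum hsum_0 harmonic_closed)
    then obtain g where "harmonic_expansion g (\<Sum>(i, j)\<in>UNIV. H i j * f i j)" by blast
    from harmonic_expansion_add[OF h this] show ?case using hf(2) by auto
  qed
  from this[of P "Suc (Max (mdeg ` keys P))"] show ?thesis by (simp add: less_Suc_eq_le)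
qed


section \<open>Uniqueness of harmonic expansions\<close>

text \<open>Labels and coordinates become numbers counted from 0, so that i + j can name a
  coordinate.\<close>

definition rank :: "'a::{finite,linorder} \<Rightarrow> nat" where
  "rank a = card {b. b < a}"

lemma rank_less_iff: "rank a < rank b \<longleftrightarrow> a < b"
proof -
  have *: "rank a < rank b" if "a < b" for a b :: 'a
    unfolding rank_def using that by (intro psubset_card_mono) auto
  show ?thesis using *[of a b] *[of b a] by (metis less_asym linorder_neqE)
qed

lemma rank_inj: "rank a = rank b \<longleftrightarrow> a = b"
  using rank_less_iff[of a b] rank_less_iff[of b a] by (metis less_irrefl linorder_neqE)

lemma rank_bound: "rank (a :: 'a::{finite,linorder}) < CARD('a)"
  unfolding rank_def by (intro psubset_card_mono) auto

lemma rank_surj: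
  assumes "k < CARD('a::{finite,linorder})"
  shows "\<exists>a :: 'a. rank a = k"
proof -
  have "rank ` (UNIV :: 'a set) = {..<CARD('a)}"
    by (intro card_subset_eq) (auto simp: rank_bound card_image inj_on_def rank_inj)
  then show ?thesis using assms by (metis imageE lessThan_iff)
qed

text \<open>
  A weight for which every \<open>H\<^sub>i\<^sub>j\<close> has a single monomial of top weight: the weight of
  \<open>z\<^sub>i\<^sub>a zbar\<^sub>j\<^sub>a\<close> is a constant minus \<open>2 (a - i - j)\<^sup>2\<close> for given \<open>i, j\<close>, so \<open>a = i + j\<close> wins,
  which is in range because \<open>m \<ge> 2 N\<close>. These leading monomials have pairwise disjoint variables.
  The square of \<open>m\<close> is added to stay within the natural numbers.
\<close>

fun wvar :: "('l::{finite,linorder}, 'm::{finite,linorder}) bosvar \<Rightarrow> nat" where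
  "wvar (Z i a) = (CARD('m))\<^sup>2 + 4 * rank a * rank i - (rank a)\<^sup>2"
| "wvar (Zb i a) = (CARD('m))\<^sup>2 + 4 * rank a * rank i - (rank a)\<^sup>2"

abbreviation bwt :: "('l::{finite,linorder}, 'm::{finite,linorder}) mono \<Rightarrow> nat" where
  "bwt \<equiv> wt wvar"

text \<open>The choice has a witness once m >= 2 N, by \<open>rank_lead_ix\<close>.\<close>

definition lead_ix :: "'l::{finite,linorder} \<Rightarrow> 'l \<Rightarrow> 'm::{finite,linorder}" where
  "lead_ix i j = (SOME a. rank a = rank i + rank j)"

text \<open>The monomial \<mu> itself cannot occur in the difference, so its coefficient in p is 1.
  Monomials of equal weight stay incomparable: a weight takes the place of a monomial order.\<close>

definition leading :: "('l::{finite,linorder}, 'm::{finite,linorder}) mono \<Rightarrow> ('l, 'm) psc \<Rightarrow> bool" where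
  "leading \<mu> p \<longleftrightarrow> (\<forall>\<nu>\<in>keys (p - bas \<mu>). bwt \<nu> < bwt \<mu>)"

lemma leading_bas: "leading \<mu> (bas \<mu>)"
  by (simp add: leading_def)

text \<open>Writing p r - \<mu> \<nu> = (p - \<mu>) r + \<mu> (r - \<nu>), each summand has a factor
  of strictly lower weight.\<close>

lemma leading_mult:
  assumes "leading \<mu> p" "leading \<nu> r"
  shows "leading (\<mu> + \<nu>) (p * r)"
proof -
  have eq: "p * r - bas (\<mu> + \<nu>) = (p - bas \<mu>) * r + bas \<mu> * (r - bas \<nu>)"
    by (simp add: bas_mult[symmetric] algebra_simps)
  have r: "bwt \<kappa> \<le> bwt \<nu>" if "\<kappa> \<in> keys r" for \<kappa>
  proof -
    have "\<kappa> \<in> keys (r - bas \<nu>) \<or> \<kappa> = \<nu>"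
      using that Poly_Mapping.keys_add[of "r - bas \<nu>" "bas \<nu>"] by auto
    then show ?thesis using assms(2) by (auto simp: leading_def less_imp_le)
  qed
  have "bwt \<kappa> < bwt (\<mu> + \<nu>)" if \<kappa>: "\<kappa> \<in> keys ((p - bas \<mu>) * r + bas \<mu> * (r - bas \<nu>))" for \<kappa>
  proof -
    consider "\<kappa> \<in> keys ((p - bas \<mu>) * r)" | "\<kappa> \<in> keys (bas \<mu> * (r - bas \<nu>))"
      using subsetD[OF Poly_Mapping.keys_add \<kappa>] by blast
    then show ?thesis
    proof cases
      case 1
      then obtain a b where "\<kappa> = a + b" "a \<in> keys (p - bas \<mu>)" "b \<in> keys r"
        using keys_mult[of "p - bas \<mu>" r] by auto
      then show ?thesis using assms(1) r[of b]
        by (auto simp: leading_def wt_add intro: add_less_le_mono)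
    next
      case 2
      then obtain b where "\<kappa> = \<mu> + b" "b \<in> keys (r - bas \<nu>)"
        using keys_mult[of "bas \<mu>" "r - bas \<nu>"] by auto
      then show ?thesis using assms(2) by (auto simp: leading_def wt_add)
    qed
  qed
  then show ?thesis by (simp add: leading_def eq)
qed

lemma leading_prod:
  assumes "\<And>a. a \<in> A \<Longrightarrow> leading (\<mu> a) (p a)"
  shows "leading (\<Sum>a\<in>A. \<mu> a) (\<Prod>a\<in>A. p a)"
proof -
  have "leading 0 1" using leading_bas[of 0] by (simp add: bas_def)
  then show ?thesis using assms
    by (induction A rule: infinite_finite_induct) (auto intro: leading_mult)
qed

definition lead_exp :: "('l \<times> 'l \<Rightarrow> nat) \<Rightarrow> ('l::{finite,linorder}, 'm::{finite,linorder}) mono" where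
  "lead_exp \<alpha> = (\<Sum>(i, j)\<in>UNIV. single (Z i (lead_ix i j)) (\<alpha> (i, j)) + single (Zb j (lead_ix i j)) (\<alpha> (i, j)))"

text \<open>The multiplicity of each leading monomial in \<mu>. All of them can be extracted at once
  because they are pairwise coprime.\<close>

definition std_exp :: "('l::{finite,linorder}, 'm::{finite,linorder}) mono \<Rightarrow> 'l \<times> 'l \<Rightarrow> nat" where
  "std_exp \<mu> = (\<lambda>(i, j). min (lookup \<mu> (Z i (lead_ix i j))) (lookup \<mu> (Zb j (lead_ix i j))))"

text \<open>
  As the leading monomials are pairwise coprime, every monomial \<open>\<mu>\<close> is uniquely a product of them
  with a monomial divisible by none; \<open>straighten\<close> replaces each leading monomial in this
  factorization by its \<open>H\<^sub>i\<^sub>j\<close>. Being unitriangular for the weight, it is bijective, which makes the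
  polynomial ring free over \<open>\<complex>[H]\<close>.
\<close>

definition straighten :: "('l::{finite,linorder}, 'm::{finite,linorder}) psc \<Rightarrow> ('l, 'm) psc" where
  "straighten = lin_ext (\<lambda>\<mu>. H_pow (std_exp \<mu>) * bas (\<mu> - lead_exp (std_exp \<mu>)))"

section \<open>Freeness over the algebra of the H_ij when m >= 2 N\<close>

context
  assumes card: "CARD('m::{finite,linorder}) \<ge> 2 * CARD('l::{finite,linorder})"
begin

text \<open>Ranks start at 0, so the sum is at most 2 N - 2.\<close>

lemma rank_lead_ix: "rank (lead_ix i j :: 'm) = rank (i :: 'l) + rank j"
proof -
  have "rank i + rank j < CARD('m)" using rank_bound[of i] rank_bound[of j] card by linarith
  then have "\<exists>a :: 'm. rank a = rank i + rank j" by (rule rank_surj)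
  then show ?thesis unfolding lead_ix_def by (rule someI_ex)
qed

text \<open>The coprimality of the leading monomials: z_ia occurs only for j = a - i, and zbar_ja
  only for i = a - j.\<close>

lemma lead_ix_inj:
  "(lead_ix i j :: 'm) = lead_ix i j' \<longleftrightarrow> j = (j' :: 'l)"
  "(lead_ix i j :: 'm) = lead_ix i' j \<longleftrightarrow> i = (i' :: 'l)"
  using rank_lead_ix by (metis add_left_cancel rank_inj, metis add_right_cancel rank_inj)

lemma lead_weight:
  fixes a :: 'm and i j :: 'l
  assumes "a \<noteq> lead_ix i j"
  shows "wvar (Z i a) + wvar (Zb j a) < wvar (Z i (lead_ix i j :: 'm)) + wvar (Zb j (lead_ix i j :: 'm))"
proof -
  \<comment> \<open>Completing the square in 4 a (i + j) - 2 a^2.\<close>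
  have w: "int (wvar (Z i b) + wvar (Zb j b)) =
      2 * (int CARD('m))\<^sup>2 + 2 * (int (rank i) + int (rank j))\<^sup>2
        - 2 * (int (rank b) - (int (rank i) + int (rank j)))\<^sup>2" for b :: 'm
  proof -
    \<comment> \<open>The natural-number subtraction in \<open>wvar\<close> is exact, since every
      rank is below m.\<close>
    have "(rank b)\<^sup>2 \<le> (CARD('m))\<^sup>2" using rank_bound[of b] by (intro power_mono) simp_all
    then have "(rank b)\<^sup>2 \<le> (CARD('m))\<^sup>2 + 4 * rank b * k" for k by (rule trans_le_add1)
    then have *: "int (wvar (Z k b)) = (int CARD('m))\<^sup>2 + 4 * int (rank b) * int (rank k) - (int (rank b))\<^sup>2"
      "int (wvar (Zb k b)) = (int CARD('m))\<^sup>2 + 4 * int (rank b) * int (rank k) - (int (rank b))\<^sup>2" for k :: 'l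
      by (simp_all add: of_nat_diff)
    show ?thesis unfolding of_nat_add * by (simp add: power2_eq_square algebra_simps)
  qed
  have "rank a \<noteq> rank i + rank j" using assms rank_inj[of a] rank_lead_ix by metis
  then have "int (rank a) - (int (rank i) + int (rank j)) \<noteq> 0" by linarith
  then have "(int (rank a) - (int (rank i) + int (rank j)))\<^sup>2 > 0" by simp
  then have "int (wvar (Z i a) + wvar (Zb j a)) < int (wvar (Z i (lead_ix i j :: 'm)) + wvar (Zb j (lead_ix i j :: 'm)))"
    unfolding w by (simp add: rank_lead_ix)
  then show ?thesis by (simp only: of_nat_less_iff)
qed

lemma leading_H:
  "leading (single (Z i (lead_ix i j)) 1 + single (Zb j (lead_ix i j)) 1) (H i j :: ('l, 'm) psc)"
proof -
  let ?b = "\<lambda>a. single (Z i a) 1 + single (Zb j a) 1 :: ('l, 'm) mono"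
  have "H i j = (\<Sum>a\<in>UNIV. bas (?b a) :: ('l, 'm) psc)"
    by (simp add: H_def var_def mult_single bas_def)
  then have "H i j - bas (?b (lead_ix i j)) = (\<Sum>a\<in>UNIV - {lead_ix i j}. bas (?b a) :: ('l, 'm) psc)"
    by (simp add: sum_diff1)
  moreover have "\<exists>a. a \<noteq> lead_ix i j \<and> \<nu> = ?b a"
    if "\<nu> \<in> keys (\<Sum>a\<in>UNIV - {lead_ix i j}. bas (?b a) :: ('l, 'm) psc)" for \<nu>
    using subsetD[OF keys_sum that] by auto
  ultimately show ?thesis using lead_weight
    by (fastforce simp: leading_def wt_add wt_single simp del: wvar.simps)
qed

lemma leading_H_pow: "leading (lead_exp \<alpha>) (H_pow \<alpha> :: ('l, 'm) psc)"
proof -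
  have "leading (single (Z i (lead_ix i j)) k + single (Zb j (lead_ix i j)) k) (H i j ^ k :: ('l, 'm) psc)" for i j k
  proof (induction k)
    case 0
    then show ?case using leading_bas[of 0] by (simp add: bas_def)
  next
    case (Suc k)
    have "single v (Suc k) = single v 1 + single v k" for v :: "('l, 'm) bosvar"
      by (simp flip: single_add)
    then show ?case using leading_mult[OF leading_H[of i j] Suc] by (simp add: add_ac)
  qed
  then show ?thesis unfolding lead_exp_def H_pow_def by (intro leading_prod) auto
qed

lemma lookup_lead_exp:
  "lookup (lead_exp \<alpha> :: ('l, 'm) mono) (Z i a) = (\<Sum>j\<in>{j. lead_ix i j = a}. \<alpha> (i, j))"
  "lookup (lead_exp \<alpha> :: ('l, 'm) mono) (Zb j a) = (\<Sum>i\<in>{i. lead_ix i j = a}. \<alpha> (i, j))"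
proof -
  have "lookup (lead_exp \<alpha> :: ('l, 'm) mono) (Z i a) = (\<Sum>i'\<in>UNIV. \<Sum>j\<in>UNIV. if i' = i \<and> lead_ix i j = a then \<alpha> (i, j) else 0)"
    unfolding lead_exp_def lookup_sum UNIV_Times_UNIV[symmetric] sum.cartesian_product
    by (intro sum.cong refl) (auto simp: lookup_add lookup_single when_def)
  also have "\<dots> = (\<Sum>i'\<in>UNIV. if i' = i then \<Sum>j\<in>UNIV. if lead_ix i j = a then \<alpha> (i, j) else 0 else 0)"
    by (intro sum.cong refl) auto
  also have "\<dots> = (\<Sum>j\<in>{j. lead_ix i j = a}. \<alpha> (i, j))"
    by (simp add: sum.If_cases)
  finally show "lookup (lead_exp \<alpha> :: ('l, 'm) mono) (Z i a) = (\<Sum>j\<in>{j. lead_ix i j = a}. \<alpha> (i, j))" .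
  have "lookup (lead_exp \<alpha> :: ('l, 'm) mono) (Zb j a) = (\<Sum>i\<in>UNIV. \<Sum>j'\<in>UNIV. if j' = j then if lead_ix i j = a then \<alpha> (i, j) else 0 else 0)"
    unfolding lead_exp_def lookup_sum UNIV_Times_UNIV[symmetric] sum.cartesian_product
    by (intro sum.cong refl) (auto simp: lookup_add lookup_single when_def)
  also have "\<dots> = (\<Sum>i\<in>{i. lead_ix i j = a}. \<alpha> (i, j))"
    by (simp add: sum.If_cases)
  finally show "lookup (lead_exp \<alpha> :: ('l, 'm) mono) (Zb j a) = (\<Sum>i\<in>{i. lead_ix i j = a}. \<alpha> (i, j))" .
qed

lemma lookup_lead_exp_lead:
  "lookup (lead_exp \<alpha>) (Z (i :: 'l) (lead_ix i j :: 'm)) = \<alpha> (i, j)"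
  "lookup (lead_exp \<alpha>) (Zb (j :: 'l) (lead_ix i j :: 'm)) = \<alpha> (i, j)"
  by (simp_all add: lookup_lead_exp lead_ix_inj)

text \<open>Both exponents inside each minimum grow by the same \<open>\<alpha> (i, j)\<close>, as
  no other leading monomial contains these variables.\<close>

lemma std_exp_add: "std_exp (lead_exp \<alpha> + \<mu> :: ('l, 'm) mono) = (\<lambda>v. \<alpha> v + std_exp \<mu> v)"
  by (auto simp: std_exp_def lookup_add lookup_lead_exp_lead)

lemma lead_exp_add: "lead_exp (\<lambda>v. \<alpha> v + \<beta> v) = (lead_exp \<alpha> + lead_exp \<beta> :: ('l, 'm) mono)"
  by (simp add: lead_exp_def split_def single_add sum.distrib add_ac)

text \<open>Each variable occurs in at most one leading monomial, so the extracted product divides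
  \<mu> and the truncated subtraction is exact.\<close>

lemma lead_exp_std_exp: "lead_exp (std_exp \<mu>) + (\<mu> - lead_exp (std_exp \<mu>)) = (\<mu> :: ('l, 'm) mono)"
proof (rule poly_mapping_eqI)
  fix v :: "('l, 'm) bosvar"
  have "lookup (lead_exp (std_exp \<mu>)) v \<le> lookup \<mu> v"
  proof (cases v)
    case (Z i a)
    show ?thesis
    proof (cases "\<exists>j. lead_ix i j = a")
      case True
      then obtain j where "a = lead_ix i j" by auto
      then show ?thesis by (simp only: Z lookup_lead_exp_lead) (simp add: std_exp_def)
    next
      case False
      then have "{j. lead_ix i j = a} = {}" by auto
      then show ?thesis by (simp only: Z lookup_lead_exp) simp
    qed
  next
    case (Zb j a)
    show ?thesis
    proof (cases "\<exists>i. lead_ix i j = a")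
      case True
      then obtain i where "a = lead_ix i j" by auto
      then show ?thesis by (simp only: Zb lookup_lead_exp_lead) (simp add: std_exp_def)
    next
      case False
      then have "{i. lead_ix i j = a} = {}" by auto
      then show ?thesis by (simp only: Zb lookup_lead_exp) simp
    qed
  qed
  then show "lookup (lead_exp (std_exp \<mu>) + (\<mu> - lead_exp (std_exp \<mu>))) v = lookup \<mu> v"
    by (simp add: lookup_add lookup_minus)
qed

lemma bij_straighten: "bij (straighten :: ('l, 'm) psc \<Rightarrow> _)"
proof (rule unitriangular_bij)
  have "leading \<mu> (straighten (bas \<mu>))" for \<mu> :: "('l, 'm) mono"
    using leading_mult[OF leading_H_pow[of "std_exp \<mu>"] leading_bas[of "\<mu> - lead_exp (std_exp \<mu>)"]]
    by (simp add: straighten_def lead_exp_std_exp)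
  then show "unitriangular bwt (straighten :: ('l, 'm) psc \<Rightarrow> _)"
    by (auto simp: unitriangular_def leading_def straighten_def is_linear_lin_ext)
qed

text \<open>Before straightening, multiplication by H^\<alpha> is multiplication by a monomial, and
  there coefficients can be compared.\<close>

lemma straighten_lead_exp:
  "straighten (bas (lead_exp \<alpha>) * u) = (H_pow \<alpha> * straighten u :: ('l, 'm) psc)"
proof -
  have lin: "is_linear (straighten :: ('l, 'm) psc \<Rightarrow> _)"
    unfolding straighten_def by (rule is_linear_lin_ext)
  have cancel: "a + \<mu> - (a + c) = \<mu> - c" for a \<mu> c :: "('l, 'm) mono"
    by (rule poly_mapping_eqI) (simp add: lookup_add lookup_minus)
  have "straighten \<circ> (\<lambda>u. bas (lead_exp \<alpha>) * u) = (\<lambda>u. H_pow \<alpha> * u) \<circ> (straighten :: ('l, 'm) psc \<Rightarrow> _)"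
    by (intro is_linear_eqI is_linear_comp lin is_linear_mult)
      (simp add: bas_mult straighten_def std_exp_add H_pow_add lead_exp_add cancel mult.assoc)
  then show ?thesis by (auto simp: fun_eq_iff)
qed

text \<open>Every monomial of u is sent to a multiple of a nontrivial product of the H_ij.\<close>

lemma fischer_straighten_harmonic:
  fixes u :: "('l, 'm) psc"
  assumes "harmonic h" "\<And>\<mu>. \<mu> \<in> keys u \<Longrightarrow> std_exp \<mu> \<noteq> (\<lambda>_. 0)"
  shows "fischer (straighten u) h = 0"
  unfolding straighten_def lin_ext_def semilin_ext_def
  using assms by (simp add: fischer_simps fischer_H_pow_harmonic)

text \<open>
  For a term \<open>\<alpha>\<close> of minimal total exponent the standard part of the straightened \<open>h\<^sub>\<alpha>\<close> cannot cancel,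
  so \<open>h\<^sub>\<alpha>\<close> lies in the ideal generated by the \<open>H\<^sub>i\<^sub>j\<close>, hence is orthogonal to itself.
\<close>

lemma hsum_harmonic_eq_0:
  fixes f :: "('l \<times> 'l \<Rightarrow> nat) \<Rightarrow>\<^sub>0 ('l, 'm) psc"
  assumes harm: "\<And>\<alpha>. harmonic (lookup f \<alpha>)" and 0: "hsum (\<lambda>_. 1) f = 0"
  shows "f = 0"
proof (rule ccontr)
  assume "f \<noteq> 0"
  define u where "u \<alpha> = inv straighten (lookup f \<alpha>)" for \<alpha>
  have fu: "straighten (u \<alpha>) = lookup f \<alpha>" for \<alpha>
    using bij_straighten by (simp add: u_def bij_is_surj surj_f_inv_f)
  have lin: "is_linear (straighten :: ('l, 'm) psc \<Rightarrow> _)"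
    unfolding straighten_def by (rule is_linear_lin_ext)
  \<comment> \<open>The vanishing sum is pulled back along \<open>straighten\<close>, where each
    H^\<alpha> becomes a monomial.\<close>
  have "straighten (\<Sum>\<alpha>\<in>keys f. bas (lead_exp \<alpha>) * u \<alpha>) = straighten 0"
    using 0 by (simp add: is_linear_sum[OF lin] straighten_lead_exp fu hsum_def scl_simps is_linearD[OF lin])
  then have sum0: "(\<Sum>\<alpha>\<in>keys f. bas (lead_exp \<alpha>) * u \<alpha>) = 0"
    using bij_straighten by (simp only: bij_def inj_eq)
  define s where "s \<alpha> = sum \<alpha> (UNIV :: ('l \<times> 'l) set)" for \<alpha> :: "'l \<times> 'l \<Rightarrow> nat"
  have "keys f \<noteq> {}" using \<open>f \<noteq> 0\<close> by simp
  then obtain \<alpha>0 where \<alpha>0: "\<alpha>0 \<in> keys f" "\<And>\<alpha>. \<alpha> \<in> keys f \<Longrightarrow> s \<alpha>0 \<le> s \<alpha>"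
    using ex_min_if_finite[of "s ` keys f"] by (metis (no_types, lifting) arg_min_if_finite(1) arg_min_least finite_keys)
  have "std_exp \<mu> \<noteq> (\<lambda>_. 0)" if \<mu>: "\<mu> \<in> keys (u \<alpha>0)" for \<mu>
  proof
    assume std: "std_exp \<mu> = (\<lambda>_. 0)"
    \<comment> \<open>Another term reaches this monomial only if \<alpha>0 is \<alpha> plus the
      standard exponent of some \<kappa>; minimality of \<alpha>0 then forces \<alpha> =
      \<alpha>0.\<close>
    have "lookup (bas (lead_exp \<alpha>) * u \<alpha>) (lead_exp \<alpha>0 + \<mu>) = 0" if "\<alpha> \<in> keys f" "\<alpha> \<noteq> \<alpha>0" for \<alpha>
    proof (rule ccontr)
      assume "lookup (bas (lead_exp \<alpha>) * u \<alpha>) (lead_exp \<alpha>0 + \<mu>) \<noteq> 0"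
      then have "lead_exp \<alpha>0 + \<mu> \<in> keys (bas (lead_exp \<alpha>) * u \<alpha>)" by (simp add: in_keys_iff)
      then obtain \<kappa> where "lead_exp \<alpha>0 + \<mu> = lead_exp \<alpha> + \<kappa>"
        using keys_mult[of "bas (lead_exp \<alpha>)" "u \<alpha>"] by auto
      then have "std_exp (lead_exp \<alpha>0 + \<mu>) = std_exp (lead_exp \<alpha> + \<kappa>)" by (rule arg_cong)
      then have eq: "\<alpha>0 = (\<lambda>v. \<alpha> v + std_exp \<kappa> v)" by (simp add: std_exp_add std)
      then have "s \<alpha>0 = s \<alpha> + s (std_exp \<kappa>)" by (simp add: s_def sum.distrib)
      then have "s (std_exp \<kappa>) = 0" using \<alpha>0(2)[OF that(1)] by simp
      then have "std_exp \<kappa> v = 0" for v by (cases v) (simp add: s_def)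
      then show False using eq that(2) by (simp add: fun_eq_iff)
    qed
    then have "lookup (\<Sum>\<alpha>\<in>keys f. bas (lead_exp \<alpha>) * u \<alpha>) (lead_exp \<alpha>0 + \<mu>) =
        (\<Sum>\<alpha>\<in>keys f. if \<alpha> = \<alpha>0 then lookup (u \<alpha>0) \<mu> else 0)"
      unfolding lookup_sum by (intro sum.cong refl) (auto simp: lookup_bas_mult)
    then have "lookup (u \<alpha>0) \<mu> = 0" using sum0 \<alpha>0(1) by simp
    then show False using \<mu> by (simp add: in_keys_iff)
  qed
  then have "fischer (lookup f \<alpha>0) (lookup f \<alpha>0) = 0"
    using fischer_straighten_harmonic[OF harm] by (simp flip: fu)
  then show False using fischer_definite \<alpha>0(1) by (auto simp: in_keys_iff)
qed

lemma harmonic_expansion_unique: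
  fixes P :: "('l, 'm) psc"
  assumes "harmonic_expansion h P" "harmonic_expansion h' P"
  shows "h = h'"
proof -
  have "hsum (\<lambda>_. 1) h = hsum (\<lambda>_. 1) (h - h') + hsum (\<lambda>_. 1) h'" by (simp flip: hsum_add)
  then have "hsum (\<lambda>_. 1) (h - h') = 0" using assms by (simp add: harmonic_expansion_hsum)
  then have "h - h' = 0"
    using assms by (intro hsum_harmonic_eq_0) (auto simp: harmonic_expansion_hsum lookup_minus harmonic_closed)
  then show ?thesis by simp
qed

section \<open>Rescaling of harmonic components, and the gauge \<open>G_nf\<close>\<close>

definition hexp :: "('l, 'm) psc \<Rightarrow> ('l \<times> 'l \<Rightarrow> nat) \<Rightarrow>\<^sub>0 ('l, 'm) psc" where
  "hexp P = (THE h. harmonic_expansion h P)"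

lemma hexp_eqI: "harmonic_expansion h P \<Longrightarrow> hexp P = h"
  unfolding hexp_def using harmonic_expansion_unique by blast

lemma harmonic_expansion_hexp: "harmonic_expansion (hexp P) P"
  using harmonic_expansion_exists[of P] hexp_eqI by metis

text \<open>These maps compose by multiplying their coefficient functions, so a nowhere vanishing g
  gives a bijection; \<open>G_nf\<close> is one of them.\<close>

definition twist :: "(('l \<times> 'l \<Rightarrow> nat) \<Rightarrow> complex) \<Rightarrow> ('l, 'm) psc \<Rightarrow> ('l, 'm) psc" where
  "twist g P = hsum g (hexp P)"

text \<open>Scaling keeps each component harmonic, so uniqueness identifies the scaled family as the
  expansion.\<close>

lemma hexp_twist: "hexp (twist g P) = Poly_Mapping.mapp (\<lambda>\<alpha>. scl (g \<alpha>)) (hexp P)"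
proof (rule hexp_eqI)
  let ?h = "Poly_Mapping.mapp (\<lambda>\<alpha>. scl (g \<alpha>)) (hexp P)"
  have l: "lookup ?h \<alpha> = scl (g \<alpha>) (lookup (hexp P) \<alpha>)" for \<alpha>
    by (auto simp: lookup_mapp when_def in_keys_iff scl_simps)
  have "keys ?h \<subseteq> keys (hexp P)" by (rule keys_mapp_subset)
  then have "hsum (\<lambda>_. 1) ?h = twist g P"
    by (simp add: twist_def hsum_superset[of "keys (hexp P)"] l scl_simps mult_scl)
  then show "harmonic_expansion ?h (twist g P)"
    using harmonic_expansion_hexp[of P] by (simp add: harmonic_expansion_hsum l harmonic_closed)
qed

lemma twist_twist: "twist g (twist g' P) = twist (\<lambda>\<alpha>. g \<alpha> * g' \<alpha>) P"
proof -
  have l: "lookup (Poly_Mapping.mapp (\<lambda>\<alpha>. scl (g' \<alpha>)) (hexp P)) \<alpha> = scl (g' \<alpha>) (lookup (hexp P) \<alpha>)" for \<alpha>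
    by (auto simp: lookup_mapp when_def in_keys_iff scl_simps)
  have S: "keys (Poly_Mapping.mapp (\<lambda>\<alpha>. scl (g' \<alpha>)) (hexp P)) \<subseteq> keys (hexp P)" by (rule keys_mapp_subset)
  show ?thesis
    unfolding twist_def[of g] hexp_twist
    by (simp add: hsum_superset[OF finite_keys S] l twist_def hsum_def[of _ "hexp P"] scl_simps mult_scl)
qed

lemma twist_const: "twist (\<lambda>_. c) P = scl c P"
proof -
  have "twist (\<lambda>_. c) P = scl c (hsum (\<lambda>_. 1) (hexp P))"
    by (simp add: twist_def hsum_def scl_sum scl_simps)
  then show ?thesis using harmonic_expansion_hexp[of P] by (simp add: harmonic_expansion_hsum)
qed

lemma is_linear_twist: "is_linear (twist g)"
proof (rule is_linearI)
  fix P Q :: "('l, 'm) psc"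
  have "hexp (P + Q) = hexp P + hexp Q"
    by (intro hexp_eqI harmonic_expansion_add harmonic_expansion_hexp)
  then show "twist g (P + Q) = twist g P + twist g Q" by (simp add: twist_def hsum_add)
  \<comment> \<open>Scaling by c is itself a twist, and twists commute.\<close>
  show "twist g (scl c P) = scl c (twist g P)" for c
    by (simp add: twist_twist mult.commute flip: twist_const)
qed

lemma bij_twist:
  assumes "\<And>\<alpha>. g \<alpha> \<noteq> 0"
  shows "bij (twist g)"
proof (rule o_bij)
  show "twist (\<lambda>\<alpha>. inverse (g \<alpha>)) \<circ> twist g = id" "twist g \<circ> twist (\<lambda>\<alpha>. inverse (g \<alpha>)) = id"
    using assms by (auto simp: fun_eq_iff twist_twist twist_const scl_simps)
qed

text \<open>For 0 < q < 1 the q-numbers of positive index are positive, so every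
  \<open>g_coeff\<close> is nonzero.\<close>

lemma G_nf_linear_bij:
  assumes "0 < q" "q < 1"
  shows "is_linear (G_nf q :: ('l, 'm) psc \<Rightarrow> _)" "bij (G_nf q :: ('l, 'm) psc \<Rightarrow> _)"
proof -
  have eq: "G_nf q = twist (\<lambda>\<alpha>. complex_of_real (g_coeff q \<alpha>))"
    by (simp add: fun_eq_iff G_nf_def twist_def hsum_def hexp_def Let_def)
  have qint: "qint p r > 0" if "0 < p" "p < 1" "r > 0" for p r
    using that by (simp add: qint_def power_Suc_less_one power_less_one_iff)
  have q2: "0 < q\<^sup>2" "q\<^sup>2 < 1" using assms by (simp_all add: power_less_one_iff)
  have "qfact q r > 0" "cfact q r > 0" for r
    using qint[OF assms] qint[OF q2] assms
    by (auto simp: qfact_def cfact_def c_q_def intro!: prod_pos mult_pos_pos)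
  then have "g_coeff q \<alpha> > 0" for \<alpha> :: "'l \<times> 'l \<Rightarrow> nat"
    unfolding g_coeff_def by (intro mult_pos_pos prod_pos) (auto split: prod.splits)
  then have "complex_of_real (g_coeff q \<alpha>) \<noteq> 0" for \<alpha> :: "'l \<times> 'l \<Rightarrow> nat"
    by (metis less_irrefl of_real_eq_0_iff)
  then show "is_linear (G_nf q :: ('l, 'm) psc \<Rightarrow> _)" "bij (G_nf q :: ('l, 'm) psc \<Rightarrow> _)"
    unfolding eq by (intro is_linear_twist bij_twist; assumption)+
qed

end


section \<open>The localized coefficient ring\<close>

lemma bconst_simps:
  "bconst (z + w) = bconst z + bconst w" "bconst (z * w) = bconst z * bconst w"
  "bconst (- z) = - bconst z" "bconst 0 = 0" "bconst 1 = 1" "bconst (z - w) = bconst z - bconst w"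
  by (simp_all add: bconst_def single_add mult_single single_uminus single_diff)

lemma cst_simps:
  "cst (z + w) = cst z + cst w" "cst (z * w) = cst z * cst w" "cst (- z) = - cst z"
  "cst 0 = 0" "cst 1 = 1" "cst (z - w) = cst z - cst w"
proof -
  have *: "cst (z + w) = cst z + cst w" "cst (- w) = - cst w" for z w
    by (simp_all add: cst_def bconst_simps)
  show "cst (z * w) = cst z * cst w" "cst 0 = 0" "cst 1 = 1"
    by (simp_all add: cst_def bconst_simps Zero_fract_def One_fract_def)
  show "cst (z + w) = cst z + cst w" "cst (- z) = - cst z" by (rule *)+
  show "cst (z - w) = cst z - cst w" using *(1)[of z "- w"] by (simp add: *(2))
qed

lemma cst_of_nat: "cst (of_nat n) = of_nat n"
  by (induction n) (simp_all add: cst_simps)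

lemma cst_numeral: "cst (numeral n) = numeral n"
  using cst_of_nat[of "numeral n"] by simp

lemma cst_inverse: "cst (inverse z) = inverse (cst z)"
proof (cases "z = 0")
  case False
  then have "cst z * cst (inverse z) = 1" by (simp add: cst_simps flip: cst_simps(2))
  then show ?thesis by (metis inverse_unique)
qed (simp add: cst_simps)

lemma denominators_mult:
  "d \<in> denominators s \<Longrightarrow> d' \<in> denominators s \<Longrightarrow> d * d' \<in> denominators s"
proof (induction d rule: denominators.induct)
  case (pole d v k)
  then show ?case using denominators.pole[OF pole.IH[OF pole.prems]] by (simp only: mult.assoc)
next
  case (minus d v k)
  then show ?case using denominators.minus[OF minus.IH[OF minus.prems]] by (simp only: mult.assoc)
next
  case (plus d v k)
  then show ?case using denominators.plus[OF plus.IH[OF plus.prems]] by (simp only: mult.assoc)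
qed simp

text \<open>Every factor of a denominator is linear in some B_v with B_v-coefficient 1, -2i or 2i,
  hence nonzero.\<close>

lemma lookup_factor:
  "lookup (Bvar v) (single v 1) = (1 :: complex)" "lookup (bconst z) (single v 1) = 0"
  by (auto simp: Bvar_def bconst_def lookup_single when_def poly_mapping_eq_iff fun_eq_iff
      dest!: fun_cong[where x=v])

lemma denominators_nonzero: "d \<in> denominators s \<Longrightarrow> d \<noteq> 0"
proof (induction d rule: denominators.induct)
  case one
  then show ?case by simp
next
  case (pole d v k)
  have "lookup (Bvar v + bconst (2 * \<i> * of_int k) - bconst \<i>) (single v 1) \<noteq> 0"
    by (simp only: lookup_add lookup_minus lookup_factor) simp
  then have "Bvar v + bconst (2 * \<i> * of_int k) - bconst \<i> \<noteq> 0" by auto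
  then show ?case using pole by simp
next
  case (minus d v k)
  have "lookup (bconst (of_real s) - bconst (2 * \<i>) * (Bvar v + bconst (2 * \<i> * of_int k))) (single v 1) \<noteq> 0"
    by (simp only: distrib_left bconst_simps(2)[symmetric] lookup_add lookup_minus lookup_factor)
      (simp add: Bvar_def bconst_def mult_single lookup_single)
  then have "bconst (of_real s) - bconst (2 * \<i>) * (Bvar v + bconst (2 * \<i> * of_int k)) \<noteq> 0" by auto
  then show ?case using minus by simp
next
  case (plus d v k)
  have "lookup (bconst (of_real s) + bconst (2 * \<i>) * (Bvar v + bconst (2 * \<i> * of_int k))) (single v 1) \<noteq> 0"
    by (simp only: distrib_left bconst_simps(2)[symmetric] lookup_add lookup_minus lookup_factor)
      (simp add: Bvar_def bconst_def mult_single lookup_single)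
  then have "bconst (of_real s) + bconst (2 * \<i>) * (Bvar v + bconst (2 * \<i> * of_int k)) \<noteq> 0" by auto
  then show ?case using plus by simp
qed

lemma bcnj_simps: "bcnj (Bvar v) = Bvar v" "bcnj (bconst z) = bconst (cnj z)" "bcnj 1 = 1"
  "bcnj (p - r) = bcnj p - bcnj r"
proof -
  show "bcnj (Bvar v) = Bvar v" "bcnj (bconst z) = bconst (cnj z)"
    by (simp_all add: Bvar_def bconst_def bcnj_single)
  show "bcnj 1 = 1" by (simp add: bcnj_single flip: single_one)
  show "bcnj (p - r) = bcnj p - bcnj r"
    by (rule poly_mapping_eqI) (simp add: lookup_bcnj lookup_minus)
qed

text \<open>Conjugation exchanges the \<open>minus\<close> and \<open>plus\<close> factors while k
  becomes -k; for a pole, -2ik + i = 2i(1 - k) - i.\<close>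

lemma bcnj_denominators: "d \<in> denominators s \<Longrightarrow> bcnj d \<in> denominators s"
proof (induction d rule: denominators.induct)
  case one
  then show ?case by (simp add: bcnj_simps denominators.one)
next
  case (pole d v k)
  have "bcnj (Bvar v + bconst (2 * \<i> * of_int k) - bconst \<i>) =
      Bvar v + bconst (2 * \<i> * of_int (1 - k)) - bconst \<i>"
    unfolding bcnj_simps bcnj_add add_diff_eq[symmetric] bconst_simps(6)[symmetric]
    by (rule arg_cong[where f="\<lambda>z. Bvar v + bconst z"]) (simp add: algebra_simps)
  then show ?case using denominators.pole[OF pole.IH] by (simp only: bcnj_mult)
next
  case (minus d v k)
  have "bcnj (bconst (of_real s) - bconst (2 * \<i>) * (Bvar v + bconst (2 * \<i> * of_int k))) =
      bconst (of_real s) + bconst (2 * \<i>) * (Bvar v + bconst (2 * \<i> * of_int (- k)))"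
    by (simp add: bcnj_simps bcnj_add bcnj_mult bconst_simps)
  then show ?case using denominators.plus[OF minus.IH] by (simp only: bcnj_mult)
next
  case (plus d v k)
  have "bcnj (bconst (of_real s) + bconst (2 * \<i>) * (Bvar v + bconst (2 * \<i> * of_int k))) =
      bconst (of_real s) - bconst (2 * \<i>) * (Bvar v + bconst (2 * \<i> * of_int (- k)))"
    by (simp add: bcnj_simps bcnj_add bcnj_mult bconst_simps)
  then show ?case using denominators.minus[OF plus.IH] by (simp only: bcnj_mult)
qed

section \<open>The localization as a subring, and its units\<close>

lemma A_minI: "d \<in> denominators s \<Longrightarrow> Fract p d \<in> A_min s"
  by (auto simp: A_min_def)

lemma is_subring_A_min: "is_subring (A_min s)"
proof -
  have "0 \<in> A_min s" "1 \<in> A_min s"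
    unfolding Zero_fract_def One_fract_def by (intro A_minI denominators.one)+
  moreover have "- x \<in> A_min s" if "x \<in> A_min s" for x
    using that by (force simp: A_min_def)
  moreover have "x + y \<in> A_min s \<and> x * y \<in> A_min s" if xy: "x \<in> A_min s" "y \<in> A_min s" for x y
  proof -
    obtain p d where x: "x = Fract p d" "d \<in> denominators s" using xy(1) by (auto simp: A_min_def)
    obtain p' d' where y: "y = Fract p' d'" "d' \<in> denominators s" using xy(2) by (auto simp: A_min_def)
    show ?thesis unfolding x(1) y(1)
      using x(2) y(2) denominators_nonzero[OF x(2)] denominators_nonzero[OF y(2)]
      by (auto intro!: A_minI denominators_mult)
  qed
  ultimately show ?thesis by (auto simp: is_subring_def)
qed

lemmas A_min_closed = is_subringD[OF is_subring_A_min]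

lemma cst_A_min: "cst z \<in> A_min s"
  unfolding cst_def by (intro A_minI denominators.one)

lemma Bgen_A_min: "Bgen v \<in> A_min s"
  unfolding Bgen_def by (intro A_minI denominators.one)

lemma brat_cnj_A_min: "x \<in> A_min s \<Longrightarrow> brat_cnj x \<in> A_min s"
  by (force simp: A_min_def brat_cnj_Fract denominators_nonzero intro: bcnj_denominators)

text \<open>As \<open>inverse 0 = 0\<close>, zero satisfies this too, which frees the constants in
  \<open>A_unit_closed\<close> from a side condition. What matters later is that inverses stay in
  \<open>A_min\<close>.\<close>

definition A_unit :: "real \<Rightarrow> 'v::linorder brat \<Rightarrow> bool" where
  "A_unit s x \<longleftrightarrow> x \<in> A_min s \<and> inverse x \<in> A_min s"

lemma A_unit_Fract: "d \<in> denominators s \<Longrightarrow> A_unit s (Fract d 1)"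
  by (auto simp: A_unit_def intro!: A_minI denominators.one)

lemma A_unit_closed:
  "A_unit s x \<Longrightarrow> A_unit s y \<Longrightarrow> A_unit s (x * y)" "A_unit s x \<Longrightarrow> A_unit s y \<Longrightarrow> A_unit s (x / y)"
  "A_unit s x \<Longrightarrow> A_unit s (- x)" "A_unit s 1" "A_unit s (cst z)"
  by (auto simp: A_unit_def divide_inverse A_min_closed cst_A_min inverse_mult_distrib simp flip: cst_inverse)

lemma A_unit_pole: "A_unit s (Bgen v + cst (2 * \<i> * of_int k) - cst \<i>)"
proof -
  \<comment> \<open>The trailing factor 1 gives the numerator the shape of an introduction rule of
    \<open>denominators\<close>.\<close>
  have "Bgen v + cst (2 * \<i> * of_int k) - cst \<i> = Fract ((Bvar v + bconst (2 * \<i> * of_int k) - bconst \<i>) * 1) 1"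
    by (simp add: Bgen_def cst_def)
  then show ?thesis by (simp only:) (intro A_unit_Fract denominators.intros)
qed

lemma A_unit_minus: "A_unit s (cst (of_real s) - cst (2 * \<i>) * (Bgen v + cst (2 * \<i> * of_int k)))"
proof -
  have "cst (of_real s) - cst (2 * \<i>) * (Bgen v + cst (2 * \<i> * of_int k)) =
      Fract ((bconst (of_real s) - bconst (2 * \<i>) * (Bvar v + bconst (2 * \<i> * of_int k))) * 1) 1"
    by (simp add: Bgen_def cst_def)
  then show ?thesis by (simp only:) (intro A_unit_Fract denominators.intros)
qed

text \<open>Since (2j - 1) i = 2ij - i, the nonconstant case is a shifted pole.\<close>

lemma A_unit_beta: "A_unit s (beta j (Bgen v))"
proof -
  have "Bgen v + cst (of_int (2 * j - 1) * \<i>) = Bgen v + cst (2 * \<i> * of_int j) - cst \<i>"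
    by (simp add: cst_simps algebra_simps)
  then show ?thesis unfolding beta_def using A_unit_pole[of s v j] A_unit_closed(4)[of s]
    by (simp only: if_split) blast
qed

text \<open>At X = B + 2i(c + 1) the constant 4 cancels against (2i)(2i) = -4, leaving minus the
  factor s - 2i(B + 2ic) over a shifted pole.\<close>

lemma A_unit_Phi: "A_unit s (Phi s (Bgen v + cst (2 * \<i> * of_int (c + 1))))"
proof -
  have *: "cst (2 * \<i>) * cst (2 * \<i> * of_int (c + 1)) = cst (2 * \<i>) * cst (2 * \<i> * of_int c) - cst 4"
    unfolding cst_simps(2,6)[symmetric] by (rule arg_cong[where f=cst]) (simp add: algebra_simps)
  have "4 - cst (of_real s) + cst (2 * \<i>) * (Bgen v + cst (2 * \<i> * of_int (c + 1))) =
      - (cst (of_real s) - cst (2 * \<i>) * (Bgen v + cst (2 * \<i> * of_int c)))"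
    by (simp only: distrib_left * cst_numeral) simp
  then show ?thesis unfolding Phi_def
    by (simp only:) (intro A_unit_closed A_unit_minus A_unit_pole)
qed

lemma A_unit_sigma_plus: "A_unit s (sigma_plus s c (Bgen v))"
  unfolding sigma_plus_def by (intro A_unit_closed A_unit_beta A_unit_Phi)

lemma A_unit_pi_plus: "A_unit s (pi_plus s c (Bgen v))"
  unfolding pi_plus_def by (intro A_unit_closed A_unit_sigma_plus)

lemma alpha_A_min: "alpha j (Bgen v) \<in> A_min s"
  by (simp add: alpha_def A_min_closed cst_A_min Bgen_A_min)

lemma A_unitD: "A_unit s x \<Longrightarrow> x \<in> A_min s" "A_unit s x \<Longrightarrow> inverse x \<in> A_min s"
  by (simp_all add: A_unit_def)


section \<open>The fermionic maps over the coefficient ring\<close>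

abbreviation over_A where "over_A s \<equiv> coeffs_in (A_min s)"

lemmas over_A_closed = coeffs_in_closed[OF is_subring_A_min]

lemma is_linear_hat: "is_linear (hat f v)"
  unfolding hat_def by (rule is_linear_lin_ext)

lemma hat_bas_over_A:
  assumes "\<And>c t. f c (Bgen v) t \<in> over_A s"
  shows "hat f v (bas e) \<in> over_A s"
  unfolding hat_def lin_ext_bas Let_def
  by (intro over_A_closed A_min_closed) (use assms in \<open>auto simp: coeffs_in_def\<close>)

lemma hat_over_A:
  assumes "\<And>c t. f c (Bgen v) t \<in> over_A s" "x \<in> over_A s"
  shows "hat f v x \<in> over_A s"
  by (rule coeffs_in_is_linear[OF is_subring_A_min is_linear_hat hat_bas_over_A assms(2)]) (rule assms)

lemma one_pair_over_A: "Q1_plus s c (Bgen v) t \<in> over_A s" "h1_plus s c (Bgen v) t \<in> over_A s"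
  by (cases t; simp; intro over_A_closed A_min_closed cst_A_min A_unitD A_unit_pi_plus A_unit_beta)+

lemma Q_plus_over_A:
  fixes x :: "('l::{finite,linorder}, 'p::{finite,linorder}) fmod"
  shows "x \<in> over_A (s_q q m CARD('p)) \<Longrightarrow> Q_plus q m k x \<in> over_A (s_q q m CARD('p))"
  unfolding Q_plus_def by (intro over_A_closed hat_over_A one_pair_over_A)

lemma h_plus_over_A:
  fixes x :: "('l::{finite,linorder}, 'p::{finite,linorder}) fmod"
  shows "x \<in> over_A (s_q q m CARD('p)) \<Longrightarrow> h_plus q m k x \<in> over_A (s_q q m CARD('p))"
  unfolding h_plus_def by (intro over_A_closed hat_over_A one_pair_over_A cst_A_min)

lemma M_plus_over_A:
  fixes x :: "('l::{finite,linorder}, 'p::{finite,linorder}) fmod"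
  assumes "x \<in> over_A (s_q q m CARD('p))"
  shows "M_plus q m r k x \<in> over_A (s_q q m CARD('p))"
proof -
  have "proj_plus t \<in> A_min (s_q q m CARD('p))" for t :: fkind
    by (simp add: proj_plus_def A_min_closed)
  then have "M_plus_coeff q m r k e \<in> A_min (s_q q m CARD('p))" for e :: "('l, 'p) fidx"
    unfolding M_plus_coeff_def kappa_plus_def K_coeff_def
    by (intro A_min_closed cst_A_min alpha_A_min A_unitD(1)[OF A_unit_beta] A_unitD(1)[OF A_unit_sigma_plus])
  then show ?thesis using assms unfolding M_plus_def lin_ext_def
    by (intro coeffs_in_semilin_ext[OF is_subring_A_min] over_A_closed) auto
qed

lemma N_plus_over_A:
  fixes x :: "('l::{finite,linorder}, 'p::{finite,linorder}) fmod"
  assumes "x \<in> over_A (s_q q m CARD('p))"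
  shows "N_plus q m r k x \<in> over_A (s_q q m CARD('p))"
  unfolding N_plus_def by (intro over_A_closed h_plus_over_A M_plus_over_A assms)

lemma dag_F_over_A: "x \<in> over_A s \<Longrightarrow> dag_F x \<in> over_A s"
  unfolding dag_F_def
  by (intro coeffs_in_semilin_ext[OF is_subring_A_min] brat_cnj_A_min over_A_closed A_min_closed)

lemma N_minus_over_A:
  fixes x :: "('l::{finite,linorder}, 'p::{finite,linorder}) fmod"
  assumes "x \<in> over_A (s_q q m CARD('p))"
  shows "N_minus q m r k x \<in> over_A (s_q q m CARD('p))"
  unfolding N_minus_def by (intro dag_F_over_A N_plus_over_A assms)

lemma tensor_over_A: "y \<in> over_A s \<Longrightarrow> tensor cst x y \<in> over_A s"
  by (intro coeffs_in_tensor[OF is_subring_A_min] cst_A_min)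

lemma is_linear_graded_tensor: "is_linear (graded_tensor d X Y)"
  unfolding graded_tensor_def by (rule is_linear_lin_ext)

lemma graded_tensor_over_A:
  assumes "\<And>e. Y (bas e) \<in> over_A s" "x \<in> over_A s"
  shows "graded_tensor d X Y x \<in> over_A s"
proof (rule coeffs_in_is_linear[OF is_subring_A_min is_linear_graded_tensor _ assms(2)])
  show "graded_tensor d X Y (bas b) \<in> over_A s" for b
    by (cases b) (auto simp: graded_tensor_def intro!: over_A_closed tensor_over_A A_min_closed assms(1))
qed

lemma M_space_over_A:
  "(M_space q :: ('l::{finite,linorder}, 'm::{finite,linorder}, 'p::{finite,linorder}) tot set)
    = over_A (s_q q CARD('m) CARD('p))"
  by (simp add: M_space_def coeffs_in_def)

lemma is_linear_A_plus: "is_linear (A_plus q k)"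
  unfolding A_plus_def by (intro is_linear_plus is_linear_graded_tensor)

lemma A_plus_M_space: "x \<in> M_space q \<Longrightarrow> A_plus q k x \<in> M_space q"
  unfolding M_space_over_A A_plus_def
  by (intro over_A_closed(2) graded_tensor_over_A Q_plus_over_A over_A_closed(8)) auto

lemma dag_tot_M_space: "x \<in> M_space q \<Longrightarrow> dag_tot x \<in> M_space q"
  unfolding M_space_over_A dag_tot_def
  by (rule coeffs_in_semilin_ext[OF is_subring_A_min brat_cnj_A_min])
     (auto split: prod.splits intro!: tensor_over_A dag_F_over_A over_A_closed(8))

lemma A_minus_M_space: "x \<in> M_space q \<Longrightarrow> A_minus q k x \<in> M_space q"
  unfolding A_minus_def by (intro dag_tot_M_space A_plus_M_space)


section \<open>The transport maps are bijective\<close>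

definition tdeg :: "('l, 'm) pidx \<times> ('l, 'p) fidx \<Rightarrow> nat" where
  "tdeg b = cliff_parity (fst b)"

lemma tdeg_bound: "tdeg (b :: ('l, 'm::finite) pidx \<times> ('l, 'p) fidx) < Suc (2 * CARD('m))"
  unfolding tdeg_def by (rule cliff_parity_bound)

lemma inverse_fact_A_min: "inverse (of_nat (fact n)) \<in> A_min s"
  using cst_A_min[of "inverse (of_nat (fact n))" s] by (simp add: cst_inverse cst_of_nat del: of_nat_fact)

text \<open>\<open>Y i\<close> depends on the bosonic index because the fermionic operator reads an
  Euler degree off the monomial. \<open>X i\<close> lowers the Clifford degree, which is at most 2m,
  so the sum is nilpotent.\<close>

lemma exp_odd_tensor:
  fixes S :: "'i \<Rightarrow> ('l::{finite,linorder}, 'm::{finite,linorder}, 'p::{finite,linorder}) tot \<Rightarrow> ('l, 'm, 'p) tot"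
    and X :: "'i \<Rightarrow> ('l, 'm) pcl \<Rightarrow> ('l, 'm) pcl"
    and Y :: "'i \<Rightarrow> ('l, 'm) pidx \<Rightarrow> ('l, 'p) fmod \<Rightarrow> ('l, 'p) fmod"
  assumes S: "\<And>i. S i = lin_ext (\<lambda>(b, e). scl ((-1) ^ cliff_parity b) (tensor cst (X i (bas b)) (Y i b (bas e))))"
    and X: "\<And>i F d. F \<in> pfil (Suc d) \<Longrightarrow> X i F \<in> pfil d"
    and Y: "\<And>i b e. Y i b (bas e) \<in> over_A s"
  shows "is_linear (op_exp (\<lambda>x. \<Sum>i\<in>I. S i x))"
    and "bij_betw (op_exp (\<lambda>x. \<Sum>i\<in>I. S i x)) (over_A s) (over_A s)"
proof -
  let ?T = "\<lambda>x. \<Sum>i\<in>I. S i x"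
  have lin: "is_linear ?T" by (intro is_linear_Sum) (simp add: S is_linear_lin_ext)
  have A: "?T (bas b) \<in> over_A s" for b
    by (cases b) (auto simp: S intro!: over_A_closed tensor_over_A A_min_closed Y)
  have low: "tdeg b' < tdeg b" if b': "b' \<in> keys (?T (bas b))" for b b'
  proof -
    obtain i where "b' \<in> keys (S i (bas b))" using subsetD[OF keys_sum b'] by auto
    moreover obtain a e where b: "b = (a, e)" by (rule prod.exhaust)
    ultimately have "b' \<in> keys (tensor cst (X i (bas a)) (Y i a (bas e)))"
      using keys_scl by (fastforce simp: S)
    then have "fst b' \<in> keys (X i (bas a))" using subsetD[OF keys_tensor] by fastforce
    moreover have "X i (bas a) \<in> pfil (cliff_parity a)" by (intro X pfil_closed(4)) simp
    ultimately show ?thesis by (auto simp: tdeg_def b pfil_def)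
  qed
  have u: "unitriangular tdeg (op_exp ?T)"
    by (rule unitriangular_op_exp[OF lin low tdeg_bound])
  then show "is_linear (op_exp ?T)" by (simp add: unitriangular_def)
  have "op_exp ?T (bas b) \<in> over_A s" for b
    by (rule op_exp_coeffs_in[OF lin low tdeg_bound is_subring_A_min inverse_fact_A_min A over_A_closed(8)])
  then show "bij_betw (op_exp ?T) (over_A s) (over_A s)"
    by (rule unitriangular_bij_betw[OF u is_subring_A_min])
qed

lemma U_plus_linear_bij:
  shows "is_linear (U_plus q :: ('l::{finite,linorder}, 'm::{finite,linorder}, 'p::{finite,linorder}) tot \<Rightarrow> _)"
    and "bij_betw (U_plus q) (M_space q :: ('l, 'm, 'p) tot set) (M_space q)"
proof -
  note exp = exp_odd_tensor[where X=n_plus and Y="\<lambda>i b. N_plus q CARD('m) (zb_degree i (fst b)) i"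
      and S="H_plus q" and I=UNIV and s="s_q q CARD('m) CARD('p)"]
  show "is_linear (U_plus q :: ('l, 'm, 'p) tot \<Rightarrow> _)" unfolding U_plus_def
    by (rule exp(1)) (simp_all add: H_plus_def pfil_n_plus N_plus_over_A over_A_closed(8))
  show "bij_betw (U_plus q) (M_space q :: ('l, 'm, 'p) tot set) (M_space q)"
    unfolding U_plus_def M_space_over_A
    by (rule exp(2)) (simp_all add: H_plus_def pfil_n_plus N_plus_over_A over_A_closed(8))
qed

lemma U_minus_linear_bij:
  shows "is_linear (U_minus q :: ('l::{finite,linorder}, 'm::{finite,linorder}, 'p::{finite,linorder}) tot \<Rightarrow> _)"
    and "bij_betw (U_minus q) (M_space q :: ('l, 'm, 'p) tot set) (M_space q)"
proof -
  note exp = exp_odd_tensor[where X=n_minus and Y="\<lambda>i b. N_minus q CARD('m) (z_degree i (fst b)) i"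
      and S="H_minus q" and I=UNIV and s="s_q q CARD('m) CARD('p)"]
  show "is_linear (U_minus q :: ('l, 'm, 'p) tot \<Rightarrow> _)" unfolding U_minus_def
    by (rule exp(1)) (simp_all add: H_minus_def pfil_n_minus N_minus_over_A over_A_closed(8))
  show "bij_betw (U_minus q) (M_space q :: ('l, 'm, 'p) tot set) (M_space q)"
    unfolding U_minus_def M_space_over_A
    by (rule exp(2)) (simp_all add: H_minus_def pfil_n_minus N_minus_over_A over_A_closed(8))
qed

section \<open>The gauge on the full module\<close>

lemma graded_tensor_tensor:
  fixes u :: "('l::{finite,linorder}, 'm::{finite,linorder}) pcl"
    and e :: "('l, 'p::{finite,linorder}) fidx"
  assumes "is_linear X"
  shows "graded_tensor 0 X (\<lambda>y. y) (tensor cst u (bas e)) = tensor cst (X u) (bas e)"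
proof -
  have l: "tensor cst (u + v) y = tensor cst u y + tensor cst v y"
    "tensor cst (scl c u) y = scl (cst c) (tensor cst u y)" for u v :: "('l, 'm) pcl" and y :: "('l, 'p) fmod" and c
    by (rule poly_mapping_eqI; auto simp: lookup_tensor cst_simps lookup_add lookup_scl algebra_simps split_paired_all)+
  show ?thesis
  \<comment> \<open>u has complex coefficients and its image rational functions, so the comparison
    goes by additivity and singles rather than \<open>is_linear_eqI\<close>.\<close>
  proof (rule additive_eqI[where F="\<lambda>u. graded_tensor 0 X (\<lambda>y. y) (tensor cst u (bas e))"
        and G="\<lambda>u. tensor cst (X u) (bas e)"])
    show "graded_tensor 0 X (\<lambda>y. y) (tensor cst (single b c) (bas e)) = tensor cst (X (single b c)) (bas e)" for b c
      by (simp add: single_scl_bas[of b] l is_linearD[OF assms] is_linearD[OF is_linear_graded_tensor] tensor_bas cst_simps)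
         (simp add: graded_tensor_def scl_simps)
  qed (simp_all add: l is_linearD[OF assms] is_linearD[OF is_linear_graded_tensor])
qed

lemma graded_tensor_comp:
  fixes x :: "('l::{finite,linorder}, 'm::{finite,linorder}, 'p::{finite,linorder}) tot"
  assumes "is_linear X" "\<And>u. X (X' u) = u"
  shows "graded_tensor 0 X (\<lambda>y. y) (graded_tensor 0 X' (\<lambda>y. y) x) = x"
proof -
  have "graded_tensor 0 X (\<lambda>y. y) \<circ> graded_tensor 0 X' (\<lambda>y. y) = (\<lambda>x :: ('l, 'm, 'p) tot. x)"
  proof (intro is_linear_eqI is_linear_comp is_linear_graded_tensor is_linear_id)
    fix b :: "('l, 'm) pidx \<times> ('l, 'p) fidx"
    obtain a e where b: "b = (a, e)" by (rule prod.exhaust)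
    have "graded_tensor 0 X' (\<lambda>y. y) (bas b) = tensor cst (X' (bas a)) (bas e)"
      by (simp add: b graded_tensor_def scl_simps)
    then show "(graded_tensor 0 X (\<lambda>y. y) \<circ> graded_tensor 0 X' (\<lambda>y. y)) (bas b) = bas b"
      by (simp add: graded_tensor_tensor assms b tensor_bas cst_simps)
  qed
  then show ?thesis by (auto simp: fun_eq_iff)
qed

text \<open>\<open>G_PBW\<close> has complex matrix entries, so \<open>G_tot\<close> and the map
  built in the same way from the inverse of \<open>G_PBW\<close> both preserve
  \<open>M_space\<close>.\<close>

lemma G_tot_linear_bij:
  fixes q :: real
  assumes "0 < q" "q < 1" "CARD('m::{finite,linorder}) \<ge> 2 * CARD('l::{finite,linorder})"
  shows "is_linear (G_tot q :: ('l, 'm, 'p::{finite,linorder}) tot \<Rightarrow> _)"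
    and "bij_betw (G_tot q) (M_space q :: ('l, 'm, 'p) tot set) (M_space q)"
proof -
  show "is_linear (G_tot q :: ('l, 'm, 'p) tot \<Rightarrow> _)"
    unfolding G_tot_def by (rule is_linear_graded_tensor)
  have G: "is_linear (G_PBW q :: ('l, 'm) pcl \<Rightarrow> _)" "bij (G_PBW q :: ('l, 'm) pcl \<Rightarrow> _)"
    using G_PBW_linear_bij G_nf_linear_bij[OF assms(3,1,2)] by blast+
  have inv: "G_PBW q (inv (G_PBW q) u) = u" "inv (G_PBW q) (G_PBW q u) = u" for u :: "('l, 'm) pcl"
    using G(2) by (simp_all add: bij_is_surj surj_f_inv_f bij_is_inj)
  have M: "graded_tensor 0 X (\<lambda>y. y) x \<in> M_space q" if "x \<in> M_space q"
    for X and x :: "('l, 'm, 'p) tot"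
    using that unfolding M_space_over_A by (intro graded_tensor_over_A over_A_closed(8))
  show "bij_betw (G_tot q) (M_space q :: ('l, 'm, 'p) tot set) (M_space q)"
    unfolding G_tot_def
    by (rule bij_betw_byWitness[where f'="graded_tensor 0 (inv (G_PBW q)) (\<lambda>y. y)"])
       (auto simp: graded_tensor_comp G inv is_linear_inv M)
qed

section \<open>The conjugation argument on the module\<close>

theorem theorem6p1:
  fixes q :: real
    and i j :: "'l::{finite,linorder}"
    and x :: "('l, 'm::{finite,linorder}, 'p::{finite,linorder}) tot"
  assumes "0 < q" and "q < 1"
    and "CARD('m) \<ge> 2 * CARD('l)"
    and "x \<in> M_space q"
  shows "anticomm (D_plus q i) (D_minus q j) x =
    (G_tot q \<circ> M_inv q (U_plus q)
      \<circ> (\<lambda>y. L_seed q i j y + anticomm (A_plus q i) (Omega q j) y)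
      \<circ> U_plus q \<circ> M_inv q (G_tot q)) x"
proof -
  let ?M = "M_space q :: ('l, 'm, 'p) tot set"
  let ?U = "U_plus q :: ('l, 'm, 'p) tot \<Rightarrow> _" and ?V = "U_minus q :: ('l, 'm, 'p) tot \<Rightarrow> _"
    and ?G = "G_tot q :: ('l, 'm, 'p) tot \<Rightarrow> _" and ?R = "R_op q :: ('l, 'm, 'p) tot \<Rightarrow> _"
  note G = G_tot_linear_bij[OF assms(1-3), where 'p='p]
  have M_add: "a + b \<in> ?M" if "a \<in> ?M" "b \<in> ?M" for a b
    using that unfolding M_space_over_A by (rule over_A_closed)
  have M_inv: "M_inv q T y \<in> ?M" "T (M_inv q T y) = y" "M_inv q T (T y) = y"
    if "bij_betw T ?M ?M" "y \<in> ?M" for T y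
    using that bij_betw_imp_surj_on[OF that(1)]
    by (auto simp: M_inv_def inv_into_into f_inv_into_f bij_betw_inv_into_left)
  have maps: "T y \<in> ?M" if "bij_betw T ?M ?M" "y \<in> ?M" for T y
    using that by (rule bij_betw_apply)
  have R: "bij_betw ?R ?M ?M" unfolding R_op_def M_inv_def
    by (rule bij_betw_trans[OF bij_betw_inv_into[OF U_minus_linear_bij(2)] U_plus_linear_bij(2)])
  define y where "y = M_inv q ?G x"
  \<comment> \<open>The point U G^-1 x at which the bracket on the right-hand side is
    evaluated.\<close>
  define z where "z = ?U y"
  have y: "y \<in> ?M" unfolding y_def by (rule M_inv[OF G(2) assms(4)])
  have z: "z \<in> ?M" unfolding z_def by (rule maps[OF U_plus_linear_bij(2) y])
  have Rinv: "M_inv q ?R z = ?V y"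
  proof -
    have "?R (?V y) = z"
      by (simp add: R_op_def z_def M_inv(3)[OF U_minus_linear_bij(2) y])
    then show ?thesis using M_inv(3)[OF R maps[OF U_minus_linear_bij(2) y]] by simp
  qed
  \<comment> \<open>The two halves, at z, of the anticommutator of \<open>A_plus\<close> with the
    R-conjugate of \<open>A_minus\<close>.\<close>
  let ?a = "A_plus q i (?R (A_minus q j (M_inv q ?R z)))"
  let ?b = "?R (A_minus q j (M_inv q ?R (A_plus q i z)))"
  have Ui: "M_inv q ?U (?R u) = M_inv q ?V u" if "u \<in> ?M" for u
    unfolding R_op_def using M_inv(3)[OF U_plus_linear_bij(2) M_inv(1)[OF U_minus_linear_bij(2) that]] by simp
  have a: "?a \<in> ?M" and b: "?b \<in> ?M"
    by (intro A_plus_M_space A_minus_M_space maps[OF R] M_inv(1)[OF R] z)+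
  have D_minus: "D_minus q j x' = ?G (M_inv q ?V (A_minus q j (?V (M_inv q ?G x'))))"
    and D_plus: "D_plus q i x' = ?G (M_inv q ?U (A_plus q i (?U (M_inv q ?G x'))))" for x'
    by (simp_all add: D_minus_def D_plus_def)
  have "D_plus q i (D_minus q j x) = ?G (M_inv q ?U ?a)"
  proof -
    let ?w = "A_minus q j (?V y)"
    have w: "?w \<in> ?M" by (intro A_minus_M_space maps[OF U_minus_linear_bij(2)] y)
    have "?U (M_inv q ?V ?w) = ?R ?w" by (simp add: R_op_def)
    then show ?thesis
      by (simp add: D_plus D_minus M_inv(3)[OF G(2) M_inv(1)[OF U_minus_linear_bij(2) w]] Rinv flip: y_def)
  qed
  moreover have "D_minus q j (D_plus q i x) = ?G (M_inv q ?U ?b)"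
  proof -
    let ?w = "A_plus q i z"
    have w: "?w \<in> ?M" by (intro A_plus_M_space z)
    have Uw: "M_inv q ?U ?w \<in> ?M" by (rule M_inv(1)[OF U_plus_linear_bij(2) w])
    have "?R (?V (M_inv q ?U ?w)) = ?w"
      by (simp add: R_op_def M_inv(3)[OF U_minus_linear_bij(2) Uw] M_inv(2)[OF U_plus_linear_bij(2) w])
    then have "M_inv q ?R ?w = ?V (M_inv q ?U ?w)"
      using M_inv(3)[OF R maps[OF U_minus_linear_bij(2) Uw]] by simp
    moreover have "A_minus q j (M_inv q ?R ?w) \<in> ?M" by (intro A_minus_M_space M_inv(1)[OF R] w)
    ultimately show ?thesis
      by (simp add: D_plus D_minus M_inv(3)[OF G(2) Uw] Ui flip: y_def z_def)
  qed
  moreover have "?G (M_inv q ?U ?a) + ?G (M_inv q ?U ?b) = ?G (M_inv q ?U (?a + ?b))"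
  proof -
    \<comment> \<open>\<open>M_inv\<close> is a choice of preimages, so its additivity is read off
      from the linearity and injectivity of U.\<close>
    have "?U (M_inv q ?U ?a + M_inv q ?U ?b) = ?a + ?b"
      by (simp add: is_linearD[OF U_plus_linear_bij(1)] M_inv(2)[OF U_plus_linear_bij(2) a] M_inv(2)[OF U_plus_linear_bij(2) b])
    then have "M_inv q ?U (?a + ?b) = M_inv q ?U ?a + M_inv q ?U ?b"
      using M_inv(3)[OF U_plus_linear_bij(2) M_add[OF M_inv(1)[OF U_plus_linear_bij(2) a] M_inv(1)[OF U_plus_linear_bij(2) b]]] by simp
    then show ?thesis by (simp add: is_linearD[OF G(1)])
  qed
  \<comment> \<open>\<open>Omega\<close> subtracts the plain \<open>A_minus\<close> terms that
    \<open>L_seed\<close> contributes, so only the R-conjugates remain.\<close>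
  moreover have "L_seed q i j z + anticomm (A_plus q i) (Omega q j) z = ?a + ?b"
    by (simp add: L_seed_def anticomm_def Omega_def is_linearD[OF is_linear_A_plus])
  ultimately show ?thesis
    by (simp add: anticomm_def flip: y_def z_def)
qed

end
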